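(* Let $\psi$ be a nondecreasing Young function such that $\limsup_{x,y\to\infty}\psi(x)\psi(y)/\psi(cxy)<\infty$ for some constant $c$ and $\|\cdot\|_{L_1}\le\|\cdot\|_{L_\psi}$. Let $\rho$ be a semimetric on $\mathcal F$ and $\mathcal A$ a family of regular Borel subsets of $[0,1]$. Assume that $\mathbb Z_n^s(A,f)$, $(A,f)\in\mathcal A\times\mathcal F$, is separable for all $n$, and that: (i) there is a constant $C_1$ such that for all $A,B\in\mathcal A$ and $n\in\mathbb N$, $\sup_{f\in\mathcal F}\|\mathbb Z_n^s(A,f)-\mathbb Z_n^s(B,f)\|_{L_\psi}\le C_1\sqrt{\lambda(A\triangle B)}$; (ii) there is a constant $C_2$ such that for all $f,g\in\mathcal F$ and $n\in\mathbb N$, $\sup_{A\in\mathcal A}\|\mathbb Z_n^s(A,f)-\mathbb Z_n^s(A,g)\|_{L_\psi}\le C_2\rho(f,g)$; (iii) $\int_0^{\Delta_s}\psi^{-1}(N(\mathcal A\times\mathcal F,\tau_s,\varepsilon/2))\,d\varepsilon<\infty$. Then for every $\varepsilon>0$ there exists $\eta=\eta(\varepsilon)>0$ such that for all $n$, $\mathrm E\{\sup_{\tau_s((A,f),(B,g))<\eta}|\mathbb Z_n^s(A,f)-\mathbb Z_n^s(B,g)|\}<\varepsilon$; this implies that $\mathbb Z_n^s$ satisfies (AEC) with respect to $\tau_s$, so that convergence of the finite-dimensional marginals of $\mathbb Z_n^s$ to those of a tight Borel measurable limit implies weak convergence of $\mathbb Z_n^s$ to it in $\ell^\infty(\mathcal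 A\times\mathcal F)$. Furthermore, if $N(\mathcal A\times\mathcal F,\tau_s,\varepsilon)=O(\varepsilon^{-a})$ for some $a>0$ and $\psi(x)=x^p$ with $p>\max(a,1)$, then (iii) holds and (under (i), (ii)) there exists a continuous version $\tilde{\mathbb Z}_n^s$ of $\mathbb Z_n^s$ with almost all sample paths lying in the space $\mathcal C_u(\mathcal A\times\mathcal F;\mathbb R)$ of bounded uniformly continuous functions.
   Context: Let $(\Omega,\Upsilon,P)$ be a probability space, $(\mathcal X,\mathcal A_{\mathcal X})$ a measurable space, $(X_{i,n})_{1\le i\le n,\,n\in\mathbb N}$ an array of $\mathcal X$-valued random variables, and $\mathcal F$ a family of Borel measurable maps $\mathcal X\to\mathbb R$ with a finite measurable envelope $F$ ($\sup_f|f(x)|\le F(x)<\infty$, $\mathrm EF(X_{i,n})<\infty$). A Borel set $A\subset[0,1]$ is regular if $\lambda(\partial A)=0$, $\lambda$ Lebesgue measure. With $R_i=(i-1,i]$, the smoothed sequential empirical process is $\mathbb Z_n^s(A,f)=n^{-1/2}\sum_{i=1}^n\lambda(R_i\cap nA)(f(X_{i,n})-\mathrm Ef(X_{i,n}))$, $(A,f)\in\mathcal A\times\mathcal F$. The semimetric $\tau_s((A,f),(B,g))=\sqrt{\lambda(A\triangle B)}+\rho(f,g)$; $\Delta_s$ is the $\tau_s$-diameter of $\mathcal A\times\mathcal F$; $N(\mathcal A\times\mathcal F,\tau_s,\varepsilon)$ is the minimal number of open $\tau_s$-balls of radius $\varepsilon$ needed to cover $\mathcal A\times\mathcal F$. A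 Young function is a convex $\psi:[0,\infty)\to[0,\infty)$ with $\psi(0)=0$, $\psi\neq0$; $\|X\|_{L_\psi}=\inf\{c>0:\mathrm E\psi(|X|/c)\le1\}$. Separability means that the supremum $\sup_{\tau_s((A,f),(B,g))<\eta}|\mathbb Z_n^s(A,f)-\mathbb Z_n^s(B,g)|$ remains almost surely unchanged when $\mathcal A\times\mathcal F$ is replaced by a suitable countable subset. (AEC) w.r.t. a semimetric $\tau$: for every $\varepsilon>0$, $\lim_{\delta\downarrow0}\limsup_nP^*(\sup_{\tau((A,f),(B,g))\le\delta}|\mathbb Z_n^s(A,f)-\mathbb Z_n^s(B,g)|>\varepsilon)=0$, $P^*$ outer probability. Weak convergence in $\ell^\infty(\mathcal A\times\mathcal F)$ is in the Hoffmann-Jørgensen sense: $\mathrm E^*h(\mathbb Z_n^s)\to\mathrm Eh(\mathbb Z^s)$ for bounded continuous $h$, $\mathrm E^*$ outer expectation. *)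

theory Defs
  imports "HOL-Probability.Probability"
begin

definition Zs :: "'w measure \<Rightarrow> (nat \<Rightarrow> nat \<Rightarrow> 'w \<Rightarrow> 'x) \<Rightarrow> nat
                   \<Rightarrow> real set \<times> ('x \<Rightarrow> real) \<Rightarrow> 'w \<Rightarrow> real" where
  "Zs M X n Af \<omega> = (case Af of (A, f) \<Rightarrow>
     (1 / sqrt (real n)) *
     (\<Sum>i = 1..n. measure lborel ({real i - 1<..real i} \<inter> (\<lambda>x. real n * x) ` A)
                  * (f (X i n \<omega>) - integral\<^sup>L M (\<lambda>\<eta>. f (X i n \<eta>)))))"

definition symdiff :: "'a set \<Rightarrow> 'a set \<Rightarrow> 'a set" where
  "symdiff A B = (A - B) \<union> (B - A)"

definition tau_s :: "(('x \<Rightarrow> real) \<Rightarrow> ('x \<Rightarrow> real) \<Rightarrow> real)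
                     \<Rightarrow> real set \<times> ('x \<Rightarrow> real) \<Rightarrow> real set \<times> ('x \<Rightarrow> real) \<Rightarrow> real" where
  "tau_s \<rho> Af Bg = sqrt (measure lborel (symdiff (fst Af) (fst Bg))) + \<rho> (snd Af) (snd Bg)"

definition regular_set :: "real set \<Rightarrow> bool" where
  "regular_set A \<longleftrightarrow> A \<in> sets borel \<and> A \<subseteq> {0..1} \<and> measure lborel (frontier A) = 0"

definition semimetric_on :: "'a set \<Rightarrow> ('a \<Rightarrow> 'a \<Rightarrow> real) \<Rightarrow> bool" where
  "semimetric_on S d \<longleftrightarrow>
     (\<forall>x\<in>S. d x x = 0) \<and> (\<forall>x\<in>S. \<forall>y\<in>S. 0 \<le> d x y \<and> d x y = d y x) \<and>
     (\<forall>x\<in>S. \<forall>y\<in>S. \<forall>z\<in>S. d x z \<le> d x y + d y z)"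

definition young_function :: "(real \<Rightarrow> real) \<Rightarrow> bool" where
  "young_function \<psi> \<longleftrightarrow> convex_on {0..} \<psi> \<and> \<psi> 0 = 0 \<and> (\<forall>x\<ge>0. 0 \<le> \<psi> x) \<and> (\<exists>x\<ge>0. \<psi> x \<noteq> 0)"

text \<open>Orlicz norm ||Y||_{L_psi} = inf {c > 0. E psi(|Y|/c) <= 1} (infinite if no such c).\<close>
definition orlicz_norm :: "'w measure \<Rightarrow> (real \<Rightarrow> real) \<Rightarrow> ('w \<Rightarrow> real) \<Rightarrow> ennreal" where
  "orlicz_norm M \<psi> Y = Inf {ennreal c | c. 0 < c \<and> (\<integral>\<^sup>+ \<omega>. ennreal (\<psi> (\<bar>Y \<omega>\<bar> / c)) \<partial>M) \<le> 1}"

text \<open>Generalised inverse of a nondecreasing psi, extended by psi^-1(oo) = oo.\<close>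
definition psi_inv :: "(real \<Rightarrow> real) \<Rightarrow> ennreal \<Rightarrow> ennreal" where
  "psi_inv \<psi> y = Sup {ennreal x | x. 0 \<le> x \<and> ennreal (\<psi> x) \<le> y}"

definition covering_number :: "'a set \<Rightarrow> ('a \<Rightarrow> 'a \<Rightarrow> real) \<Rightarrow> real \<Rightarrow> enat" where
  "covering_number T d \<epsilon> =
     Inf {enat (card S) | S. finite S \<and> S \<subseteq> T \<and> T \<subseteq> (\<Union>s\<in>S. {t. d s t < \<epsilon>})}"

definition diameter_d :: "'a set \<Rightarrow> ('a \<Rightarrow> 'a \<Rightarrow> real) \<Rightarrow> ereal" where
  "diameter_d T d = Sup {ereal (d s t) | s t. s \<in> T \<and> t \<in> T}"

definition separable_process ::
  "'w measure \<Rightarrow> 'a set \<Rightarrow> ('a \<Rightarrow> 'a \<Rightarrow> real) \<Rightarrow> ('a \<Rightarrow> 'w \<Rightarrow> real) \<Rightarrow> bool" where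
  "separable_process M T d Z \<longleftrightarrow>
     (\<forall>\<eta>>0. \<exists>T0. T0 \<subseteq> T \<and> countable T0 \<and>
        (AE \<omega> in M. (SUP st\<in>{(s,t). s \<in> T \<and> t \<in> T \<and> d s t < \<eta>}.
                         ennreal \<bar>Z (fst st) \<omega> - Z (snd st) \<omega>\<bar>)
                   = (SUP st\<in>{(s,t). s \<in> T0 \<and> t \<in> T0 \<and> d s t < \<eta>}.
                         ennreal \<bar>Z (fst st) \<omega> - Z (snd st) \<omega>\<bar>)))"

definition outer_prob :: "'w measure \<Rightarrow> 'w set \<Rightarrow> real" where
  "outer_prob M S = Inf {measure M B | B. B \<in> sets M \<and> S \<inter> space M \<subseteq> B}"

definition outer_exp :: "'w measure \<Rightarrow> ('w \<Rightarrow> real) \<Rightarrow> real" where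
  "outer_exp M T = Inf {integral\<^sup>L M U | U. U \<in> borel_measurable M \<and> integrable M U \<and>
                                          (\<forall>\<omega>\<in>space M. T \<omega> \<le> U \<omega>)}"

definition linf_metric :: "'a set \<Rightarrow> ('a \<Rightarrow> real) metric" where
  "linf_metric T = funspace T euclidean_metric"

definition linf_top :: "'a set \<Rightarrow> ('a \<Rightarrow> real) topology" where
  "linf_top T = mtopology_of (linf_metric T)"

definition borel_of_top :: "'a topology \<Rightarrow> 'a measure" where
  "borel_of_top X = sigma (topspace X) {U. openin X U}"

end

theory Submission
  imports Defs
begin

text \<open>
  Chaining with expectations only: if \<open>E \<psi>(|Y\<^sub>i| / c) \<le> 1\<close> for \<open>m\<close> variables, then Jensen's
  inequality gives \<open>E max |Y\<^sub>i| \<le> c \<psi>\<^sup>-\<^sup>1(m)\<close>. Conditions (i) and (ii) say that increments over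
  \<open>\<tau>\<^sub>s\<close>-distance less than \<open>r\<close> satisfy this with \<open>c = C r\<close>. Linking nets of mesh \<open>\<delta> / 2^k\<close>, the
  cost of all links beyond level \<open>k\<^sub>0\<close> is a tail of a series dominated by the entropy integral. What
  remains are the finitely many pairs of level-\<open>k\<^sub>0\<close> chain ends; each such pair is compared with one
  fixed pair of points at distance less than \<open>\<eta>\<close>, so its contribution vanishes as \<open>\<eta> \<rightarrow> 0\<close>.
  The bound does not depend on \<open>n\<close>.

  For the weak limit, bounded continuous functionals are approximated from above by Lipschitz ones,
  and the process by its values on a finite net. The same approximation of the limit is controlled
  by convergence of the marginals, because on a compact subset of \<open>\<ell>\<^sup>\<infinity>\<close> the distance to the
  discretised path is attained, up to a small error, on a fixed finite set of indices.

  The process is its own continuous version: by separability its modulus of continuity is almost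
  surely a countable supremum, and it tends to \<open>0\<close> because its expectation does.
\<close>

subsection \<open>The maximal inequality\<close>

text \<open>Two points closer than \<open>\<eta>\<close> may have chain ends about a coarse mesh
  apart. A maximum over all pairs of ends at that scale would cost the mesh times
  \<open>psi_inv\<close> of the squared net size, while the entropy integral measures
  \<open>psi_inv\<close> of the net size itself. Passing through one representative pair per pair of
  ends turns this cost into a fixed number of terms of order \<open>\<eta>\<close>; the price is
  four chains in place of two, whence the factor 4 in the bounds. The order of choices gives
  uniformity: the nets, \<open>k0\<close> and \<open>\<eta>\<close> depend only on the entropy,
  \<open>C\<close> and \<epsilon>, and only the depth \<open>m\<close> of the chains depends on the
  finite set over which the supremum is taken. Suprema over uncountable index sets need not be
  measurable, so chaining is done on finite sets, monotone convergence passes to countable ones, and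
  separability to the whole index set. For the weak limit a one-sided asymptotic bound suffices, as
  it is applied to \<open>h\<close> and to \<open>- h\<close>.\<close>

lemma young_functionD:
  assumes "young_function \<psi>"
  shows "convex_on {0..} \<psi>" "\<psi> 0 = 0" "\<And>x. 0 \<le> x \<Longrightarrow> 0 \<le> \<psi> x"
  using assms unfolding young_function_def by blast+

text \<open>The even extension makes the domain open, where convexity yields continuity and Jensen's
  inequality applies with \<open>I = UNIV\<close>. Monotonicity is what allows the triangle
  inequality inside \<psi>.\<close>

lemma convex_on_abs_UNIV:
  fixes \<psi> :: "real \<Rightarrow> real"
  assumes "convex_on {0..} \<psi>" "mono_on {0..} \<psi>"
  shows "convex_on UNIV (\<lambda>x. \<psi> \<bar>x\<bar>)"
  unfolding convex_on_def
proof (intro conjI ballI allI impI)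
  fix x y u v :: real assume uv: "0 \<le> u" "0 \<le> v" "u + v = 1"
  have "\<bar>u *\<^sub>R x + v *\<^sub>R y\<bar> \<le> u * \<bar>x\<bar> + v * \<bar>y\<bar>"
    using uv by (simp add: abs_mult order_trans[OF abs_triangle_ineq])
  then have "\<psi> \<bar>u *\<^sub>R x + v *\<^sub>R y\<bar> \<le> \<psi> (u * \<bar>x\<bar> + v * \<bar>y\<bar>)"
    using uv by (intro mono_onD[OF assms(2)]) auto
  also have "\<dots> \<le> u * \<psi> \<bar>x\<bar> + v * \<psi> \<bar>y\<bar>"
    using assms(1) uv unfolding convex_on_def by auto
  finally show "\<psi> \<bar>u *\<^sub>R x + v *\<^sub>R y\<bar> \<le> u * \<psi> \<bar>x\<bar> + v * \<psi> \<bar>y\<bar>" .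
qed auto

lemma borel_measurable_young_abs:
  fixes \<psi> :: "real \<Rightarrow> real"
  assumes "young_function \<psi>" "mono_on {0..} \<psi>"
  shows "(\<lambda>x. \<psi> \<bar>x\<bar>) \<in> borel_measurable borel"
  using convex_on_continuous[OF open_UNIV convex_on_abs_UNIV[OF young_functionD(1)[OF assms(1)] assms(2)]]
  by (rule borel_measurable_continuous_onI)

lemma psi_inv_mono: "x \<le> y \<Longrightarrow> psi_inv \<psi> x \<le> psi_inv \<psi> y"
  unfolding psi_inv_def by (rule Sup_subset_mono) (auto intro: order_trans)

text \<open>This value is what lets finiteness of the entropy integral force finite covering
  numbers.\<close>

lemma psi_inv_top: "psi_inv \<psi> \<top> = \<top>"
proof -
  have "ennreal (real n) \<le> psi_inv \<psi> \<top>" for n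
    unfolding psi_inv_def by (rule Sup_upper) auto
  then show ?thesis
    using SUP_least[of UNIV "of_nat :: nat \<Rightarrow> ennreal" "psi_inv \<psi> \<top>"]
    unfolding ennreal_SUP_of_nat_eq_top by (simp add: ennreal_of_nat_eq_real_of_nat top_unique)
qed

text \<open>Convexity with value 0 at 0 forces at least linear growth beyond a point where \<psi> is
  positive, so the sublevel sets of \<psi> are bounded.\<close>

lemma psi_inv_finite:
  assumes \<psi>: "young_function \<psi>" "mono_on {0..} \<psi>" and y: "y < \<top>"
  shows "psi_inv \<psi> y < \<top>"
proof -
  obtain x0 where x0: "x0 \<ge> 0" "\<psi> x0 \<noteq> 0" using \<psi> by (auto simp: young_function_def)
  with young_functionD(2,3)[OF \<psi>(1)] have pos: "x0 > 0" "\<psi> x0 > 0"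
    by (force simp: less_le)+
  obtain r where r: "y = ennreal r" "r \<ge> 0" using y by (cases y) auto
  \<comment> \<open>To the right of \<open>x0\<close>, \<psi> lies above the line through the origin
    and \<open>(x0, \<psi> x0)\<close>, which reaches the height \<open>r\<close> at
    \<open>(r / \<psi> x0) * x0\<close>. The maximum with 1 keeps \<open>b * x0\<close> from falling
    to the left of \<open>x0\<close>.\<close>
  define b where "b = max 1 (r / \<psi> x0)"
  have "x \<le> b * x0" if x: "0 \<le> x" "ennreal (\<psi> x) \<le> y" for x
  proof (rule ccontr)
    assume "\<not> ?thesis"
    then have gt: "x > b * x0" by simp
    have b1: "b \<ge> 1" by (simp add: b_def)
    then have xx: "x > x0" using gt pos mult_right_mono[OF b1, of x0] by linarith
    have "\<psi> x0 = \<psi> ((1 - x0/x) *\<^sub>R 0 + (x0/x) *\<^sub>R x)" using xx pos by simp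
    also have "\<dots> \<le> (1 - x0/x) * \<psi> 0 + (x0/x) * \<psi> x"
      using xx pos young_functionD(1)[OF \<psi>(1)] by (intro convex_onD) auto
    finally have "\<psi> x0 * x \<le> x0 * \<psi> x"
      using xx pos young_functionD(2)[OF \<psi>(1)] by (simp add: field_simps)
    moreover have "\<psi> x \<le> r" using x r by (simp add: ennreal_le_iff)
    then have "x0 * \<psi> x \<le> x0 * r" using pos by (intro mult_left_mono) auto
    moreover have "r / \<psi> x0 \<le> b" by (simp add: b_def)
    then have "r \<le> b * \<psi> x0" using pos by (simp add: field_simps)
    then have "x0 * r \<le> x0 * (b * \<psi> x0)" using pos by (intro mult_left_mono) auto
    moreover have "\<psi> x0 * (b * x0) < \<psi> x0 * x" using gt pos by (intro mult_strict_left_mono) auto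
    ultimately show False by (simp add: mult_ac)
  qed
  then have "psi_inv \<psi> y \<le> ennreal (b * x0)"
    unfolding psi_inv_def by (intro Sup_least) (auto intro!: ennreal_leI)
  then show ?thesis using ennreal_less_top le_less_trans by blast
qed

text \<open>On each path the maximum \<open>m\<close> is one of the \<open>\<bar>Y i\<bar>\<close>,
  so \<open>\<psi> (m / c)\<close> is at most the sum of the individual terms, whose mean is at most
  \<open>card I\<close>. After Jensen, the mean of \<open>m / c\<close> is itself a member of the
  set whose supremum defines \<open>psi_inv\<close>.\<close>

lemma (in prob_space) maximal_inequality:
  fixes Y :: "'i \<Rightarrow> 'a \<Rightarrow> real"
  assumes \<psi>: "young_function \<psi>" "mono_on {0..} \<psi>" and fin: "finite I" and c: "0 < c"
    and int: "\<And>i. i \<in> I \<Longrightarrow> integrable M (Y i)"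
    and bd: "\<And>i. i \<in> I \<Longrightarrow> (\<integral>\<^sup>+\<omega>. ennreal (\<psi> (\<bar>Y i \<omega>\<bar> / c)) \<partial>M) \<le> 1"
  shows "(\<integral>\<^sup>+\<omega>. (SUP i\<in>I. ennreal \<bar>Y i \<omega>\<bar>) \<partial>M) \<le> ennreal c * psi_inv \<psi> (of_nat (card I))"
proof (cases "I = {}")
  case True
  then show ?thesis by (simp add: bot_ennreal)
next
  case False
  define m where "m \<omega> = Max ((\<lambda>i. \<bar>Y i \<omega>\<bar>) ` I)" for \<omega>
  have mge: "\<bar>Y i \<omega>\<bar> \<le> m \<omega>" if "i \<in> I" for i \<omega>
    unfolding m_def using fin that by auto
  have min: "\<exists>i\<in>I. m \<omega> = \<bar>Y i \<omega>\<bar>" for \<omega>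
    unfolding m_def using Max_in[OF finite_imageI[OF fin], of "\<lambda>i. \<bar>Y i \<omega>\<bar>"] False by (simp add: image_iff)
  have m0: "0 \<le> m \<omega>" for \<omega> using min[of \<omega>] by auto
  have [measurable]: "Y i \<in> borel_measurable M" if "i \<in> I" for i using int that by auto
  have [measurable]: "(\<lambda>x. \<psi> \<bar>x\<bar>) \<in> borel_measurable borel"
    by (rule borel_measurable_young_abs[OF \<psi>])
  have mm[measurable]: "m \<in> borel_measurable M"
    unfolding m_def using fin by measurable
  have mint: "integrable M m"
  proof (rule Bochner_Integration.integrable_bound)
    show "integrable M (\<lambda>\<omega>. \<Sum>i\<in>I. \<bar>Y i \<omega>\<bar>)" using int by auto
    show "AE \<omega> in M. norm (m \<omega>) \<le> norm (\<Sum>i\<in>I. \<bar>Y i \<omega>\<bar>)"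
    proof (rule AE_I2)
      fix \<omega>
      obtain i where i: "i \<in> I" "m \<omega> = \<bar>Y i \<omega>\<bar>" using min by blast
      have "\<bar>Y i \<omega>\<bar> \<le> (\<Sum>i\<in>I. \<bar>Y i \<omega>\<bar>)" using i fin by (intro member_le_sum) auto
      then show "norm (m \<omega>) \<le> norm (\<Sum>i\<in>I. \<bar>Y i \<omega>\<bar>)" using i by simp
    qed
  qed measurable
  let ?q = "\<lambda>\<omega>. \<psi> \<bar>m \<omega> / c\<bar>"
  have qm: "?q \<in> borel_measurable M"
    using measurable_compose[of "\<lambda>\<omega>. m \<omega> / c" M borel "\<lambda>x. \<psi> \<bar>x\<bar>" borel] by simp
  have q0: "0 \<le> ?q \<omega>" for \<omega> using young_functionD(3)[OF \<psi>(1)] by simp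
  have "(\<integral>\<^sup>+\<omega>. ennreal (?q \<omega>) \<partial>M) \<le> (\<integral>\<^sup>+\<omega>. (\<Sum>i\<in>I. ennreal (\<psi> \<bar>Y i \<omega> / c\<bar>)) \<partial>M)"
  proof (rule nn_integral_mono)
    fix \<omega>
    obtain i where i: "i \<in> I" "m \<omega> = \<bar>Y i \<omega>\<bar>" using min by blast
    have "ennreal (\<psi> \<bar>Y i \<omega> / c\<bar>) \<le> (\<Sum>i\<in>I. ennreal (\<psi> \<bar>Y i \<omega> / c\<bar>))"
      using i fin by (intro member_le_sum) auto
    then show "ennreal (?q \<omega>) \<le> (\<Sum>i\<in>I. ennreal (\<psi> \<bar>Y i \<omega> / c\<bar>))" using i c by simp
  qed
  also have "\<dots> = (\<Sum>i\<in>I. \<integral>\<^sup>+\<omega>. ennreal (\<psi> \<bar>Y i \<omega> / c\<bar>) \<partial>M)"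
  proof (rule nn_integral_sum)
    fix i assume "i \<in> I"
    then show "(\<lambda>\<omega>. ennreal (\<psi> \<bar>Y i \<omega> / c\<bar>)) \<in> borel_measurable M"
      using measurable_compose[of "\<lambda>\<omega>. Y i \<omega> / c" M borel "\<lambda>x. \<psi> \<bar>x\<bar>" borel] by simp
  qed
  also have "\<dots> \<le> (\<Sum>i\<in>I. 1)"
    using bd c by (intro sum_mono) simp
  finally have qI: "(\<integral>\<^sup>+\<omega>. ennreal (?q \<omega>) \<partial>M) \<le> of_nat (card I)" by simp
  have qint: "integrable M ?q"
    using qm q0 le_less_trans[OF qI of_nat_less_top] by (intro integrableI_nonneg) auto
  have "\<psi> \<bar>expectation (\<lambda>\<omega>. m \<omega> / c)\<bar> \<le> expectation ?q"
    using mint qint convex_on_abs_UNIV[OF young_functionD(1)[OF \<psi>(1)] \<psi>(2)]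
    by (intro jensens_inequality[where I = UNIV and q = "\<lambda>x. \<psi> \<bar>x\<bar>"]) auto
  moreover have E0: "0 \<le> expectation (\<lambda>\<omega>. m \<omega> / c)" using m0 c by (simp add: integral_nonneg_AE)
  ultimately have "\<psi> (expectation (\<lambda>\<omega>. m \<omega> / c)) \<le> expectation ?q" by (simp only: abs_of_nonneg)
  then have "ennreal (\<psi> (expectation (\<lambda>\<omega>. m \<omega> / c))) \<le> (\<integral>\<^sup>+\<omega>. ennreal (?q \<omega>) \<partial>M)"
    using qint q0 by (subst nn_integral_eq_integral) (auto intro: ennreal_leI)
  then have "ennreal (\<psi> (expectation (\<lambda>\<omega>. m \<omega> / c))) \<le> of_nat (card I)" using qI by (rule order_trans)
  then have *: "ennreal (expectation (\<lambda>\<omega>. m \<omega> / c)) \<le> psi_inv \<psi> (of_nat (card I))"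
    unfolding psi_inv_def using E0 by (intro Sup_upper) auto
  have "(\<integral>\<^sup>+\<omega>. (SUP i\<in>I. ennreal \<bar>Y i \<omega>\<bar>) \<partial>M) \<le> (\<integral>\<^sup>+\<omega>. ennreal (m \<omega>) \<partial>M)"
    by (intro nn_integral_mono SUP_least ennreal_leI mge)
  also have "\<dots> = ennreal (expectation m)"
    using mint m0 by (intro nn_integral_eq_integral) auto
  also have "expectation m = c * expectation (\<lambda>\<omega>. m \<omega> / c)" using c by simp
  also have "ennreal \<dots> = ennreal c * ennreal (expectation (\<lambda>\<omega>. m \<omega> / c))"
    using c E0 by (intro ennreal_mult) auto
  also have "\<dots> \<le> ennreal c * psi_inv \<psi> (of_nat (card I))"
    using * by (intro mult_left_mono) auto
  finally show ?thesis .
qed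

section \<open>Orlicz balls in integral form\<close>

text \<open>Strictness avoids the question whether the infimum in the norm is attained: some
  admissible \<open>c'\<close> lies below \<open>c\<close>, and a larger scale only lowers the
  integrand.\<close>

lemma orlicz_norm_lessD:
  assumes \<psi>: "mono_on {0..} \<psi>" and less: "orlicz_norm M \<psi> Y < ennreal c"
  shows "(\<integral>\<^sup>+\<omega>. ennreal (\<psi> (\<bar>Y \<omega>\<bar> / c)) \<partial>M) \<le> 1"
proof -
  obtain c' where c': "ennreal c' < ennreal c" "0 < c'" "(\<integral>\<^sup>+\<omega>. ennreal (\<psi> (\<bar>Y \<omega>\<bar> / c')) \<partial>M) \<le> 1"
    using less unfolding orlicz_norm_def Inf_less_iff by auto
  then have "c' < c" by (simp add: ennreal_less_iff)
  then have "(\<integral>\<^sup>+\<omega>. ennreal (\<psi> (\<bar>Y \<omega>\<bar> / c)) \<partial>M) \<le> (\<integral>\<^sup>+\<omega>. ennreal (\<psi> (\<bar>Y \<omega>\<bar> / c')) \<partial>M)"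
    using c'(2) by (intro nn_integral_mono ennreal_leI mono_onD[OF \<psi>] divide_left_mono) auto
  then show ?thesis using c'(3) by (rule order_trans)
qed

text \<open>The triangle inequality of the Orlicz norm without norms: the normalised sum is
  dominated by a convex combination of the normalised summands, with weights
  \<open>a / (a + b)\<close> and \<open>b / (a + b)\<close>.\<close>

lemma orlicz_ball_add:
  assumes \<psi>: "young_function \<psi>" "mono_on {0..} \<psi>" and ab: "0 < a" "0 < b"
    and [measurable]: "Y1 \<in> borel_measurable M" "Y2 \<in> borel_measurable M"
    and Y1: "(\<integral>\<^sup>+\<omega>. ennreal (\<psi> (\<bar>Y1 \<omega>\<bar> / a)) \<partial>M) \<le> 1"
    and Y2: "(\<integral>\<^sup>+\<omega>. ennreal (\<psi> (\<bar>Y2 \<omega>\<bar> / b)) \<partial>M) \<le> 1"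
  shows "(\<integral>\<^sup>+\<omega>. ennreal (\<psi> (\<bar>Y1 \<omega> + Y2 \<omega>\<bar> / (a + b))) \<partial>M) \<le> 1"
proof -
  define u v where "u = a / (a + b)" and "v = b / (a + b)"
  have uv: "0 \<le> u" "0 \<le> v" "u + v = 1" using ab by (auto simp: u_def v_def simp flip: add_divide_distrib)
  have P: "(\<lambda>x. \<psi> \<bar>x\<bar>) \<in> borel_measurable borel" by (rule borel_measurable_young_abs[OF \<psi>])
  have m1: "(\<lambda>\<omega>. ennreal (\<psi> (\<bar>Y1 \<omega>\<bar> / a))) \<in> borel_measurable M"
    using measurable_compose[of "\<lambda>\<omega>. Y1 \<omega> / a" M borel _ borel, OF _ P] ab by simp
  have m2: "(\<lambda>\<omega>. ennreal (\<psi> (\<bar>Y2 \<omega>\<bar> / b))) \<in> borel_measurable M"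
    using measurable_compose[of "\<lambda>\<omega>. Y2 \<omega> / b" M borel _ borel, OF _ P] ab by simp
  have pt: "\<psi> (\<bar>Y1 \<omega> + Y2 \<omega>\<bar> / (a + b)) \<le> u * \<psi> (\<bar>Y1 \<omega>\<bar> / a) + v * \<psi> (\<bar>Y2 \<omega>\<bar> / b)" for \<omega>
  proof -
    have "\<bar>Y1 \<omega> + Y2 \<omega>\<bar> / (a + b) \<le> (\<bar>Y1 \<omega>\<bar> + \<bar>Y2 \<omega>\<bar>) / (a + b)"
      using ab by (intro divide_right_mono) auto
    also have "\<dots> = u *\<^sub>R (\<bar>Y1 \<omega>\<bar> / a) + v *\<^sub>R (\<bar>Y2 \<omega>\<bar> / b)"
      using ab by (simp add: u_def v_def add_divide_distrib)
    finally have "\<psi> (\<bar>Y1 \<omega> + Y2 \<omega>\<bar> / (a + b)) \<le> \<psi> (u *\<^sub>R (\<bar>Y1 \<omega>\<bar> / a) + v *\<^sub>R (\<bar>Y2 \<omega>\<bar> / b))"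
      using ab uv by (intro mono_onD[OF \<psi>(2)]) auto
    also have "\<dots> \<le> u * \<psi> (\<bar>Y1 \<omega>\<bar> / a) + v * \<psi> (\<bar>Y2 \<omega>\<bar> / b)"
      using young_functionD(1)[OF \<psi>(1)] uv ab unfolding convex_on_def
      by (metis abs_ge_zero atLeast_iff divide_nonneg_pos)
    finally show ?thesis .
  qed
  have "(\<integral>\<^sup>+\<omega>. ennreal (\<psi> (\<bar>Y1 \<omega> + Y2 \<omega>\<bar> / (a + b))) \<partial>M)
      \<le> (\<integral>\<^sup>+\<omega>. ennreal u * ennreal (\<psi> (\<bar>Y1 \<omega>\<bar> / a)) + ennreal v * ennreal (\<psi> (\<bar>Y2 \<omega>\<bar> / b)) \<partial>M)"
  proof (rule nn_integral_mono)
    fix \<omega>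
    have nn: "0 \<le> \<psi> (\<bar>Y1 \<omega>\<bar> / a)" "0 \<le> \<psi> (\<bar>Y2 \<omega>\<bar> / b)"
      using young_functionD(3)[OF \<psi>(1)] ab by auto
    have "ennreal u * ennreal (\<psi> (\<bar>Y1 \<omega>\<bar> / a)) + ennreal v * ennreal (\<psi> (\<bar>Y2 \<omega>\<bar> / b))
        = ennreal (u * \<psi> (\<bar>Y1 \<omega>\<bar> / a) + v * \<psi> (\<bar>Y2 \<omega>\<bar> / b))"
      using nn uv by (simp add: ennreal_mult ennreal_plus)
    then show "ennreal (\<psi> (\<bar>Y1 \<omega> + Y2 \<omega>\<bar> / (a + b)))
        \<le> ennreal u * ennreal (\<psi> (\<bar>Y1 \<omega>\<bar> / a)) + ennreal v * ennreal (\<psi> (\<bar>Y2 \<omega>\<bar> / b))"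
      using pt by (simp add: ennreal_leI)
  qed
  also have "\<dots> = ennreal u * (\<integral>\<^sup>+\<omega>. ennreal (\<psi> (\<bar>Y1 \<omega>\<bar> / a)) \<partial>M)
      + ennreal v * (\<integral>\<^sup>+\<omega>. ennreal (\<psi> (\<bar>Y2 \<omega>\<bar> / b)) \<partial>M)"
    using m1 m2 by (simp add: nn_integral_add nn_integral_cmult)
  also have "\<dots> \<le> ennreal u * 1 + ennreal v * 1"
    using Y1 Y2 by (intro add_mono mult_left_mono) auto
  also have "\<dots> = 1" using uv by (simp flip: ennreal_plus)
  finally show ?thesis .
qed

section \<open>Covering numbers and nets\<close>

lemma covering_number_antimono:
  assumes "\<epsilon> \<le> \<epsilon>'"
  shows "covering_number T d \<epsilon>' \<le> covering_number T d \<epsilon>"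
  unfolding covering_number_def
proof (intro Inf_superset_mono subsetI, elim CollectE exE conjE)
  fix N S assume *: "N = enat (card S)" "finite S" "S \<subseteq> T" "T \<subseteq> (\<Union>s\<in>S. {t. d s t < \<epsilon>})"
  moreover have "(\<Union>s\<in>S. {t. d s t < \<epsilon>}) \<subseteq> (\<Union>s\<in>S. {t. d s t < \<epsilon>'})"
    using assms by (intro UN_mono Collect_mono impI order_refl) simp
  ultimately show "N \<in> {enat (card S) |S. finite S \<and> S \<subseteq> T \<and> T \<subseteq> (\<Union>s\<in>S. {t. d s t < \<epsilon>'})}"
    by (intro CollectI exI[of _ S] conjI) (assumption | rule subset_trans)+
qed

text \<open>Finiteness excludes the empty set, whose infimum in \<open>enat\<close> is \<infinity>;
  a nonempty set of \<open>enat\<close> contains its infimum, so an optimal net exists.\<close>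

lemma covering_number_net:
  assumes "covering_number T d \<epsilon> < \<infinity>"
  obtains S where "finite S" "S \<subseteq> T" "\<And>t. t \<in> T \<Longrightarrow> \<exists>s\<in>S. d s t < \<epsilon>"
    "covering_number T d \<epsilon> = enat (card S)"
proof -
  define A where "A = {enat (card S) | S. finite S \<and> S \<subseteq> T \<and> T \<subseteq> (\<Union>s\<in>S. {t. d s t < \<epsilon>})}"
  have N: "covering_number T d \<epsilon> = Inf A" unfolding covering_number_def A_def ..
  then have "A \<noteq> {}" using assms unfolding Inf_enat_def by (auto split: if_splits)
  then have "Inf A \<in> A" using LeastI_ex[of "\<lambda>x. x \<in> A"] by (auto simp: Inf_enat_def)
  then obtain S where S: "Inf A = enat (card S)" "finite S" "S \<subseteq> T" "T \<subseteq> (\<Union>s\<in>S. {t. d s t < \<epsilon>})"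
    unfolding A_def mem_Collect_eq by (elim exE conjE)
  show thesis
  proof (rule that[of S])
    show "\<exists>s\<in>S. d s t < \<epsilon>" if "t \<in> T" for t using S(4) that by blast
  qed (use S N in auto)
qed

subsection \<open>Chaining\<close>

lemma ennreal_of_enat_mono: "m \<le> n \<Longrightarrow> ennreal_of_enat m \<le> ennreal_of_enat n"
  by (cases m; cases n) auto

text \<open>The integrand is nonincreasing, so on each dyadic block it is at least its value at the
  right end, and summing over the blocks compares the series with the integral. The radius
  \<open>\<epsilon> / 2\<close> in the integrand accounts for the \<open>Suc k\<close> in the
  series.\<close>

lemma entropy_series:
  assumes d: "semimetric_on T d" and ne: "T \<noteq> {}" and \<psi>: "young_function \<psi>" "mono_on {0..} \<psi>"
    and int: "(\<integral>\<^sup>+ \<epsilon> \<in> {\<epsilon>. 0 < \<epsilon> \<and> ereal \<epsilon> < diameter_d T d}.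
        psi_inv \<psi> (ennreal_of_enat (covering_number T d (\<epsilon> / 2))) \<partial>lborel) < \<infinity>"
  obtains \<delta> where "\<delta> > 0"
    "(\<Sum>k. ennreal (\<delta> / 2^k) * psi_inv \<psi> (ennreal_of_enat (covering_number T d (\<delta> / 2^Suc k)))) < \<infinity>"
proof (cases "diameter_d T d \<le> 0")
  \<comment> \<open>The range of integration is empty here and the integral carries no information.
    Instead one ball of any positive radius covers \<open>T\<close>, and the series is
    geometric.\<close>
  case True
  obtain t0 where t0: "t0 \<in> T" using ne by blast
  have d0: "d t0 t \<le> 0" if "t \<in> T" for t
  proof -
    have "ereal (d t0 t) \<le> diameter_d T d" unfolding diameter_d_def using t0 that by (intro Sup_upper) blast
    then show ?thesis using True order_trans by fastforce
  qed
  have N1: "covering_number T d \<epsilon> \<le> 1" if "\<epsilon> > 0" for \<epsilon>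
    unfolding covering_number_def
  proof (rule Inf_lower, intro CollectI exI[of _ "{t0}"] conjI)
    show "T \<subseteq> (\<Union>s\<in>{t0}. {t. d s t < \<epsilon>})" using d0 that by force
  qed (use t0 in \<open>auto simp: one_enat_def\<close>)
  have "psi_inv \<psi> (ennreal_of_enat (covering_number T d (1 / 2^Suc k))) \<le> psi_inv \<psi> 1" for k
    using ennreal_of_enat_mono[OF N1[of "1 / 2^Suc k"]] by (intro psi_inv_mono) simp
  then have "(\<Sum>k. ennreal (1 / 2^k) * psi_inv \<psi> (ennreal_of_enat (covering_number T d (1 / 2^Suc k))))
     \<le> (\<Sum>k. ennreal (1 / 2^k) * psi_inv \<psi> 1)"
    by (intro suminf_le mult_left_mono) auto
  also have "\<dots> = (\<Sum>k. ennreal (1 / 2^k)) * psi_inv \<psi> 1" by simp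
  also have "(\<Sum>k. ennreal (1 / 2^k)) = ennreal (\<Sum>k. 1 / 2^k)"
    using summable_geometric[of "1/2::real"] by (intro suminf_ennreal2) (auto simp: power_one_over)
  also have "\<dots> * psi_inv \<psi> 1 < \<infinity>"
    using psi_inv_finite[OF \<psi>, of 1] by (simp add: ennreal_mult_less_top)
  finally show thesis by (intro that[of 1]) auto
next
  case False
  \<comment> \<open>Staying strictly below the diameter puts every block \<open>A k\<close> inside
    the range of integration, also when the diameter is infinite.\<close>
  then obtain \<delta> where \<delta>: "0 < \<delta>" "ereal \<delta> < diameter_d T d"
    using ereal_dense2[of 0 "diameter_d T d"] by (auto simp: not_le)
  let ?D = "{\<epsilon>. 0 < \<epsilon> \<and> ereal \<epsilon> < diameter_d T d}"
  define g where "g \<epsilon> = psi_inv \<psi> (ennreal_of_enat (covering_number T d (\<epsilon> / 2)))" for \<epsilon>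
  define A where "A k = {\<delta> / 2^Suc k <.. \<delta> / 2^k}" for k
  have dis: "A i \<inter> A j = {}" if "i < j" for i j
  proof -
    have "\<delta> / 2^j \<le> \<delta> / 2^Suc i" using \<delta> that by (intro divide_left_mono power_increasing) auto
    then show ?thesis by (auto simp: A_def)
  qed
  then have disj: "disjoint_family A"
    unfolding disjoint_family_on_def by (metis Int_commute linorder_neqE_nat)
  have mono: "g \<epsilon>' \<le> g \<epsilon>" if "\<epsilon> \<le> \<epsilon>'" for \<epsilon> \<epsilon>'
    unfolding g_def using that by (intro psi_inv_mono ennreal_of_enat_mono covering_number_antimono) auto
  have A: "A k \<in> sets lborel" "emeasure lborel (A k) = ennreal (\<delta> / 2^Suc k)" for k
  proof -
    have "\<delta> / 2^Suc k \<le> \<delta> / 2^k" using \<delta> by (intro divide_left_mono power_increasing) auto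
    then have "emeasure lborel (A k) = ennreal (\<delta> / 2^k - \<delta> / 2^Suc k)"
      unfolding A_def by (rule emeasure_lborel_Ioc)
    also have "\<delta> / 2^k - \<delta> / 2^Suc k = \<delta> / 2^Suc k" by (simp add: field_simps)
    finally show "emeasure lborel (A k) = ennreal (\<delta> / 2^Suc k)" .
  qed (simp add: A_def)
  have "(\<Sum>k. ennreal (\<delta> / 2^Suc k) * g (\<delta> / 2^k)) = (\<Sum>k. \<integral>\<^sup>+x. g (\<delta> / 2^k) * indicator (A k) x \<partial>lborel)"
    by (simp only: nn_integral_cmult_indicator[OF A(1)] A(2) mult.commute[of "ennreal _"])
  also have "\<dots> = (\<integral>\<^sup>+x. (\<Sum>k. g (\<delta> / 2^k) * indicator (A k) x) \<partial>lborel)"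
    using A(1) by (intro nn_integral_suminf[symmetric]) simp
  also have "\<dots> \<le> (\<integral>\<^sup>+x. g x * indicator ?D x \<partial>lborel)"
  proof (rule nn_integral_mono)
    fix x
    show "(\<Sum>k. g (\<delta> / 2^k) * indicator (A k) x) \<le> g x * indicator ?D x"
    proof (cases "\<exists>k. x \<in> A k")
      case True
      then obtain k where k: "x \<in> A k" by blast
      have k1: "\<delta> / 2 ^ k \<le> \<delta> / 2^0" using \<delta> by (intro divide_left_mono power_increasing) auto
      have "0 < \<delta> / 2^Suc k" using \<delta> by simp
      then have x: "0 < x" "x \<le> \<delta> / 2^k" "x \<le> \<delta>" using k k1 unfolding A_def by auto
      then have "x \<in> ?D" using \<delta> by (auto intro: le_less_trans[of _ "ereal \<delta>"])
      then show ?thesis using mono[OF x(2)] by (simp add: suminf_cmult_indicator[OF disj k])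
    qed simp
  qed
  also have "\<dots> < \<infinity>" using int unfolding g_def .
  finally have fin: "(\<Sum>k. ennreal (\<delta> / 2^Suc k) * g (\<delta> / 2^k)) < \<infinity>" .
  \<comment> \<open>A block is half as long as its right end point, hence the factor 2.\<close>
  have "(\<Sum>k. ennreal (\<delta> / 2^k) * psi_inv \<psi> (ennreal_of_enat (covering_number T d (\<delta> / 2^Suc k))))
     = (\<Sum>k. 2 * (ennreal (\<delta> / 2^Suc k) * g (\<delta> / 2^k)))"
  proof (rule suminf_cong)
    fix k
    have "ennreal (\<delta> / 2^k) = ennreal (2 * (\<delta> / 2^Suc k))" by simp
    also have "\<dots> = 2 * ennreal (\<delta> / 2^Suc k)" using \<delta> by (subst ennreal_mult) auto
    finally show "ennreal (\<delta> / 2^k) * psi_inv \<psi> (ennreal_of_enat (covering_number T d (\<delta> / 2^Suc k)))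
      = 2 * (ennreal (\<delta> / 2^Suc k) * g (\<delta> / 2^k))"
      by (simp add: g_def mult_ac)
  qed
  also have "\<dots> = 2 * (\<Sum>k. ennreal (\<delta> / 2^Suc k) * g (\<delta> / 2^k))" by (rule ennreal_suminf_cmult)
  also have "\<dots> < \<infinity>" using fin by (simp add: ennreal_mult_less_top)
  finally show thesis using \<delta> by (intro that[of \<delta>]) auto
qed

text \<open>An infinite covering number at a dyadic scale would make one term of the series
  infinite; dyadic scales below \<epsilon> decide, since covering numbers grow as the radius
  shrinks.\<close>

lemma entropy_covering_finite:
  assumes d: "semimetric_on T d" and \<psi>: "young_function \<psi>" "mono_on {0..} \<psi>"
    and int: "(\<integral>\<^sup>+ \<epsilon> \<in> {\<epsilon>. 0 < \<epsilon> \<and> ereal \<epsilon> < diameter_d T d}.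
        psi_inv \<psi> (ennreal_of_enat (covering_number T d (\<epsilon> / 2))) \<partial>lborel) < \<infinity>"
    and \<epsilon>: "0 < \<epsilon>"
  shows "covering_number T d \<epsilon> < \<infinity>"
proof (cases "T = {}")
  case True
  have "covering_number T d \<epsilon> \<le> 0"
    unfolding covering_number_def
    by (rule Inf_lower, intro CollectI exI[of _ "{}"]) (simp add: True zero_enat_def)
  then show ?thesis by simp
next
  case False
  obtain \<delta> where \<delta>: "\<delta> > 0" and fin:
    "(\<Sum>k. ennreal (\<delta> / 2^k) * psi_inv \<psi> (ennreal_of_enat (covering_number T d (\<delta> / 2^Suc k)))) < \<infinity>"
    using entropy_series[OF d False \<psi> int] .
  obtain k where k: "(1/2)^k < \<epsilon> / \<delta>"
    using real_arch_pow_inv[of "\<epsilon> / \<delta>" "1/2"] \<epsilon> \<delta> by auto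
  have "\<delta> / 2^Suc k \<le> \<delta> / 2^k" using \<delta> by (intro divide_left_mono power_increasing) auto
  also have "\<delta> / 2^k \<le> \<epsilon>" using k \<delta> by (simp add: field_simps power_one_over)
  finally have "covering_number T d \<epsilon> \<le> covering_number T d (\<delta> / 2^Suc k)" by (rule covering_number_antimono)
  moreover have "covering_number T d (\<delta> / 2^Suc k) \<noteq> \<infinity>"
  proof
    let ?f = "\<lambda>k. ennreal (\<delta> / 2^k) * psi_inv \<psi> (ennreal_of_enat (covering_number T d (\<delta> / 2^Suc k)))"
    assume "covering_number T d (\<delta> / 2^Suc k) = \<infinity>"
    then have top: "?f k = \<top>"
      using \<delta> by (simp add: psi_inv_top ennreal_mult_eq_top_iff)
    have "sum ?f {k} \<le> suminf ?f" by (rule sum_le_suminf) auto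
    then have "\<top> \<le> suminf ?f" unfolding top[symmetric] by simp
    then show False using fin by (simp add: top_unique)
  qed
  then have "covering_number T d (\<delta> / 2^Suc k) < \<infinity>" by simp
  ultimately show ?thesis by (rule le_less_trans)
qed

lemma (in prob_space) nn_integral_abs_le_psi_inv:
  assumes \<psi>: "young_function \<psi>" "mono_on {0..} \<psi>" and c: "0 < c" and int: "integrable M Y"
    and bd: "(\<integral>\<^sup>+\<omega>. ennreal (\<psi> (\<bar>Y \<omega>\<bar> / c)) \<partial>M) \<le> 1"
  shows "(\<integral>\<^sup>+\<omega>. ennreal \<bar>Y \<omega>\<bar> \<partial>M) \<le> ennreal c * psi_inv \<psi> 1"
  using maximal_inequality[OF \<psi>, of "{()}" c "\<lambda>_. Y"] assms by simp

text \<open>\<open>T1\<close> enters only through its cardinality in the first term, which a deeper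
  level \<open>m\<close> can make small. The sum pays for one link per point of
  \<open>S (Suc i)\<close>, and the last term for the representative pairs.\<close>

lemma (in prob_space) chaining_finite:
  fixes Z :: "'t \<Rightarrow> 'a \<Rightarrow> real" and S :: "nat \<Rightarrow> 't set" and \<delta> :: "nat \<Rightarrow> real"
  assumes d: "semimetric_on T d" and \<psi>: "young_function \<psi>" "mono_on {0..} \<psi>" and C: "0 < C"
    and S: "\<And>k. finite (S k)" "\<And>k. S k \<subseteq> T" and \<delta>: "\<And>k. 0 < \<delta> k"
    and \<pi>: "\<And>k t. t \<in> T \<Longrightarrow> \<pi> k t \<in> S k" "\<And>k t. t \<in> T \<Longrightarrow> d (\<pi> k t) t < \<delta> k"
    and int: "\<And>t. t \<in> T \<Longrightarrow> integrable M (Z t)"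
    and inc: "\<And>s t r. s \<in> T \<Longrightarrow> t \<in> T \<Longrightarrow> d s t < r \<Longrightarrow>
       (\<integral>\<^sup>+\<omega>. ennreal (\<psi> (\<bar>Z s \<omega> - Z t \<omega>\<bar> / (C * r))) \<partial>M) \<le> 1"
    and T1: "finite T1" "T1 \<subseteq> T" and \<eta>: "0 < \<eta>"
  shows "(\<integral>\<^sup>+\<omega>. (SUP st\<in>{(s, t). s \<in> T1 \<and> t \<in> T1 \<and> d s t < \<eta>}. ennreal \<bar>Z (fst st) \<omega> - Z (snd st) \<omega>\<bar>) \<partial>M)
     \<le> 4 * (of_nat (card T1) * (ennreal (C * \<delta> m) * psi_inv \<psi> 1)
            + (\<Sum>i<m. ennreal (C * \<delta> i) * psi_inv \<psi> (of_nat (card (S (Suc i))))))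
       + of_nat (card (S 0 \<times> S 0)) * (ennreal (C * \<eta>) * psi_inv \<psi> 1)"
proof -
  define e where "e s t \<omega> = ennreal \<bar>Z s \<omega> - Z t \<omega>\<bar>" for s t \<omega>
  have tri: "e s u \<omega> \<le> e s t \<omega> + e t u \<omega>" for s t u \<omega>
    unfolding e_def by (simp flip: ennreal_plus)
  have sym: "e s t \<omega> = e t s \<omega>" for s t \<omega> by (simp add: e_def abs_minus_commute)
  have dsym: "d s t = d t s" if "s \<in> T" "t \<in> T" for s t using d that by (auto simp: semimetric_on_def)
  have Zm: "Z t \<in> borel_measurable M" if "t \<in> T" for t using int[OF that] by auto
  have em: "e s t \<in> borel_measurable M" if "s \<in> T" "t \<in> T" for s t
    unfolding e_def using Zm that by measurable
  have e_bd: "(\<integral>\<^sup>+\<omega>. e s t \<omega> \<partial>M) \<le> ennreal (C * r) * psi_inv \<psi> 1"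
    if "s \<in> T" "t \<in> T" "d s t < r" "0 < r" for s t r
    unfolding e_def using that C inc int by (intro nn_integral_abs_le_psi_inv[OF \<psi>]) auto
  have \<pi>T: "\<pi> k t \<in> T" if "t \<in> T" for k t using \<pi>(1) S(2) that by blast
  \<comment> \<open>\<open>q i\<close> descends from level \<open>i\<close> to level 0 by successive
    projections. The recursion takes the finest projection first, so the inductions below must keep
    the starting point \<open>u\<close> arbitrary.\<close>
  define q where "q = rec_nat (\<lambda>u. u) (\<lambda>i r u. r (\<pi> i u))"
  have q0: "q 0 u = u" and qS: "q (Suc i) u = q i (\<pi> i u)" for i u by (simp_all add: q_def)
  have q_in: "q i u \<in> S 0" if "u \<in> S i" for i u
    using that
  proof (induction i arbitrary: u)
    case (Suc i)
    then show ?case using \<pi>(1) S(2) by (metis qS subsetD)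
  qed (simp add: q0)
  \<comment> \<open>Bounding every link of a level by the largest one lets a single use of the
    maximal inequality serve all chains through that level.\<close>
  define L where "L k \<omega> = (SUP u\<in>S (Suc k). e u (\<pi> k u) \<omega>)" for k \<omega>
  have Lm: "L k \<in> borel_measurable M" for k
    unfolding L_def
  proof (rule borel_measurable_SUP)
    fix u assume "u \<in> S (Suc k)"
    then have "u \<in> T" using S(2) by blast
    then show "e u (\<pi> k u) \<in> borel_measurable M" by (intro em \<pi>T)
  qed (use S in \<open>auto intro: countable_finite\<close>)
  have L_bd: "(\<integral>\<^sup>+\<omega>. L k \<omega> \<partial>M) \<le> ennreal (C * \<delta> k) * psi_inv \<psi> (of_nat (card (S (Suc k))))" for k
    unfolding L_def e_def
  proof (rule maximal_inequality[OF \<psi> S(1)])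
    fix u assume "u \<in> S (Suc k)"
    then have u: "u \<in> T" using S by blast
    show "integrable M (\<lambda>\<omega>. Z u \<omega> - Z (\<pi> k u) \<omega>)" using int u \<pi>T by auto
    have "d u (\<pi> k u) < \<delta> k" using \<pi>(2)[OF u] dsym[OF u \<pi>T[OF u]] by simp
    then show "(\<integral>\<^sup>+ \<omega>. ennreal (\<psi> (\<bar>Z u \<omega> - Z (\<pi> k u) \<omega>\<bar> / (C * \<delta> k))) \<partial>M) \<le> 1"
      using u \<pi>T by (intro inc) auto
  qed (use C \<delta> in simp)
  have chain: "e u (q i u) \<omega> \<le> (\<Sum>j<i. L j \<omega>)" if "u \<in> S i" for u i \<omega>
    using that
  proof (induction i arbitrary: u)
    case 0
    then show ?case by (simp add: q0 e_def)
  next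
    case (Suc i)
    then have u: "u \<in> T" using S by blast
    have "e u (q (Suc i) u) \<omega> \<le> e u (\<pi> i u) \<omega> + e (\<pi> i u) (q i (\<pi> i u)) \<omega>"
      unfolding qS by (rule tri)
    also have "\<dots> \<le> L i \<omega> + (\<Sum>j<i. L j \<omega>)"
      using Suc.prems Suc.IH[OF \<pi>(1)[OF u]] by (intro add_mono) (auto simp: L_def intro: SUP_upper)
    finally show ?case by (simp add: add.commute)
  qed
  define \<theta> where "\<theta> s = q m (\<pi> m s)" for s
  have \<theta>S: "\<theta> s \<in> S 0" if "s \<in> T1" for s unfolding \<theta>_def using that T1 by (intro q_in \<pi>) auto
  \<comment> \<open>The hops from \<open>T1\<close> into the finest net are added up, not maximised:
    the resulting factor \<open>card T1\<close> is harmless because the mesh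
    \<open>\<delta> m\<close> can be chosen after \<open>T1\<close>.\<close>
  define W where "W \<omega> = (\<Sum>s\<in>T1. e s (\<pi> m s) \<omega>) + (\<Sum>i<m. L i \<omega>)" for \<omega>
  have W: "e s (\<theta> s) \<omega> \<le> W \<omega>" if s: "s \<in> T1" for s \<omega>
  proof -
    have "e s (\<theta> s) \<omega> \<le> e s (\<pi> m s) \<omega> + e (\<pi> m s) (q m (\<pi> m s)) \<omega>" unfolding \<theta>_def by (rule tri)
    also have "\<dots> \<le> W \<omega>"
      unfolding W_def using s T1
      by (intro add_mono chain \<pi>) (auto intro: member_le_sum[of s T1 "\<lambda>s. e s (\<pi> m s) \<omega>"])
    finally show ?thesis .
  qed
  have m1: "(\<lambda>\<omega>. \<Sum>s\<in>T1. e s (\<pi> m s) \<omega>) \<in> borel_measurable M"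
    using em \<pi>T T1 by (intro borel_measurable_sum) auto
  have m2: "(\<lambda>\<omega>. \<Sum>i<m. L i \<omega>) \<in> borel_measurable M" using Lm by (intro borel_measurable_sum) auto
  have Wm: "W \<in> borel_measurable M" unfolding W_def using m1 m2 by simp
  have "(\<integral>\<^sup>+\<omega>. W \<omega> \<partial>M) = (\<Sum>s\<in>T1. \<integral>\<^sup>+\<omega>. e s (\<pi> m s) \<omega> \<partial>M) + (\<Sum>i<m. \<integral>\<^sup>+\<omega>. L i \<omega> \<partial>M)"
    unfolding W_def using m1 m2 em \<pi>T T1 Lm by (simp add: nn_integral_add nn_integral_sum subset_iff)
  also have "\<dots> \<le> (\<Sum>s\<in>T1. ennreal (C * \<delta> m) * psi_inv \<psi> 1)
      + (\<Sum>i<m. ennreal (C * \<delta> i) * psi_inv \<psi> (of_nat (card (S (Suc i)))))"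
  proof (intro add_mono sum_mono L_bd)
    fix s assume "s \<in> T1"
    then have s: "s \<in> T" using T1 by auto
    then show "(\<integral>\<^sup>+\<omega>. e s (\<pi> m s) \<omega> \<partial>M) \<le> ennreal (C * \<delta> m) * psi_inv \<psi> 1"
      using \<pi>(2)[OF s] dsym[OF s \<pi>T[OF s]] \<pi>T \<delta> by (intro e_bd) auto
  qed
  finally have W_bd: "(\<integral>\<^sup>+\<omega>. W \<omega> \<partial>M) \<le> of_nat (card T1) * (ennreal (C * \<delta> m) * psi_inv \<psi> 1)
      + (\<Sum>i<m. ennreal (C * \<delta> i) * psi_inv \<psi> (of_nat (card (S (Suc i)))))" by simp
  define P where "P = {(s, t). s \<in> T1 \<and> t \<in> T1 \<and> d s t < \<eta>}"
  define \<Theta> where "\<Theta> p = (\<theta> (fst p), \<theta> (snd p))" for p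
  \<comment> \<open>\<open>inv_into\<close> selects one pair of \<open>P\<close> for each pair of
    chain ends that occurs, so the size of \<open>R\<close> is bounded by the coarsest net however
    large \<open>T1\<close> is.\<close>
  define R where "R = inv_into P \<Theta> ` (\<Theta> ` P)"
  have finP: "finite P" by (rule finite_subset[of _ "T1 \<times> T1"]) (auto simp: P_def T1)
  have \<Theta>P: "\<Theta> ` P \<subseteq> S 0 \<times> S 0" using \<theta>S by (auto simp: \<Theta>_def P_def)
  have finR: "finite R" unfolding R_def using finP by simp
  have "card R \<le> card (\<Theta> ` P)" unfolding R_def using finP by (intro card_image_le) simp
  also have "\<dots> \<le> card (S 0 \<times> S 0)" using \<Theta>P S(1) by (intro card_mono) auto
  finally have cardR: "card R \<le> card (S 0 \<times> S 0)" .
  have RP: "R \<subseteq> P" unfolding R_def by (rule image_subsetI) (rule inv_into_into)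
  define Q where "Q \<omega> = (\<Sum>p\<in>R. e (fst p) (snd p) \<omega>)" for \<omega>
  have Rem: "e (fst p) (snd p) \<in> borel_measurable M" if "p \<in> R" for p
  proof (rule em)
    have "p \<in> P" using that RP by blast
    then show "fst p \<in> T" "snd p \<in> T" using T1 by (auto simp: P_def)
  qed
  have "(\<integral>\<^sup>+\<omega>. Q \<omega> \<partial>M) = (\<Sum>p\<in>R. \<integral>\<^sup>+\<omega>. e (fst p) (snd p) \<omega> \<partial>M)"
    unfolding Q_def by (rule nn_integral_sum) (rule Rem)
  also have "\<dots> \<le> (\<Sum>p\<in>R. ennreal (C * \<eta>) * psi_inv \<psi> 1)"
  proof (intro sum_mono e_bd \<eta>)
    fix p assume "p \<in> R"
    then have "p \<in> P" using RP by blast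
    then show "fst p \<in> T" "snd p \<in> T" "d (fst p) (snd p) < \<eta>" using T1 by (auto simp: P_def)
  qed
  also have "\<dots> = of_nat (card R) * (ennreal (C * \<eta>) * psi_inv \<psi> 1)" by simp
  also have "\<dots> \<le> of_nat (card (S 0 \<times> S 0)) * (ennreal (C * \<eta>) * psi_inv \<psi> 1)"
    using cardR by (intro mult_right_mono) auto
  finally have Q_bd: "(\<integral>\<^sup>+\<omega>. Q \<omega> \<partial>M) \<le> of_nat (card (S 0 \<times> S 0)) * (ennreal (C * \<eta>) * psi_inv \<psi> 1)" .
  have Qm: "Q \<in> borel_measurable M" unfolding Q_def using Rem by (intro borel_measurable_sum) auto
  have main: "e (fst p) (snd p) \<omega> \<le> 4 * W \<omega> + Q \<omega>" if p: "p \<in> P" for p \<omega>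
  proof -
    define p' where "p' = inv_into P \<Theta> (\<Theta> p)"
    have p'R: "p' \<in> R" unfolding R_def p'_def using p by blast
    then have p'P: "p' \<in> P" using RP by blast
    have "\<Theta> p' = \<Theta> p" unfolding p'_def using p by (intro f_inv_into_f) blast
    then have eq: "\<theta> (fst p') = \<theta> (fst p)" "\<theta> (snd p') = \<theta> (snd p)" by (simp_all add: \<Theta>_def)
    have T1s: "fst p \<in> T1" "snd p \<in> T1" "fst p' \<in> T1" "snd p' \<in> T1" using p p'P by (auto simp: P_def)
    let ?s = "fst p" and ?t = "snd p" and ?s' = "fst p'" and ?t' = "snd p'"
    \<comment> \<open>The route goes from \<open>?s\<close> to its chain end, back up to
      \<open>?s'\<close>, which has the same end, across to \<open>?t'\<close>, down to the end that
      it shares with \<open>?t\<close>, and up to \<open>?t\<close>: four chains and one increment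
      counted in \<open>Q\<close>.\<close>
    have "e ?s ?t \<omega> \<le> e ?s (\<theta> ?s) \<omega> + (e (\<theta> ?s) ?s' \<omega> + (e ?s' ?t' \<omega> + (e ?t' (\<theta> ?t) \<omega> + e (\<theta> ?t) ?t \<omega>)))"
      by (intro order_trans[OF tri[of ?s ?t \<omega> "\<theta> ?s"]] order_trans[OF tri[of "\<theta> ?s" ?t \<omega> ?s']]
          order_trans[OF tri[of ?s' ?t \<omega> ?t']] add_left_mono tri)
    also have "\<dots> \<le> W \<omega> + (W \<omega> + (Q \<omega> + (W \<omega> + W \<omega>)))"
    proof (intro add_mono)
      show "e ?s' ?t' \<omega> \<le> Q \<omega>"
        unfolding Q_def using p'R finR by (intro member_le_sum[of p' R "\<lambda>p. e (fst p) (snd p) \<omega>"]) auto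
      show "e (\<theta> ?s) ?s' \<omega> \<le> W \<omega>" using W[OF T1s(3), of \<omega>] unfolding eq by (subst sym)
      show "e (\<theta> ?t) ?t \<omega> \<le> W \<omega>" using W[OF T1s(2), of \<omega>] by (subst sym)
      show "e ?t' (\<theta> ?t) \<omega> \<le> W \<omega>" using W[OF T1s(4), of \<omega>] unfolding eq .
    qed (rule W[OF T1s(1)])
    also have "\<dots> = (1 + 1 + 1 + 1) * W \<omega> + Q \<omega>" by (simp only: distrib_right mult_1 add.assoc add.commute add.left_commute)
    also have "(1 + 1 + 1 + 1 :: ennreal) = 4" by simp
    finally show ?thesis .
  qed
  have "(\<integral>\<^sup>+\<omega>. (SUP st\<in>P. ennreal \<bar>Z (fst st) \<omega> - Z (snd st) \<omega>\<bar>) \<partial>M) \<le> (\<integral>\<^sup>+\<omega>. 4 * W \<omega> + Q \<omega> \<partial>M)"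
    using main unfolding e_def by (intro nn_integral_mono SUP_least) auto
  also have "\<dots> = 4 * (\<integral>\<^sup>+\<omega>. W \<omega> \<partial>M) + (\<integral>\<^sup>+\<omega>. Q \<omega> \<partial>M)"
    using Wm Qm by (simp add: nn_integral_add nn_integral_cmult)
  also have "\<dots> \<le> 4 * (of_nat (card T1) * (ennreal (C * \<delta> m) * psi_inv \<psi> 1)
            + (\<Sum>i<m. ennreal (C * \<delta> i) * psi_inv \<psi> (of_nat (card (S (Suc i))))))
       + of_nat (card (S 0 \<times> S 0)) * (ennreal (C * \<eta>) * psi_inv \<psi> 1)"
    using W_bd Q_bd by (intro add_mono mult_left_mono) auto
  finally show ?thesis unfolding P_def .
qed

text \<open>One \<open>\<eta>\<close> serves every process \<open>Z\<close> with the increment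
  bound; applied to all \<open>Zs M X n\<close> at once, this is the uniformity in \<open>n\<close>.
  Two errors of \<open>\<epsilon> / 16\<close> with weight 4 and \<open>\<epsilon> / 4\<close> for
  the representative pairs add up to \<open>3 * \<epsilon> / 4\<close>.\<close>

lemma (in prob_space) chaining_uniform:
  fixes T :: "'t set"
  assumes d: "semimetric_on T d" and \<psi>: "young_function \<psi>" "mono_on {0..} \<psi>" and C: "0 < C"
    and ent: "(\<integral>\<^sup>+ \<epsilon> \<in> {\<epsilon>. 0 < \<epsilon> \<and> ereal \<epsilon> < diameter_d T d}.
        psi_inv \<psi> (ennreal_of_enat (covering_number T d (\<epsilon> / 2))) \<partial>lborel) < \<infinity>"
    and \<epsilon>: "0 < \<epsilon>"
  shows "\<exists>\<eta>>0. \<forall>Z :: 't \<Rightarrow> 'a \<Rightarrow> real.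
     (\<forall>t\<in>T. integrable M (Z t)) \<longrightarrow>
     (\<forall>s\<in>T. \<forall>t\<in>T. \<forall>r. d s t < r \<longrightarrow>
       (\<integral>\<^sup>+\<omega>. ennreal (\<psi> (\<bar>Z s \<omega> - Z t \<omega>\<bar> / (C * r))) \<partial>M) \<le> 1) \<longrightarrow>
     (\<forall>T1. finite T1 \<longrightarrow> T1 \<subseteq> T \<longrightarrow>
       (\<integral>\<^sup>+\<omega>. (SUP st\<in>{(s, t). s \<in> T1 \<and> t \<in> T1 \<and> d s t < \<eta>}. ennreal \<bar>Z (fst st) \<omega> - Z (snd st) \<omega>\<bar>) \<partial>M)
         \<le> ennreal \<epsilon>)"
proof (cases "T = {}")
  case True
  then show ?thesis by (auto intro!: exI[of _ 1] simp: bot_ennreal)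
next
  case False
  obtain \<delta> where \<delta>: "\<delta> > 0" and fin:
    "(\<Sum>k. ennreal (\<delta> / 2^k) * psi_inv \<psi> (ennreal_of_enat (covering_number T d (\<delta> / 2^Suc k)))) < \<infinity>"
    using entropy_series[OF d False \<psi> ent] .
  define N where "N k = covering_number T d (\<delta> / 2^k)" for k
  have Nfin: "N k < \<infinity>" for k
    unfolding N_def using \<delta> by (intro entropy_covering_finite[OF d \<psi> ent]) simp
  have "\<exists>S. finite S \<and> S \<subseteq> T \<and> (\<forall>t\<in>T. \<exists>s\<in>S. d s t < \<delta> / 2^k) \<and> N k = enat (card S)" for k
    by (rule covering_number_net[OF Nfin[of k, unfolded N_def]]) (unfold N_def, blast)
  then obtain S where S: "\<And>k. finite (S k)" "\<And>k. S k \<subseteq> T"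
      "\<And>k t. t \<in> T \<Longrightarrow> \<exists>s\<in>S k. d s t < \<delta> / 2^k" "\<And>k. N k = enat (card (S k))" by metis
  have "\<exists>p. \<forall>t\<in>T. p t \<in> S k \<and> d (p t) t < \<delta> / 2^k" for k
    by (rule bchoice) (use S(3) in blast)
  then obtain \<pi> where \<pi>: "\<And>k t. t \<in> T \<Longrightarrow> \<pi> k t \<in> S k" "\<And>k t. t \<in> T \<Longrightarrow> d (\<pi> k t) t < \<delta> / 2^k" by metis
  define a where "a k = ennreal (C * (\<delta> / 2^k)) * psi_inv \<psi> (of_nat (card (S (Suc k))))" for k
  have a_eq: "a k = ennreal C * (ennreal (\<delta> / 2^k) * psi_inv \<psi> (ennreal_of_enat (N (Suc k))))" for k
    unfolding a_def S(4) using C \<delta> ennreal_mult[of C "\<delta> / 2^k"]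
    by (simp add: mult.assoc)
  have "(\<Sum>k. a k) = ennreal C * (\<Sum>k. ennreal (\<delta> / 2^k) * psi_inv \<psi> (ennreal_of_enat (N (Suc k))))"
    unfolding a_eq by (rule ennreal_suminf_cmult)
  also have "\<dots> < \<infinity>" using fin unfolding N_def by (simp add: ennreal_mult_less_top)
  finally have asum: "(\<Sum>k. a k) < \<infinity>" .
  define b where "b k = enn2real (a k)" for k
  have ab: "a k = ennreal (b k)" for k
    using psi_inv_finite[OF \<psi> of_nat_less_top] unfolding b_def a_def
    by (simp add: ennreal_mult_less_top)
  have b0: "0 \<le> b k" for k by (simp add: b_def)
  have "summable b"
    using asum b0 unfolding ab by (intro summable_suminf_not_top) auto
  then obtain k0 where k0: "norm (\<Sum>i. b (i + k0)) < \<epsilon> / 16"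
    using suminf_exist_split[of "\<epsilon> / 16" b] \<epsilon> by auto
  have tail: "(\<Sum>i<m. a (i + k0)) \<le> ennreal (\<epsilon> / 16)" for m
  proof -
    have "(\<Sum>i<m. b (i + k0)) \<le> (\<Sum>i. b (i + k0))"
      using \<open>summable b\<close> b0 by (intro sum_le_suminf) (auto simp: summable_iff_shift)
    then have "(\<Sum>i<m. b (i + k0)) \<le> \<epsilon> / 16" using k0 by simp
    then show ?thesis unfolding ab using b0 by (simp add: sum_ennreal ennreal_leI)
  qed
  define c where "c = enn2real (psi_inv \<psi> 1)"
  have c: "psi_inv \<psi> 1 = ennreal c" "0 \<le> c"
    using psi_inv_finite[OF \<psi>, of 1] by (auto simp: c_def)
  define n where "n = real (card (S k0 \<times> S k0))"
  \<comment> \<open>Chosen so that the \<open>n\<close> possible representative pairs together cost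
    \<open>n * C * c * \<eta>\<close>, at most \<open>\<epsilon> / 4\<close>; the 1 guards against a
    zero denominator.\<close>
  define \<eta> where "\<eta> = \<epsilon> / (4 * (n * C * c + 1))"
  have n0: "0 \<le> n * C * c" using C c by (simp add: n_def)
  then have \<eta>: "0 < \<eta>" using \<epsilon> by (simp add: \<eta>_def)
  have "n * C * c * \<eta> \<le> \<epsilon> / 4"
    using n0 \<epsilon> unfolding \<eta>_def by (simp add: field_simps)
  then have \<eta>2: "of_nat (card (S k0 \<times> S k0)) * (ennreal (C * \<eta>) * psi_inv \<psi> 1) \<le> ennreal (\<epsilon> / 4)"
    unfolding c using C c \<eta>
    by (simp add: n_def mult_ac ennreal_leI flip: ennreal_of_nat_eq_real_of_nat ennreal_mult)
      (simp add: ennreal_of_nat_eq_real_of_nat mult_ac ennreal_leI flip: ennreal_mult)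
  show ?thesis
  proof (intro exI[of _ \<eta>] conjI \<eta> allI impI)
    fix Z :: "'t \<Rightarrow> 'a \<Rightarrow> real" and T1
    assume Z: "\<forall>t\<in>T. integrable M (Z t)"
      and inc: "\<forall>s\<in>T. \<forall>t\<in>T. \<forall>r. d s t < r \<longrightarrow>
         (\<integral>\<^sup>+\<omega>. ennreal (\<psi> (\<bar>Z s \<omega> - Z t \<omega>\<bar> / (C * r))) \<partial>M) \<le> 1"
      and T1: "finite T1" "T1 \<subseteq> T"
    \<comment> \<open>\<open>x\<close> is the total cost of the hops from \<open>T1\<close> at mesh
      \<open>\<delta>\<close>. Only now that \<open>T1\<close> is given is the depth
      \<open>m\<close> chosen, so that \<open>x / 2^m\<close> is negligible.\<close>
    define x where "x = real (card T1) * C * c * \<delta>"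
    have x0: "0 \<le> x" using C c \<delta> by (simp add: x_def)
    obtain m where m: "(1/2)^m < \<epsilon> / (16 * (x + 1))"
      using real_arch_pow_inv[of "\<epsilon> / (16 * (x + 1))" "1/2"] \<epsilon> x0 by auto
    have "x / 2^(m + k0) \<le> x / 2^m" using x0 by (intro divide_left_mono power_increasing) auto
    also have "\<dots> = x * (1/2)^m" by (simp add: power_one_over)
    also have "\<dots> \<le> x * (\<epsilon> / (16 * (x + 1)))" using m x0 by (intro mult_left_mono) auto
    also have "\<dots> \<le> \<epsilon> / 16" using x0 \<epsilon> by (simp add: field_simps)
    finally have m': "real (card T1) * (C * (\<delta> / 2^(m + k0)) * c) \<le> \<epsilon> / 16" by (simp add: x_def mult_ac)
    have "of_nat (card T1) * (ennreal (C * (\<delta> / 2^(m + k0))) * psi_inv \<psi> 1)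
       = ennreal (real (card T1) * (C * (\<delta> / 2^(m + k0)) * c))"
      unfolding c(1) using C c \<delta>
      by (simp add: ennreal_of_nat_eq_real_of_nat flip: ennreal_mult)
    then have m1: "of_nat (card T1) * (ennreal (C * (\<delta> / 2^(m + k0))) * psi_inv \<psi> 1) \<le> ennreal (\<epsilon> / 16)"
      using m' by (simp add: ennreal_leI)
    have "(\<integral>\<^sup>+\<omega>. (SUP st\<in>{(s, t). s \<in> T1 \<and> t \<in> T1 \<and> d s t < \<eta>}. ennreal \<bar>Z (fst st) \<omega> - Z (snd st) \<omega>\<bar>) \<partial>M)
      \<le> 4 * (of_nat (card T1) * (ennreal (C * (\<delta> / 2^(m + k0))) * psi_inv \<psi> 1)
            + (\<Sum>i<m. ennreal (C * (\<delta> / 2^(i + k0))) * psi_inv \<psi> (of_nat (card (S (Suc i + k0))))))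
       + of_nat (card (S (0 + k0) \<times> S (0 + k0))) * (ennreal (C * \<eta>) * psi_inv \<psi> 1)"
      \<comment> \<open>Shifting the nets by \<open>k0\<close> makes level \<open>k0\<close> the
        coarsest one, so only the tail of the series is paid.\<close>
      using Z inc T1 \<eta> C \<delta> S \<pi>
      by (intro chaining_finite[OF d \<psi> C, where S = "\<lambda>k. S (k + k0)" and \<delta> = "\<lambda>k. \<delta> / 2^(k + k0)"
            and \<pi> = "\<lambda>k. \<pi> (k + k0)"]) auto
    also have "\<dots> \<le> 4 * (ennreal (\<epsilon> / 16) + ennreal (\<epsilon> / 16)) + ennreal (\<epsilon> / 4)"
      using m1 tail[of m] \<eta>2 unfolding a_def by (intro add_mono mult_left_mono) auto
    also have "\<dots> = ennreal (4 * (\<epsilon> / 16 + \<epsilon> / 16) + \<epsilon> / 4)"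
      using \<epsilon> by (subst ennreal_plus, simp, simp, subst ennreal_mult, simp, simp, subst ennreal_plus) auto
    also have "\<dots> \<le> ennreal \<epsilon>" using \<epsilon> by (intro ennreal_leI) auto
    finally show "(\<integral>\<^sup>+\<omega>. (SUP st\<in>{(s, t). s \<in> T1 \<and> t \<in> T1 \<and> d s t < \<eta>}. ennreal \<bar>Z (fst st) \<omega> - Z (snd st) \<omega>\<bar>) \<partial>M)
         \<le> ennreal \<epsilon>" .
  qed
qed

subsection \<open>Oscillations of separable processes\<close>

text \<open>The modulus of continuity that occurs in \<open>separable_process\<close> and in the
  theorem. With values in \<open>ennreal\<close> the supremum needs no side condition on boundedness
  or on the index set.\<close>

definition osc :: "'t set \<Rightarrow> ('t \<Rightarrow> 't \<Rightarrow> real) \<Rightarrow> ('t \<Rightarrow> 'w \<Rightarrow> real) \<Rightarrow> real \<Rightarrow> 'w \<Rightarrow> ennreal" where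
  "osc T d Z \<eta> \<omega> = (SUP st\<in>{(s, t). s \<in> T \<and> t \<in> T \<and> d s t < \<eta>}. ennreal \<bar>Z (fst st) \<omega> - Z (snd st) \<omega>\<bar>)"

lemma osc_upper: "s \<in> T \<Longrightarrow> t \<in> T \<Longrightarrow> d s t < \<eta> \<Longrightarrow> ennreal \<bar>Z s \<omega> - Z t \<omega>\<bar> \<le> osc T d Z \<eta> \<omega>"
  unfolding osc_def by (rule SUP_upper2[of "(s, t)"]) auto

lemma osc_subset: "T1 \<subseteq> T2 \<Longrightarrow> osc T1 d Z \<eta> \<omega> \<le> osc T2 d Z \<eta> \<omega>"
  unfolding osc_def by (rule SUP_subset_mono) auto

lemma separable_processD:
  assumes "separable_process M T d Z" "0 < \<eta>"
  obtains T0 where "T0 \<subseteq> T" "countable T0" "AE \<omega> in M. osc T d Z \<eta> \<omega> = osc T0 d Z \<eta> \<omega>"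
  using assms unfolding separable_process_def osc_def by meson

lemma borel_measurable_osc_countable:
  assumes "countable T" "\<And>t. t \<in> T \<Longrightarrow> Z t \<in> borel_measurable M"
  shows "osc T d Z \<eta> \<in> borel_measurable M"
proof -
  have "countable {(s, t). s \<in> T \<and> t \<in> T \<and> d s t < \<eta>}"
    by (rule countable_subset[of _ "T \<times> T"]) (use assms in auto)
  then show ?thesis
    unfolding osc_def using assms(2) by (intro borel_measurable_SUP) auto
qed

text \<open>\<open>H\<close> is the supremum over a countable separant. It replaces
  \<open>osc\<close> in Markov's inequality, in infima and in integrable majorants, where
  measurability is indispensable.\<close>

lemma separable_process_osc_version:
  assumes "separable_process M T d Z" "0 < \<eta>" "\<And>t. t \<in> T \<Longrightarrow> Z t \<in> borel_measurable M"
  obtains H where "H \<in> borel_measurable M" "AE \<omega> in M. osc T d Z \<eta> \<omega> = H \<omega>"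
  using separable_processD[OF assms(1,2)] borel_measurable_osc_countable assms(3)
  by (metis subsetD)

text \<open>Enumerating the separant gives increasing finite sets, whose oscillations increase to
  the countable supremum, so monotone convergence preserves a bound common to all finite subsets.
  Almost sure equality is enough to replace \<open>osc T\<close>, which itself need not be
  measurable.\<close>

lemma nn_integral_osc_le:
  assumes sep: "separable_process M T d Z" and \<eta>: "0 < \<eta>"
    and meas: "\<And>t. t \<in> T \<Longrightarrow> Z t \<in> borel_measurable M"
    and bd: "\<And>T1. finite T1 \<Longrightarrow> T1 \<subseteq> T \<Longrightarrow> (\<integral>\<^sup>+\<omega>. osc T1 d Z \<eta> \<omega> \<partial>M) \<le> K"
  shows "(\<integral>\<^sup>+\<omega>. osc T d Z \<eta> \<omega> \<partial>M) \<le> K"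
proof -
  obtain T0 where T0: "T0 \<subseteq> T" "countable T0" and ae: "AE \<omega> in M. osc T d Z \<eta> \<omega> = osc T0 d Z \<eta> \<omega>"
    using separable_processD[OF sep \<eta>] .
  \<comment> \<open>The intersection with \<open>T0\<close> matters for empty \<open>T0\<close>,
    where \<open>from_nat_into\<close> returns an arbitrary element.\<close>
  define A where "A n = T0 \<inter> from_nat_into T0 ` {..<n}" for n
  have A: "finite (A n)" "A n \<subseteq> T" for n using T0 by (auto simp: A_def)
  have incA: "A m \<subseteq> A n" if "m \<le> n" for m n using that by (auto simp: A_def)
  have inA: "\<exists>n. \<forall>m\<ge>n. s \<in> A m" if "s \<in> T0" for s
    using that T0(2) by (intro exI[of _ "Suc (to_nat_on T0 s)"]) (auto simp: A_def image_iff intro!: bexI[of _ "to_nat_on T0 s"])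
  have eq: "osc T0 d Z \<eta> \<omega> = (SUP n. osc (A n) d Z \<eta> \<omega>)" for \<omega>
  proof (rule antisym)
    show "osc T0 d Z \<eta> \<omega> \<le> (SUP n. osc (A n) d Z \<eta> \<omega>)"
      unfolding osc_def[of T0]
    proof (rule SUP_least)
      fix st assume "st \<in> {(s, t). s \<in> T0 \<and> t \<in> T0 \<and> d s t < \<eta>}"
      then have st: "fst st \<in> T0" "snd st \<in> T0" "d (fst st) (snd st) < \<eta>" by auto
      obtain m n where "\<forall>k\<ge>m. fst st \<in> A k" "\<forall>k\<ge>n. snd st \<in> A k" using inA st by meson
      then have "fst st \<in> A (max m n)" "snd st \<in> A (max m n)" by auto
      from osc_upper[OF this, of d \<eta> Z \<omega>] st(3)
      show "ennreal \<bar>Z (fst st) \<omega> - Z (snd st) \<omega>\<bar> \<le> (SUP n. osc (A n) d Z \<eta> \<omega>)"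
        by (intro SUP_upper2[of "max m n"]) auto
    qed
    show "(SUP n. osc (A n) d Z \<eta> \<omega>) \<le> osc T0 d Z \<eta> \<omega>"
      by (intro SUP_least osc_subset) (auto simp: A_def)
  qed
  have "(\<integral>\<^sup>+\<omega>. osc T d Z \<eta> \<omega> \<partial>M) = (\<integral>\<^sup>+\<omega>. osc T0 d Z \<eta> \<omega> \<partial>M)"
    using ae by (rule nn_integral_cong_AE)
  also have "\<dots> = (SUP n. \<integral>\<^sup>+\<omega>. osc (A n) d Z \<eta> \<omega> \<partial>M)"
    unfolding eq
  proof (rule nn_integral_monotone_convergence_SUP)
    show "incseq (\<lambda>n \<omega>. osc (A n) d Z \<eta> \<omega>)"
      by (intro incseq_SucI le_funI osc_subset incA) simp
    show "osc (A n) d Z \<eta> \<in> borel_measurable M" for n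
      using A meas by (intro borel_measurable_osc_countable countable_finite) auto
  qed
  also have "\<dots> \<le> K" using bd A by (intro SUP_least) auto
  finally show ?thesis .
qed

lemma outer_prob_nonneg: "0 \<le> outer_prob M S"
  unfolding outer_prob_def by (rule cInf_greatest) (auto intro!: exI[of _ "space M"])

lemma outer_prob_le: "B \<in> sets M \<Longrightarrow> S \<inter> space M \<subseteq> B \<Longrightarrow> outer_prob M S \<le> measure M B"
  unfolding outer_prob_def by (rule cInf_lower) (auto intro!: bdd_belowI[of _ 0])

text \<open>Markov's inequality for the measurable version \<open>H\<close>; the null set where
  \<open>H\<close> differs from the oscillation is added to the covering event. The gap
  \<open>\<delta> < \<eta>\<close> reconciles the closed condition in the event with the open one in
  \<open>osc\<close>.\<close>

lemma (in prob_space) outer_prob_osc_le: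
  assumes sep: "separable_process M T d Z" and \<eta>: "0 < \<eta>"
    and meas: "\<And>t. t \<in> T \<Longrightarrow> Z t \<in> borel_measurable M"
    and bd: "(\<integral>\<^sup>+\<omega>. osc T d Z \<eta> \<omega> \<partial>M) \<le> ennreal (\<epsilon> * e)" and \<epsilon>: "0 < \<epsilon>" and e: "0 \<le> e" and \<delta>: "\<delta> < \<eta>"
  shows "outer_prob M {\<omega>. \<exists>s\<in>T. \<exists>t\<in>T. d s t \<le> \<delta> \<and> \<bar>Z s \<omega> - Z t \<omega>\<bar> > \<epsilon>} \<le> e"
proof -
  obtain H where H[measurable]: "H \<in> borel_measurable M" and ae: "AE \<omega> in M. osc T d Z \<eta> \<omega> = H \<omega>"
    using separable_process_osc_version[OF sep \<eta> meas] .
  obtain N where N: "N \<in> null_sets M" "{\<omega>\<in>space M. osc T d Z \<eta> \<omega> \<noteq> H \<omega>} \<subseteq> N"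
    using ae unfolding eventually_ae_filter by auto
  define B where "B = {\<omega>\<in>space M. 1 \<le> ennreal (1/\<epsilon>) * H \<omega>}"
  have Bs: "B \<in> sets M" unfolding B_def by measurable
  have "{\<omega>. \<exists>s\<in>T. \<exists>t\<in>T. d s t \<le> \<delta> \<and> \<bar>Z s \<omega> - Z t \<omega>\<bar> > \<epsilon>} \<inter> space M \<subseteq> B \<union> N"
  proof safe
    fix \<omega> s t assume \<omega>: "\<omega> \<in> space M" "\<omega> \<notin> N" and st: "s \<in> T" "t \<in> T" "d s t \<le> \<delta>" "\<epsilon> < \<bar>Z s \<omega> - Z t \<omega>\<bar>"
    have "ennreal \<epsilon> \<le> ennreal \<bar>Z s \<omega> - Z t \<omega>\<bar>" using st by (intro ennreal_leI) simp
    also have "\<dots> \<le> osc T d Z \<eta> \<omega>" using st \<delta> by (intro osc_upper) auto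
    also have "\<dots> = H \<omega>" using \<omega> N by auto
    finally have "ennreal (1/\<epsilon>) * ennreal \<epsilon> \<le> ennreal (1/\<epsilon>) * H \<omega>" by (intro mult_left_mono) auto
    moreover have "ennreal (1/\<epsilon>) * ennreal \<epsilon> = 1" using \<epsilon> by (simp flip: ennreal_mult)
    ultimately show "\<omega> \<in> B" using \<omega> by (simp add: B_def)
  qed
  then have "outer_prob M {\<omega>. \<exists>s\<in>T. \<exists>t\<in>T. d s t \<le> \<delta> \<and> \<bar>Z s \<omega> - Z t \<omega>\<bar> > \<epsilon>} \<le> measure M (B \<union> N)"
    using Bs N by (intro outer_prob_le) auto
  also have "measure M (B \<union> N) = measure M B" using Bs N by (simp add: measure_Un_null_set)
  also have "\<dots> \<le> e"
  proof -
    have "emeasure M B \<le> ennreal (1/\<epsilon>) * (\<integral>\<^sup>+\<omega>. H \<omega> * indicator (space M) \<omega> \<partial>M)"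
      unfolding B_def by (rule nn_integral_Markov_inequality) auto
    also have "(\<integral>\<^sup>+\<omega>. H \<omega> * indicator (space M) \<omega> \<partial>M) = (\<integral>\<^sup>+\<omega>. osc T d Z \<eta> \<omega> \<partial>M)"
      using ae by (intro nn_integral_cong_AE) (auto elim!: eventually_mono)
    also have "ennreal (1/\<epsilon>) * \<dots> \<le> ennreal (1/\<epsilon>) * ennreal (\<epsilon> * e)" using bd by (intro mult_left_mono) auto
    also have "\<dots> = ennreal e" using \<epsilon> e by (simp flip: ennreal_mult)
    finally show ?thesis using e by (simp add: emeasure_eq_measure)
  qed
  finally show ?thesis .
qed

text \<open>Along scales with mean oscillation below \<open>1 / Suc k\<close> the infimum of the
  versions \<open>H k\<close> has mean 0 and so vanishes almost surely. An infimum below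
  \<open>e\<close> means that one scale already serves as \<delta>, so no convergence along the
  scales has to be shown.\<close>

lemma AE_uniformly_continuous_paths:
  assumes sep: "separable_process M T d Z"
    and meas: "\<And>t. t \<in> T \<Longrightarrow> Z t \<in> borel_measurable M"
    and bd: "\<And>\<epsilon>. 0 < \<epsilon> \<Longrightarrow> \<exists>\<eta>>0. (\<integral>\<^sup>+\<omega>. osc T d Z \<eta> \<omega> \<partial>M) < ennreal \<epsilon>"
  shows "AE \<omega> in M. \<forall>e>0. \<exists>\<delta>>0. \<forall>s\<in>T. \<forall>t\<in>T. d s t < \<delta> \<longrightarrow> \<bar>Z s \<omega> - Z t \<omega>\<bar> < e"
proof -
  have "\<exists>\<eta> H. 0 < \<eta> \<and> (\<integral>\<^sup>+\<omega>. osc T d Z \<eta> \<omega> \<partial>M) < ennreal (1 / real (Suc k)) \<and>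
      H \<in> borel_measurable M \<and> (AE \<omega> in M. osc T d Z \<eta> \<omega> = H \<omega>)" for k
  proof -
    obtain \<eta> where \<eta>: "0 < \<eta>" "(\<integral>\<^sup>+\<omega>. osc T d Z \<eta> \<omega> \<partial>M) < ennreal (1 / real (Suc k))"
      using bd[of "1 / real (Suc k)"] by auto
    from separable_process_osc_version[OF sep \<eta>(1) meas] show ?thesis using \<eta> by metis
  qed
  then obtain \<eta> H where \<eta>: "\<And>k. 0 < \<eta> k"
      and int: "\<And>k. (\<integral>\<^sup>+\<omega>. osc T d Z (\<eta> k) \<omega> \<partial>M) < ennreal (1 / real (Suc k))"
      and H: "\<And>k. H k \<in> borel_measurable M" and ae: "\<And>k. AE \<omega> in M. osc T d Z (\<eta> k) \<omega> = H k \<omega>"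
    by metis
  have Im: "(\<lambda>\<omega>. INF k. H k \<omega>) \<in> borel_measurable M" using H by (intro borel_measurable_INF) auto
  have I_le: "(\<integral>\<^sup>+\<omega>. (INF k. H k \<omega>) \<partial>M) \<le> ennreal (1 / real (Suc k))" for k
  proof -
    have "(\<integral>\<^sup>+\<omega>. (INF k. H k \<omega>) \<partial>M) \<le> (\<integral>\<^sup>+\<omega>. H k \<omega> \<partial>M)"
      by (intro nn_integral_mono INF_lower) auto
    also have "\<dots> = (\<integral>\<^sup>+\<omega>. osc T d Z (\<eta> k) \<omega> \<partial>M)"
      using ae[of k] by (intro nn_integral_cong_AE) (auto elim!: eventually_mono)
    finally show ?thesis using int[of k] by simp
  qed
  have "(\<lambda>k. ennreal (1 / real (Suc k))) \<longlonglongrightarrow> ennreal 0"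
    using LIMSEQ_inverse_real_of_nat by (intro tendsto_ennrealI) (simp add: field_simps)
  then have "(\<integral>\<^sup>+\<omega>. (INF k. H k \<omega>) \<partial>M) \<le> ennreal 0"
    using I_le by (intro LIMSEQ_le_const) auto
  then have "AE \<omega> in M. (INF k. H k \<omega>) = 0" using Im by (simp add: nn_integral_0_iff_AE)
  moreover have "AE \<omega> in M. \<forall>k. osc T d Z (\<eta> k) \<omega> = H k \<omega>" using ae by (simp add: AE_all_countable)
  ultimately show ?thesis
  proof eventually_elim
    case (elim \<omega>)
    show ?case
    proof (intro allI impI)
      fix e :: real assume e: "e > 0"
      have "(INF k. H k \<omega>) < ennreal e" using elim e by simp
      then obtain k where k: "H k \<omega> < ennreal e" by (auto simp: INF_less_iff)
      have "\<bar>Z s \<omega> - Z t \<omega>\<bar> < e" if "s \<in> T" "t \<in> T" "d s t < \<eta> k" for s t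
      proof -
        have "ennreal \<bar>Z s \<omega> - Z t \<omega>\<bar> \<le> H k \<omega>" using osc_upper[where d = d and Z = Z and \<omega> = \<omega>, OF that] elim by simp
        then have "ennreal \<bar>Z s \<omega> - Z t \<omega>\<bar> < ennreal e" using k by (rule le_less_trans)
        then show ?thesis by (simp add: ennreal_less_iff)
      qed
      then show "\<exists>\<delta>>0. \<forall>s\<in>T. \<forall>t\<in>T. d s t < \<delta> \<longrightarrow> \<bar>Z s \<omega> - Z t \<omega>\<bar> < e" using \<eta> by blast
    qed
  qed
qed

subsection \<open>Bounded functions and outer expectations\<close>

lemma mspace_linf: "f \<in> mspace (linf_metric T) \<longleftrightarrow> f \<in> extensional T \<and> bounded (f ` T)"
  for f :: "'t \<Rightarrow> real"
  by (simp add: linf_metric_def Met_TC.fspace_def)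

lemma linf_coord_le:
  assumes "f \<in> mspace (linf_metric T)" "g \<in> mspace (linf_metric T)" "t \<in> T"
  shows "\<bar>f t - g t\<bar> \<le> mdist (linf_metric T) f g"
  using funspace_mdist_le[of f T euclidean_metric g "mdist (linf_metric T) f g"] assms
  unfolding linf_metric_def by (auto simp: dist_real_def)

lemma linf_mdist_le:
  assumes "f \<in> mspace (linf_metric T)" "g \<in> mspace (linf_metric T)" "0 \<le> a"
    and "\<And>t. t \<in> T \<Longrightarrow> \<bar>f t - g t\<bar> \<le> a"
  shows "mdist (linf_metric T) f g \<le> a"
proof (cases "T = {}")
  case True
  then show ?thesis using assms(3) by (simp add: linf_metric_def)
next
  case False
  then show ?thesis
    using funspace_mdist_le[of f T euclidean_metric g a] assms
    unfolding linf_metric_def by (auto simp: dist_real_def)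
qed

lemma Lipschitz_linf_continuous:
  assumes "\<And>x y. x \<in> mspace (linf_metric T) \<Longrightarrow> y \<in> mspace (linf_metric T) \<Longrightarrow>
     \<bar>h x - h y\<bar> \<le> L * mdist (linf_metric T) x y"
  shows "continuous_map (linf_top T) euclideanreal h"
proof -
  have "Lipschitz_continuous_map (linf_metric T) euclidean_metric h"
    unfolding Lipschitz_continuous_map_def using assms by (auto simp: dist_real_def)
  from Lipschitz_continuous_imp_continuous_map[OF this] show ?thesis by (simp add: linf_top_def)
qed

lemma continuous_map_linfD:
  assumes h: "continuous_map (linf_top T) euclideanreal h" and z: "z \<in> mspace (linf_metric T)" and e: "0 < e"
  obtains r where "0 < r" "\<And>y. y \<in> mspace (linf_metric T) \<Longrightarrow> mdist (linf_metric T) z y < r \<Longrightarrow> \<bar>h y - h z\<bar> < e"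
proof -
  interpret m: Metric_space "mspace (linf_metric T)" "mdist (linf_metric T)"
    by (rule Metric_space_mspace_mdist)
  have "continuous_map m.mtopology Met_TC.mtopology h"
    using h by (simp add: linf_top_def mtopology_of_def)
  then have "\<exists>r>0. \<forall>y. y \<in> mspace (linf_metric T) \<and> mdist (linf_metric T) z y < r \<longrightarrow> dist (h z) (h y) < e"
    using z e unfolding m.metric_continuous_map[OF Met_TC.Metric_space_axioms] by blast
  then show thesis using that by (metis dist_commute dist_real_def)
qed

lemma space_borel_of_top: "space (borel_of_top X) = topspace X"
  unfolding borel_of_top_def by (rule space_measure_of) (auto dest: openin_subset)

lemma borel_measurable_continuous_map:
  assumes Z: "Z \<in> measurable M' (borel_of_top X)" and h: "continuous_map X euclideanreal h"
  shows "(\<lambda>v. h (Z v)) \<in> borel_measurable M'"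
proof (rule borel_measurableI)
  fix S :: "real set" assume "open S"
  then have "openin X {x \<in> topspace X. h x \<in> S}"
    using h by (simp add: openin_continuous_map_preimage)
  then have U: "{x \<in> topspace X. h x \<in> S} \<in> sets (borel_of_top X)"
    unfolding borel_of_top_def by (subst sets_measure_of) (auto dest: openin_subset)
  have "(\<lambda>v. h (Z v)) -` S \<inter> space M' = Z -` {x \<in> topspace X. h x \<in> S} \<inter> space M'"
    using measurable_space[OF Z] by (auto simp: space_borel_of_top)
  then show "(\<lambda>v. h (Z v)) -` S \<inter> space M' \<in> sets M'" using measurable_sets[OF Z U] by simp
qed

text \<open>Total boundedness reduces \<open>K\<close> to finitely many functions \<open>y\<close>,
  and for each of them one index nearly maximises the discretisation error. The map \<open>p\<close>
  is arbitrary: all that matters is that both coordinates are uniformly close for nearby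
  functions.\<close>

lemma compact_linf_osc_finite:
  assumes K: "compactin (linf_top T) K" and p: "\<And>t. t \<in> T \<Longrightarrow> p t \<in> T" and e: "0 < e"
  obtains T1 where "finite T1" "T1 \<subseteq> T"
    "\<And>z t. z \<in> K \<Longrightarrow> t \<in> T \<Longrightarrow> \<exists>s\<in>T1. \<bar>z t - z (p t)\<bar> \<le> \<bar>z s - z (p s)\<bar> + e"
proof -
  interpret m: Metric_space "mspace (linf_metric T)" "mdist (linf_metric T)"
    by (rule Metric_space_mspace_mdist)
  \<comment> \<open>Four coordinates change when \<open>z\<close> is exchanged for its centre
    \<open>y\<close>, and the supremum for \<open>y\<close> is only nearly attained: five
    errors.\<close>
  define e' where "e' = e / 5"
  have e': "0 < e'" using e by (simp add: e'_def)
  have "m.mtotally_bounded K"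
    using K by (intro m.compactin_imp_mtotally_bounded) (simp add: linf_top_def mtopology_of_def)
  then have "\<exists>K0. finite K0 \<and> K0 \<subseteq> K \<and> K \<subseteq> (\<Union>x\<in>K0. m.mball x e')"
    unfolding m.mtotally_bounded_def using e' by simp
  then obtain K0 where K0: "finite K0" "K0 \<subseteq> K" "K \<subseteq> (\<Union>x\<in>K0. m.mball x e')"
    by (elim exE conjE)
  have Km: "K \<subseteq> mspace (linf_metric T)" using compactin_subset_topspace[OF K] by (simp add: linf_top_def)
  have "\<exists>s. T \<noteq> {} \<longrightarrow> s \<in> T \<and> (\<forall>t\<in>T. \<bar>y t - y (p t)\<bar> \<le> \<bar>y s - y (p s)\<bar> + e')" if "y \<in> K0" for y
  proof (cases "T = {}")
    case False
    have "bounded (y ` T)" using that K0 Km by (auto simp: mspace_linf)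
    then obtain c where c: "\<And>t. t \<in> T \<Longrightarrow> \<bar>y t\<bar> \<le> c" by (auto simp: bounded_iff)
    have "\<bar>y t - y (p t)\<bar> \<le> 2 * c" if "t \<in> T" for t using c[OF that] c[OF p[OF that]] by linarith
    then have bdd: "bdd_above ((\<lambda>t. \<bar>y t - y (p t)\<bar>) ` T)" by (auto intro!: bdd_aboveI)
    have "\<exists>x\<in>(\<lambda>t. \<bar>y t - y (p t)\<bar>) ` T. (SUP t\<in>T. \<bar>y t - y (p t)\<bar>) - e' < x"
      using e' False by (intro less_cSupD) auto
    then obtain s where s: "s \<in> T" "(SUP t\<in>T. \<bar>y t - y (p t)\<bar>) - e' < \<bar>y s - y (p s)\<bar>" by auto
    have "\<bar>y t - y (p t)\<bar> \<le> (SUP t\<in>T. \<bar>y t - y (p t)\<bar>)" if "t \<in> T" for t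
      by (rule cSUP_upper[OF that bdd])
    with s show ?thesis by (intro exI[of _ s]) force
  qed auto
  then obtain \<sigma> where \<sigma>: "\<And>y. y \<in> K0 \<Longrightarrow> T \<noteq> {} \<Longrightarrow> \<sigma> y \<in> T"
    "\<And>y t. y \<in> K0 \<Longrightarrow> t \<in> T \<Longrightarrow> \<bar>y t - y (p t)\<bar> \<le> \<bar>y (\<sigma> y) - y (p (\<sigma> y))\<bar> + e'" by (metis empty_iff)
  show thesis
  proof (rule that[of "\<sigma> ` K0 \<inter> T"])
    fix z t assume z: "z \<in> K" and t: "t \<in> T"
    obtain y where y: "y \<in> K0" "z \<in> m.mball y e'" using K0 z by blast
    then have yz: "y \<in> mspace (linf_metric T)" "z \<in> mspace (linf_metric T)" "mdist (linf_metric T) y z < e'"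
      by auto
    have c: "\<bar>y u - z u\<bar> < e'" if "u \<in> T" for u using linf_coord_le[OF yz(1,2) that] yz(3) by simp
    have s: "\<sigma> y \<in> T" using \<sigma>(1) y t by blast
    show "\<exists>s\<in>\<sigma> ` K0 \<inter> T. \<bar>z t - z (p t)\<bar> \<le> \<bar>z s - z (p s)\<bar> + e"
      using \<sigma>(2)[OF y(1) t] c[OF t] c[OF p[OF t]] c[OF s] c[OF p[OF s]] s y(1) unfolding e'_def
      by (intro bexI[of _ "\<sigma> y"]) (auto simp: abs_if split: if_splits)
  qed (use K0 in auto)
qed

section \<open>Outer expectations of bounded functions\<close>

text \<open>The infimum in \<open>outer_exp\<close> is taken in the reals, where it is informative
  only for sets that are nonempty and bounded below; a bound on \<open>f\<close> supplies
  both.\<close>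

lemma (in prob_space) outer_exp_set:
  fixes f :: "'a \<Rightarrow> real"
  assumes bd: "\<And>\<omega>. \<omega> \<in> space M \<Longrightarrow> \<bar>f \<omega>\<bar> \<le> B"
  shows "integral\<^sup>L M (\<lambda>_. B) \<in> {integral\<^sup>L M U | U. U \<in> borel_measurable M \<and> integrable M U \<and> (\<forall>\<omega>\<in>space M. f \<omega> \<le> U \<omega>)}"
    and "bdd_below {integral\<^sup>L M U | U. U \<in> borel_measurable M \<and> integrable M U \<and> (\<forall>\<omega>\<in>space M. f \<omega> \<le> U \<omega>)}"
proof -
  show "integral\<^sup>L M (\<lambda>_. B) \<in> {integral\<^sup>L M U | U. U \<in> borel_measurable M \<and> integrable M U \<and> (\<forall>\<omega>\<in>space M. f \<omega> \<le> U \<omega>)}"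
    using order_trans[OF abs_ge_self bd] by (intro CollectI exI[of _ "\<lambda>_. B"]) auto
  show "bdd_below {integral\<^sup>L M U | U. U \<in> borel_measurable M \<and> integrable M U \<and> (\<forall>\<omega>\<in>space M. f \<omega> \<le> U \<omega>)}"
  proof (rule bdd_belowI[of _ "- B"], elim CollectE exE conjE)
    fix x U assume x: "x = integral\<^sup>L M U" and U: "integrable M U" "\<forall>\<omega>\<in>space M. f \<omega> \<le> U \<omega>"
    have "expectation (\<lambda>_. - B) \<le> expectation U"
    proof (rule integral_mono)
      show "- B \<le> U \<omega>" if "\<omega> \<in> space M" for \<omega> using bd[OF that] U(2) that by fastforce
    qed (use U in auto)
    then show "- B \<le> x" by (simp add: x prob_space)
  qed
qed

lemma (in prob_space) outer_exp_le:
  assumes bd: "\<And>\<omega>. \<omega> \<in> space M \<Longrightarrow> \<bar>f \<omega>\<bar> \<le> B" and U: "integrable M U" and ae: "AE \<omega> in M. f \<omega> \<le> U \<omega>"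
  shows "outer_exp M f \<le> expectation U"
proof -
  obtain N where N: "N \<in> null_sets M" "{\<omega>\<in>space M. \<not> f \<omega> \<le> U \<omega>} \<subseteq> N"
    using ae unfolding eventually_ae_filter by auto
  \<comment> \<open>\<open>outer_exp\<close> asks for majorants at every point, so the almost sure
    majorant \<open>U\<close> is raised to \<open>B\<close> on the exceptional null set, which
    leaves its integral unchanged.\<close>
  let ?V = "\<lambda>\<omega>. if \<omega> \<in> N then B else U \<omega>"
  have Nsets: "N \<in> sets M" using N by auto
  have Vm: "?V \<in> borel_measurable M" using U Nsets by (intro measurable_If_set) auto
  have VU: "AE \<omega> in M. ?V \<omega> = U \<omega>" using AE_not_in[OF N(1)] by eventually_elim simp
  have Vint: "integrable M ?V" using integrable_cong_AE_imp[OF U Vm] VU by (auto simp: eq_commute)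
  have "f \<omega> \<le> ?V \<omega>" if "\<omega> \<in> space M" for \<omega> using bd[OF that] N(2) that by auto
  then have "outer_exp M f \<le> expectation ?V"
    unfolding outer_exp_def using Vm Vint by (intro cInf_lower outer_exp_set(2)[OF bd]) auto
  also have "expectation ?V = expectation U" using VU Vm U by (intro integral_cong_AE) auto
  finally show ?thesis .
qed

lemma (in prob_space) outer_exp_mono:
  assumes "\<And>\<omega>. \<omega> \<in> space M \<Longrightarrow> \<bar>f \<omega>\<bar> \<le> B" "\<And>\<omega>. \<omega> \<in> space M \<Longrightarrow> \<bar>g \<omega>\<bar> \<le> B"
    "\<And>\<omega>. \<omega> \<in> space M \<Longrightarrow> f \<omega> \<le> g \<omega>"
  shows "outer_exp M f \<le> outer_exp M g"
  unfolding outer_exp_def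
proof (rule cInf_superset_mono)
  show "{integral\<^sup>L M U | U. U \<in> borel_measurable M \<and> integrable M U \<and> (\<forall>\<omega>\<in>space M. g \<omega> \<le> U \<omega>)} \<noteq> {}"
    using outer_exp_set(1)[of g B] assms(2) by blast
  show "bdd_below {integral\<^sup>L M U | U. U \<in> borel_measurable M \<and> integrable M U \<and> (\<forall>\<omega>\<in>space M. f \<omega> \<le> U \<omega>)}"
    by (rule outer_exp_set(2)[OF assms(1)])
qed (use assms(3) in \<open>force intro: order_trans\<close>)

text \<open>The left side is the inner expectation of \<open>f\<close>. This inequality makes upper
  bounds for \<open>h\<close> and \<open>- h\<close> sufficient in the weak limit.\<close>

lemma (in prob_space) outer_exp_uminus:
  assumes bd: "\<And>\<omega>. \<omega> \<in> space M \<Longrightarrow> \<bar>f \<omega>\<bar> \<le> B"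
  shows "- outer_exp M (\<lambda>\<omega>. - f \<omega>) \<le> outer_exp M f"
proof -
  have bd': "\<bar>- f \<omega>\<bar> \<le> B" if "\<omega> \<in> space M" for \<omega> using bd[OF that] by simp
  have "- outer_exp M (\<lambda>\<omega>. - f \<omega>) \<le> x"
    if "x \<in> {integral\<^sup>L M U | U. U \<in> borel_measurable M \<and> integrable M U \<and> (\<forall>\<omega>\<in>space M. f \<omega> \<le> U \<omega>)}" for x
  proof -
    obtain U where U: "x = integral\<^sup>L M U" "integrable M U" "\<forall>\<omega>\<in>space M. f \<omega> \<le> U \<omega>" using \<open>x \<in> _\<close> by blast
    have "- x \<le> y"
      if "y \<in> {integral\<^sup>L M V | V. V \<in> borel_measurable M \<and> integrable M V \<and> (\<forall>\<omega>\<in>space M. - f \<omega> \<le> V \<omega>)}" for y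
    proof -
      obtain V where V: "y = integral\<^sup>L M V" "integrable M V" "\<forall>\<omega>\<in>space M. - f \<omega> \<le> V \<omega>" using \<open>y \<in> _\<close> by blast
      have "expectation (\<lambda>\<omega>. - U \<omega>) \<le> expectation V"
        using U V by (intro integral_mono) force+
      then show ?thesis using U V by simp
    qed
    then have "- x \<le> outer_exp M (\<lambda>\<omega>. - f \<omega>)"
      unfolding outer_exp_def using outer_exp_set(1)[of "\<lambda>\<omega>. - f \<omega>" B] bd' by (intro cInf_greatest) blast+
    then show ?thesis by simp
  qed
  then show ?thesis
    unfolding outer_exp_def[of M f] using outer_exp_set(1)[of f B] bd by (intro cInf_greatest) blast+
qed

text \<open>Majorants for \<open>outer_exp\<close> are real and integrable, while oscillation bounds
  live in \<open>ennreal\<close>. Since \<open>enn2real\<close> sends infinity to 0, it must be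
  known that infinity occurs only on a null set.\<close>

lemma nn_integral_le_ennrealD:
  assumes [measurable]: "H \<in> borel_measurable M" and le: "(\<integral>\<^sup>+\<omega>. H \<omega> \<partial>M) \<le> ennreal c" and c: "0 \<le> c"
  shows "AE \<omega> in M. H \<omega> \<noteq> \<top>" "integrable M (\<lambda>\<omega>. enn2real (H \<omega>))" "(\<integral>\<omega>. enn2real (H \<omega>) \<partial>M) \<le> c"
proof -
  have "(\<integral>\<^sup>+\<omega>. H \<omega> \<partial>M) \<noteq> \<infinity>" using le by (auto simp: top_unique)
  then show ae: "AE \<omega> in M. H \<omega> \<noteq> \<top>" using nn_integral_PInf_AE[of H M] by simp
  have eq: "(\<integral>\<^sup>+\<omega>. ennreal (enn2real (H \<omega>)) \<partial>M) = (\<integral>\<^sup>+\<omega>. H \<omega> \<partial>M)"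
    using ae by (intro nn_integral_cong_AE) (auto elim!: eventually_mono simp: less_top)
  show "integrable M (\<lambda>\<omega>. enn2real (H \<omega>))"
    using le_less_trans[OF le ennreal_less_top] by (intro integrableI_nonneg) (auto simp: eq)
  have "(\<integral>\<omega>. enn2real (H \<omega>) \<partial>M) = enn2real (\<integral>\<^sup>+\<omega>. H \<omega> \<partial>M)"
    by (subst integral_eq_nn_integral) (auto simp: eq)
  also have "\<dots> \<le> c" using enn2real_mono[OF le] c by simp
  finally show "(\<integral>\<omega>. enn2real (H \<omega>) \<partial>M) \<le> c" .
qed

subsection \<open>Weak convergence from equicontinuity in mean\<close>

text \<open>Marginals are tested by functions on the whole sequence space, with the list of
  coordinates padded by zeros, so that a single type of test function serves all lengths. The
  process and the limit may live on different probability spaces.\<close>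

locale asymp_equicontinuous = prob_space M + L: prob_space M'
  for M :: "'w measure" and M' :: "'v measure" +
  fixes T :: "'t set" and d :: "'t \<Rightarrow> 't \<Rightarrow> real" and Z :: "nat \<Rightarrow> 't \<Rightarrow> 'w \<Rightarrow> real" and Y :: "'v \<Rightarrow> 't \<Rightarrow> real"
  assumes meas: "\<And>n t. t \<in> T \<Longrightarrow> Z n t \<in> borel_measurable M"
    and bounded_paths: "\<And>n \<omega>. \<omega> \<in> space M \<Longrightarrow> bounded ((\<lambda>t. Z n t \<omega>) ` T)"
    and sep: "\<And>n. separable_process M T d (Z n)"
    and equicont: "\<And>\<epsilon>. 0 < \<epsilon> \<Longrightarrow> \<exists>\<eta>>0. \<forall>n. (\<integral>\<^sup>+\<omega>. osc T d (Z n) \<eta> \<omega> \<partial>M) < ennreal \<epsilon>"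
    and tot: "\<And>\<epsilon>. 0 < \<epsilon> \<Longrightarrow> \<exists>S. finite S \<and> S \<subseteq> T \<and> (\<forall>t\<in>T. \<exists>s\<in>S. d s t < \<epsilon>)"
    and Y: "Y \<in> measurable M' (borel_of_top (linf_top T))"
    and tight: "\<And>e. 0 < e \<Longrightarrow> \<exists>K. compactin (linf_top T) K \<and> measure M' (Y -` K \<inter> space M') \<ge> 1 - e"
    and fidi: "\<And>ts (g :: (nat \<Rightarrow> real) \<Rightarrow> real). set ts \<subseteq> T \<Longrightarrow> continuous_on UNIV g \<Longrightarrow> bounded (range g) \<Longrightarrow>
       (\<lambda>n. \<integral>\<omega>. g (\<lambda>j. if j < length ts then Z n (ts ! j) \<omega> else 0) \<partial>M)
         \<longlonglongrightarrow> (\<integral>v. g (\<lambda>j. if j < length ts then Y v (ts ! j) else 0) \<partial>M')"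
begin

lemma Y_in: "v \<in> space M' \<Longrightarrow> Y v \<in> mspace (linf_metric T)"
  using measurable_space[OF Y] by (simp add: space_borel_of_top linf_top_def)

lemma Y_coord_measurable: "t \<in> T \<Longrightarrow> (\<lambda>v. Y v t) \<in> borel_measurable M'"
  by (rule borel_measurable_continuous_map[OF Y Lipschitz_linf_continuous[where L = 1]])
    (simp add: linf_coord_le)

lemma Z_in: "\<omega> \<in> space M \<Longrightarrow> restrict (\<lambda>t. Z n t \<omega>) T \<in> mspace (linf_metric T)"
  using bounded_paths by (simp add: mspace_linf)

text \<open>The Lipschitz bound in the coordinates of \<open>S\<close> forces \<open>\<phi>\<close>
  to depend on these alone, so it is a bounded continuous function of one finite marginal.\<close>

lemma finite_functional:
  fixes \<phi> :: "('t \<Rightarrow> real) \<Rightarrow> real"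
  assumes S: "finite S" "S \<subseteq> T"
    and lip: "\<And>x y. \<bar>\<phi> x - \<phi> y\<bar> \<le> L * (\<Sum>s\<in>S. \<bar>x s - y s\<bar>)" and bd: "\<And>x. \<bar>\<phi> x\<bar> \<le> B"
  shows "(\<lambda>n. \<integral>\<omega>. \<phi> (\<lambda>t. Z n t \<omega>) \<partial>M) \<longlonglongrightarrow> (\<integral>v. \<phi> (Y v) \<partial>M')"
    and "integrable M (\<lambda>\<omega>. \<phi> (\<lambda>t. Z n t \<omega>))" and "integrable M' (\<lambda>v. \<phi> (Y v))"
proof -
  obtain ts where ts: "set ts = S" using finite_list[OF S(1)] by blast
  then have "\<forall>s\<in>S. \<exists>i. i < length ts \<and> ts ! i = s" by (metis in_set_conv_nth)
  then obtain idx where idx: "\<And>s. s \<in> S \<Longrightarrow> idx s < length ts" "\<And>s. s \<in> S \<Longrightarrow> ts ! idx s = s" by metis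
  \<comment> \<open>A sequence is turned back into a function on the index set by looking up the
    position of each \<open>s\<close>; off \<open>S\<close> any filling gives the same value of
    \<open>\<phi>\<close>, and 0 is used.\<close>
  define g where "g x = \<phi> (\<lambda>s. if s \<in> S then x (idx s) else 0)" for x :: "nat \<Rightarrow> real"
  have g_eq: "g (\<lambda>j. if j < length ts then z (ts ! j) else 0) = \<phi> z" for z
  proof -
    have "\<bar>g (\<lambda>j. if j < length ts then z (ts ! j) else 0) - \<phi> z\<bar> \<le> 0"
      unfolding g_def by (rule order_trans[OF lip]) (simp add: idx)
    then show ?thesis by simp
  qed
  have g_Z: "g (\<lambda>j. if j < length ts then Z n (ts ! j) \<omega> else 0) = \<phi> (\<lambda>t. Z n t \<omega>)" for n \<omega>
    by (rule g_eq)
  have cont: "continuous_on UNIV g"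
    unfolding continuous_on_def
  proof
    fix x :: "nat \<Rightarrow> real"
    have c: "((\<lambda>y. y i) \<longlongrightarrow> x i) (at x)" for i
      using continuous_on_product_coordinates[of i] unfolding continuous_on_def by auto
    have "((\<lambda>y. L * (\<Sum>s\<in>S. \<bar>y (idx s) - x (idx s)\<bar>)) \<longlongrightarrow> L * (\<Sum>s\<in>S. \<bar>x (idx s) - x (idx s)\<bar>)) (at x)"
      by (intro tendsto_intros c)
    then have 0: "((\<lambda>y. L * (\<Sum>s\<in>S. \<bar>y (idx s) - x (idx s)\<bar>)) \<longlongrightarrow> 0) (at x)" by simp
    have "\<bar>g y - g x\<bar> \<le> L * (\<Sum>s\<in>S. \<bar>y (idx s) - x (idx s)\<bar>)" for y
      unfolding g_def by (rule order_trans[OF lip]) simp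
    then have "((\<lambda>y. g y - g x) \<longlongrightarrow> 0) (at x)"
      by (intro Lim_null_comparison[OF _ 0]) (simp add: eventually_mono)
    then show "(g \<longlongrightarrow> g x) (at x within UNIV)" by (simp add: LIM_zero_iff)
  qed
  have bdg: "bounded (range g)" unfolding bounded_iff g_def using bd by (auto intro!: exI[of _ B])
  have gm: "g \<in> borel_measurable borel" using cont by (rule borel_measurable_continuous_onI)
  have tsT: "ts ! j \<in> T" if "j < length ts" for j using that ts S nth_mem by blast
  show "(\<lambda>n. \<integral>\<omega>. \<phi> (\<lambda>t. Z n t \<omega>) \<partial>M) \<longlonglongrightarrow> (\<integral>v. \<phi> (Y v) \<partial>M')"
    using fidi[OF _ cont bdg, of ts] S ts by (simp add: g_eq g_Z)
  have m1: "(\<lambda>\<omega>. \<phi> (\<lambda>t. Z n t \<omega>)) \<in> borel_measurable M"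
  proof -
    have "(\<lambda>\<omega> j. if j < length ts then Z n (ts ! j) \<omega> else 0) \<in> borel_measurable M"
    proof (rule measurable_coordinatewise_then_product)
      fix j show "(\<lambda>\<omega>. if j < length ts then Z n (ts ! j) \<omega> else 0) \<in> borel_measurable M"
        using meas[OF tsT] by (cases "j < length ts") auto
    qed
    from measurable_compose[OF this gm] show ?thesis by (simp add: g_Z)
  qed
  have m2: "(\<lambda>v. \<phi> (Y v)) \<in> borel_measurable M'"
  proof -
    have "(\<lambda>v j. if j < length ts then Y v (ts ! j) else 0) \<in> borel_measurable M'"
    proof (rule measurable_coordinatewise_then_product)
      fix j show "(\<lambda>v. if j < length ts then Y v (ts ! j) else 0) \<in> borel_measurable M'"
        using Y_coord_measurable[OF tsT] by (cases "j < length ts") auto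
    qed
    from measurable_compose[OF this gm] show ?thesis by (simp add: g_eq)
  qed
  show "integrable M (\<lambda>\<omega>. \<phi> (\<lambda>t. Z n t \<omega>))"
    using m1 bd by (intro integrable_const_bound[where B = B]) auto
  show "integrable M' (\<lambda>v. \<phi> (Y v))"
    using m2 bd by (intro L.integrable_const_bound[where B = B]) auto
qed

text \<open>Of the allowance \<epsilon>, discretising the processes takes
  \<open>\<epsilon> / 8\<close>, undoing the discretisation at the limit takes
  \<open>\<epsilon> / 4\<close>, and convergence of the marginal functional \<open>\<phi>1\<close>
  takes \<open>\<epsilon> / 4\<close>.\<close>

lemma limsup_outer_exp_Lipschitz:
  fixes h :: "('t \<Rightarrow> real) \<Rightarrow> real"
  assumes lip: "\<And>x y. x \<in> mspace (linf_metric T) \<Longrightarrow> y \<in> mspace (linf_metric T) \<Longrightarrow>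
       \<bar>h x - h y\<bar> \<le> L * mdist (linf_metric T) x y" and L: "0 < L"
    and bd: "\<And>x. x \<in> mspace (linf_metric T) \<Longrightarrow> \<bar>h x\<bar> \<le> B" and \<epsilon>: "0 < \<epsilon>"
  shows "\<forall>\<^sub>F n in sequentially. outer_exp M (\<lambda>\<omega>. h (restrict (\<lambda>t. Z n t \<omega>) T)) \<le> (\<integral>v. h (Y v) \<partial>M') + \<epsilon>"
proof -
  have undef0: "restrict (\<lambda>_. 0) T \<in> mspace (linf_metric T)"
    by (auto simp: mspace_linf bounded_iff)
  have B0: "0 \<le> B" using bd[OF undef0] by linarith
  \<comment> \<open>\<open>a\<close> bounds the mean oscillation, which enters with weight
    \<open>L\<close>. \<open>e\<close> is both the accuracy on the compact set, with weight
    \<open>L\<close>, and the mass outside it, with weight \<open>2 * B\<close>; the cap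
    \<open>1/2\<close> keeps \<open>1 - e\<close> positive.\<close>
  define a where "a = \<epsilon> / (8 * L)"
  define e where "e = min (1/2) (\<epsilon> / (8 * (L + 2 * B)))"
  have a: "0 < a" "L * a = \<epsilon> / 8" using \<epsilon> L by (auto simp: a_def)
  have e: "0 < e" "e < 1" using \<epsilon> L B0 by (auto simp: e_def)
  have "e \<le> \<epsilon> / (8 * (L + 2 * B))" unfolding e_def by (rule min.cobounded2)
  then have e2: "(L + 2 * B) * e \<le> \<epsilon> / 8" using L B0 by (simp add: field_simps)
  obtain \<eta> where \<eta>: "0 < \<eta>" and osc: "\<And>n. (\<integral>\<^sup>+\<omega>. osc T d (Z n) \<eta> \<omega> \<partial>M) < ennreal a"
    using equicont[OF a(1)] by blast
  have "\<exists>H. H \<in> borel_measurable M \<and> (AE \<omega> in M. osc T d (Z n) \<eta> \<omega> = H \<omega>)" for n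
    using separable_process_osc_version[OF sep \<eta> meas] by metis
  then obtain H where H[measurable]: "\<And>n. H n \<in> borel_measurable M"
    and oscH: "\<And>n. AE \<omega> in M. osc T d (Z n) \<eta> \<omega> = H n \<omega>" by metis
  have Hle: "(\<integral>\<^sup>+\<omega>. H n \<omega> \<partial>M) \<le> ennreal a" for n
  proof -
    have "(\<integral>\<^sup>+\<omega>. H n \<omega> \<partial>M) = (\<integral>\<^sup>+\<omega>. osc T d (Z n) \<eta> \<omega> \<partial>M)"
      using oscH[of n] by (intro nn_integral_cong_AE) (auto elim!: eventually_mono)
    then show ?thesis using osc[of n] by simp
  qed
  note HH = nn_integral_le_ennrealD[OF H Hle less_imp_le[OF a(1)]]
  obtain S where S: "finite S" "S \<subseteq> T" "\<forall>t\<in>T. \<exists>s\<in>S. d s t < \<eta>" using tot[OF \<eta>] by blast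
  then obtain p where p: "\<And>t. t \<in> T \<Longrightarrow> p t \<in> S" "\<And>t. t \<in> T \<Longrightarrow> d (p t) t < \<eta>" by metis
  have pT: "p t \<in> T" if "t \<in> T" for t using p S that by blast
  have dev: "AE \<omega> in M. \<forall>t\<in>T. \<bar>Z n t \<omega> - Z n (p t) \<omega>\<bar> \<le> enn2real (H n \<omega>)" for n
    using oscH[of n] HH(1)[of n]
  proof eventually_elim
    case (elim \<omega>)
    show ?case
    proof
      fix t assume t: "t \<in> T"
      have "ennreal \<bar>Z n (p t) \<omega> - Z n t \<omega>\<bar> \<le> H n \<omega>"
        using osc_upper[of "p t" T t d \<eta> "Z n" \<omega>] p t pT elim by simp
      from enn2real_mono[OF this] show "\<bar>Z n t \<omega> - Z n (p t) \<omega>\<bar> \<le> enn2real (H n \<omega>)"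
        using elim by (simp add: less_top abs_minus_commute)
    qed
  qed
  \<comment> \<open>The result takes finitely many values, hence is bounded even if \<open>z\<close>
    is not; so \<open>\<phi>1\<close> is controlled on all functions, as
    \<open>finite_functional\<close> demands.\<close>
  define P where "P z = restrict (\<lambda>t. z (p t)) T" for z :: "'t \<Rightarrow> real"
  have P_in: "P z \<in> mspace (linf_metric T)" for z
  proof -
    have "(\<lambda>t. z (p t)) ` T \<subseteq> z ` S" using p by auto
    then have "finite ((\<lambda>t. z (p t)) ` T)" using S(1) finite_subset by blast
    then show ?thesis by (simp add: mspace_linf P_def finite_imp_bounded)
  qed
  define \<phi>1 where "\<phi>1 z = h (P z)" for z
  have \<phi>1_lip: "\<bar>\<phi>1 x - \<phi>1 y\<bar> \<le> L * (\<Sum>s\<in>S. \<bar>x s - y s\<bar>)" for x y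
  proof -
    have "\<bar>\<phi>1 x - \<phi>1 y\<bar> \<le> L * mdist (linf_metric T) (P x) (P y)"
      unfolding \<phi>1_def by (intro lip P_in)
    also have "mdist (linf_metric T) (P x) (P y) \<le> (\<Sum>s\<in>S. \<bar>x s - y s\<bar>)"
    proof (intro linf_mdist_le P_in sum_nonneg)
      fix t assume "t \<in> T"
      then show "\<bar>P x t - P y t\<bar> \<le> (\<Sum>s\<in>S. \<bar>x s - y s\<bar>)"
        using p S(1) by (auto simp: P_def intro!: member_le_sum[of "p t" S "\<lambda>s. \<bar>x s - y s\<bar>"])
    qed auto
    finally show ?thesis using L by simp
  qed
  have \<phi>1_bd: "\<bar>\<phi>1 z\<bar> \<le> B" for z unfolding \<phi>1_def by (intro bd P_in)
  note \<phi>1 = finite_functional[OF S(1,2) \<phi>1_lip \<phi>1_bd]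
  have upper: "outer_exp M (\<lambda>\<omega>. h (restrict (\<lambda>t. Z n t \<omega>) T)) \<le> expectation (\<lambda>\<omega>. \<phi>1 (\<lambda>t. Z n t \<omega>)) + \<epsilon> / 8" for n
  proof -
    have "AE \<omega> in M. h (restrict (\<lambda>t. Z n t \<omega>) T) \<le> \<phi>1 (\<lambda>t. Z n t \<omega>) + L * enn2real (H n \<omega>)"
      using dev[of n] AE_space
    proof eventually_elim
      case (elim \<omega>)
      have "\<bar>h (restrict (\<lambda>t. Z n t \<omega>) T) - h (P (\<lambda>t. Z n t \<omega>))\<bar>
          \<le> L * mdist (linf_metric T) (restrict (\<lambda>t. Z n t \<omega>) T) (P (\<lambda>t. Z n t \<omega>))"
        using elim by (intro lip P_in Z_in)
      also have "\<dots> \<le> L * enn2real (H n \<omega>)"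
        using elim L by (intro mult_left_mono linf_mdist_le P_in Z_in) (auto simp: P_def)
      finally show ?case unfolding \<phi>1_def by linarith
    qed
    then have "outer_exp M (\<lambda>\<omega>. h (restrict (\<lambda>t. Z n t \<omega>) T))
        \<le> expectation (\<lambda>\<omega>. \<phi>1 (\<lambda>t. Z n t \<omega>) + L * enn2real (H n \<omega>))"
      using \<phi>1(2)[of n] HH(2)[of n] Z_in bd by (intro outer_exp_le[where B = B]) auto
    also have "\<dots> = expectation (\<lambda>\<omega>. \<phi>1 (\<lambda>t. Z n t \<omega>)) + L * expectation (\<lambda>\<omega>. enn2real (H n \<omega>))"
      using \<phi>1(2)[of n] HH(2)[of n] by simp
    also have "L * expectation (\<lambda>\<omega>. enn2real (H n \<omega>)) \<le> L * a" using HH(3)[of n] L by simp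
    finally show ?thesis using a by simp
  qed
  obtain K where K: "compactin (linf_top T) K" "measure M' (Y -` K \<inter> space M') \<ge> 1 - e"
    using tight[OF e(1)] by blast
  \<comment> \<open>A non-measurable set has \<open>measure\<close> 0, so the positive lower bound
    \<open>1 - e\<close> already implies measurability.\<close>
  have Ksets: "Y -` K \<inter> space M' \<in> sets M'"
  proof (rule ccontr)
    assume "\<not> ?thesis"
    then have "measure M' (Y -` K \<inter> space M') = 0" by (rule measure_notin_sets)
    then show False using K e by simp
  qed
  define KC where "KC = space M' - (Y -` K \<inter> space M')"
  have KC: "KC \<in> sets M'" "measure M' KC \<le> e"
    using Ksets K unfolding KC_def by (auto simp: L.prob_compl)
  have KC_int: "integrable M' (indicator KC :: 'v \<Rightarrow> real)"
    using KC by (intro integrable_real_indicator) (auto simp: L.emeasure_eq_measure)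
  obtain T1 where T1: "finite T1" "T1 \<subseteq> T"
    "\<And>z t. z \<in> K \<Longrightarrow> t \<in> T \<Longrightarrow> \<exists>s\<in>T1. \<bar>z t - z (p t)\<bar> \<le> \<bar>z s - z (p s)\<bar> + e"
    using compact_linf_osc_finite[where p = p, OF K(1) pT e(1)] by metis
  \<comment> \<open>Inserting 0 gives the maximum a meaning for empty \<open>T1\<close> and makes it
    nonnegative.\<close>
  define m where "m z = Max (insert 0 ((\<lambda>s. \<bar>z s - z (p s)\<bar>) ` T1))" for z :: "'t \<Rightarrow> real"
  have m_ge: "\<bar>z s - z (p s)\<bar> \<le> m z" if "s \<in> T1" for z s unfolding m_def using T1(1) that by simp
  have m_0: "0 \<le> m z" for z unfolding m_def using T1(1) by simp
  have m_le: "m z \<le> c" if "0 \<le> c" "\<And>s. s \<in> T1 \<Longrightarrow> \<bar>z s - z (p s)\<bar> \<le> c" for z c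
    unfolding m_def using T1(1) that by simp
  define S2 where "S2 = T1 \<union> p ` T1"
  have S2: "finite S2" "S2 \<subseteq> T" unfolding S2_def using T1 pT by auto
  have m_lip': "m x \<le> m y + 2 * (\<Sum>s\<in>S2. \<bar>x s - y s\<bar>)" for x y
  proof (rule m_le)
    show "0 \<le> m y + 2 * (\<Sum>s\<in>S2. \<bar>x s - y s\<bar>)" using m_0[of y] by (simp add: sum_nonneg)
    fix s assume s: "s \<in> T1"
    have "\<bar>x s - y s\<bar> \<le> (\<Sum>s\<in>S2. \<bar>x s - y s\<bar>)" "\<bar>x (p s) - y (p s)\<bar> \<le> (\<Sum>s\<in>S2. \<bar>x s - y s\<bar>)"
      using s S2(1) by (auto simp: S2_def intro!: member_le_sum[of _ _ "\<lambda>s. \<bar>x s - y s\<bar>"])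
    with m_ge[OF s, of y] show "\<bar>x s - x (p s)\<bar> \<le> m y + 2 * (\<Sum>s\<in>S2. \<bar>x s - y s\<bar>)" by linarith
  qed
  have m_lip: "\<bar>m x - m y\<bar> \<le> 2 * (\<Sum>s\<in>S2. \<bar>x s - y s\<bar>)" for x y
    using m_lip'[of x y] m_lip'[of y x] by (simp add: abs_minus_commute)
  \<comment> \<open>Since \<open>2 * B\<close> bounds the difference of \<open>\<phi>1\<close> and
    \<open>h\<close> on bounded functions, truncating there loses nothing and supplies the
    boundedness needed for the marginal limit.\<close>
  define \<phi>2 where "\<phi>2 z = min (2 * B) (L * m z)" for z
  have \<phi>2_lip: "\<bar>\<phi>2 x - \<phi>2 y\<bar> \<le> (L * 2) * (\<Sum>s\<in>S2. \<bar>x s - y s\<bar>)" for x y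
  proof -
    have "\<bar>\<phi>2 x - \<phi>2 y\<bar> \<le> \<bar>L * m x - L * m y\<bar>" unfolding \<phi>2_def by linarith
    also have "\<dots> = L * \<bar>m x - m y\<bar>" using L by (simp add: abs_mult flip: right_diff_distrib)
    also have "\<dots> \<le> L * (2 * (\<Sum>s\<in>S2. \<bar>x s - y s\<bar>))" using L m_lip by (intro mult_left_mono) auto
    finally show ?thesis by simp
  qed
  have \<phi>2_bd: "\<bar>\<phi>2 z\<bar> \<le> 2 * B" for z unfolding \<phi>2_def using m_0[of z] L B0 by (simp add: abs_le_iff min_def)
  note \<phi>2 = finite_functional[OF S2 \<phi>2_lip \<phi>2_bd]
  \<comment> \<open>The oscillation of the limit is estimated through the processes: the bound
    \<open>L * a\<close> holds for every \<open>n\<close> and survives the passage to the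
    limit.\<close>
  have E\<phi>2: "(\<integral>v. \<phi>2 (Y v) \<partial>M') \<le> \<epsilon> / 8"
  proof (rule LIMSEQ_le_const2[OF \<phi>2(1)], intro exI[of _ 0] allI impI)
    fix n
    have "expectation (\<lambda>\<omega>. \<phi>2 (\<lambda>t. Z n t \<omega>)) \<le> expectation (\<lambda>\<omega>. L * enn2real (H n \<omega>))"
    proof (rule integral_mono_AE)
      show "AE \<omega> in M. \<phi>2 (\<lambda>t. Z n t \<omega>) \<le> L * enn2real (H n \<omega>)"
        using dev[of n]
      proof eventually_elim
        case (elim \<omega>)
        then have "m (\<lambda>t. Z n t \<omega>) \<le> enn2real (H n \<omega>)" using T1 by (intro m_le) auto
        then have "L * m (\<lambda>t. Z n t \<omega>) \<le> L * enn2real (H n \<omega>)" using L by simp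
        then show ?case unfolding \<phi>2_def by linarith
      qed
    qed (use \<phi>2(2)[of n] HH(2)[of n] in auto)
    also have "\<dots> \<le> L * a" using HH(3)[of n] L by simp
    finally show "expectation (\<lambda>\<omega>. \<phi>2 (\<lambda>t. Z n t \<omega>)) \<le> \<epsilon> / 8" using a by simp
  qed
  have hY: "integrable M' (\<lambda>v. h (Y v))"
    using borel_measurable_continuous_map[OF Y Lipschitz_linf_continuous[OF lip]] bd Y_in
    by (intro L.integrable_const_bound[where B = B] AE_I2) auto
  have "(\<integral>v. \<phi>1 (Y v) \<partial>M') \<le> (\<integral>v. (h (Y v) + \<phi>2 (Y v)) + (L * e + 2 * B * indicator KC v) \<partial>M')"
  proof (rule integral_mono)
    fix v assume v: "v \<in> space M'"
    show "\<phi>1 (Y v) \<le> (h (Y v) + \<phi>2 (Y v)) + (L * e + 2 * B * indicator KC v)"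
    proof (cases "Y v \<in> K")
      case True
      have "mdist (linf_metric T) (P (Y v)) (Y v) \<le> m (Y v) + e"
      proof (intro linf_mdist_le P_in Y_in v)
        fix t assume t: "t \<in> T"
        obtain s where "s \<in> T1" "\<bar>Y v t - Y v (p t)\<bar> \<le> \<bar>Y v s - Y v (p s)\<bar> + e" using T1(3)[OF True t] by blast
        then show "\<bar>P (Y v) t - Y v t\<bar> \<le> m (Y v) + e"
          using m_ge[of s "Y v"] t by (simp add: P_def abs_minus_commute)
      qed (use m_0[of "Y v"] e in simp)
      then have "L * mdist (linf_metric T) (P (Y v)) (Y v) \<le> L * m (Y v) + L * e"
        using L by (simp flip: distrib_left)
      then have "\<phi>1 (Y v) - h (Y v) \<le> L * m (Y v) + L * e"
        using lip[OF P_in Y_in[OF v], of "Y v"] unfolding \<phi>1_def by linarith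
      moreover have "\<phi>1 (Y v) - h (Y v) \<le> 2 * B" using \<phi>1_bd[of "Y v"] bd[OF Y_in[OF v]] by linarith
      moreover have "0 \<le> L * e" using L e by simp
      moreover have "v \<notin> KC" using True v by (simp add: KC_def)
      ultimately show ?thesis unfolding \<phi>2_def by simp
    next
      case False
      then have "v \<in> KC" using v by (simp add: KC_def)
      moreover have "\<phi>1 (Y v) - h (Y v) \<le> 2 * B" using \<phi>1_bd[of "Y v"] bd[OF Y_in[OF v]] by linarith
      moreover have "0 \<le> L * e" "0 \<le> \<phi>2 (Y v)" using L e m_0[of "Y v"] B0 by (simp_all add: \<phi>2_def)
      ultimately show ?thesis by simp
    qed
  next
    show "integrable M' (\<lambda>v. (h (Y v) + \<phi>2 (Y v)) + (L * e + 2 * B * indicator KC v))"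
      using \<phi>2(3) hY KC_int by (intro Bochner_Integration.integrable_add integrable_mult_right) auto
  qed (rule \<phi>1(3))
  also have "\<dots> = (\<integral>v. h (Y v) \<partial>M') + (\<integral>v. \<phi>2 (Y v) \<partial>M') + (L * e + 2 * B * measure M' KC)"
    using \<phi>2(3) hY KC KC_int by (simp add: L.prob_space Int_absorb2 sets.sets_into_space)
  also have "\<dots> \<le> (\<integral>v. h (Y v) \<partial>M') + \<epsilon> / 8 + (L * e + 2 * B * e)"
    using E\<phi>2 KC B0 L e by (intro add_mono mult_left_mono) auto
  also have "\<dots> \<le> (\<integral>v. h (Y v) \<partial>M') + \<epsilon> / 4" using e2 by (simp add: algebra_simps)
  finally have lim: "(\<integral>v. \<phi>1 (Y v) \<partial>M') \<le> (\<integral>v. h (Y v) \<partial>M') + \<epsilon> / 4" .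
  have "\<forall>\<^sub>F n in sequentially. expectation (\<lambda>\<omega>. \<phi>1 (\<lambda>t. Z n t \<omega>)) < (\<integral>v. \<phi>1 (Y v) \<partial>M') + \<epsilon> / 4"
    using \<phi>1(1) \<epsilon> by (intro order_tendstoD) auto
  then show ?thesis
  proof eventually_elim
    case (elim n)
    then show ?case using upper[of n] lim \<epsilon> by linarith
  qed
qed

lemma limsup_outer_exp:
  assumes h: "continuous_map (linf_top T) euclideanreal h"
    and bd: "\<And>x. x \<in> mspace (linf_metric T) \<Longrightarrow> \<bar>h x\<bar> \<le> B" and \<epsilon>: "0 < \<epsilon>"
  shows "\<forall>\<^sub>F n in sequentially. outer_exp M (\<lambda>\<omega>. h (restrict (\<lambda>t. Z n t \<omega>) T)) \<le> (\<integral>v. h (Y v) \<partial>M') + \<epsilon>"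
proof -
  let ?X = "mspace (linf_metric T)" and ?d = "mdist (linf_metric T)"
  interpret m: Metric_space ?X ?d by (rule Metric_space_mspace_mdist)
  have "restrict (\<lambda>_. 0) T \<in> ?X" by (auto simp: mspace_linf bounded_iff)
  then have ne: "?X \<noteq> {}" by blast
  \<comment> \<open>The sup-convolution of \<open>h\<close> with \<open>k * dist\<close> is \<open>k\<close>-Lipschitz and decreases to \<open>h\<close> as \<open>k \<rightarrow> \<infinity>\<close>,
     so no uniform continuity of \<open>h\<close> is needed.\<close>
  define hk where "hk k z = (SUP y\<in>?X. h y - real (Suc k) * ?d y z)" for k z
  have bdd: "bdd_above ((\<lambda>y. h y - real (Suc k) * ?d y z) ` ?X)" for k z
  proof (rule bdd_aboveI2)
    fix y assume "y \<in> ?X"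
    then have "h y \<le> B" using bd by fastforce
    moreover have "0 \<le> real (Suc k) * ?d y z" by simp
    ultimately show "h y - real (Suc k) * ?d y z \<le> B" by linarith
  qed
  have hk_ge: "h z \<le> hk k z" if "z \<in> ?X" for k z
  proof -
    have "h z - real (Suc k) * ?d z z \<le> hk k z" unfolding hk_def by (rule cSUP_upper[OF that bdd])
    then show ?thesis using that by simp
  qed
  have hk_le: "hk k z \<le> B" for k z
    unfolding hk_def
  proof (rule cSUP_least[OF ne])
    fix y assume "y \<in> ?X"
    then have "h y \<le> B" using bd by fastforce
    moreover have "0 \<le> real (Suc k) * ?d y z" by simp
    ultimately show "h y - real (Suc k) * ?d y z \<le> B" by linarith
  qed
  have hk_bd: "\<bar>hk k z\<bar> \<le> B" if "z \<in> ?X" for k z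
    using hk_ge[OF that, of k] hk_le[of k z] bd[OF that] by linarith
  have hk_lip': "hk k x \<le> hk k z + real (Suc k) * ?d x z" if "x \<in> ?X" "z \<in> ?X" for k x z
    unfolding hk_def[of k x]
  proof (rule cSUP_least[OF ne])
    fix y assume y: "y \<in> ?X"
    have "?d y z \<le> ?d y x + ?d x z" using y that by (intro m.triangle)
    then have "real (Suc k) * ?d y z \<le> real (Suc k) * (?d y x + ?d x z)" by (intro mult_left_mono) auto
    moreover have "h y - real (Suc k) * ?d y z \<le> hk k z" unfolding hk_def by (rule cSUP_upper[OF y bdd])
    ultimately show "h y - real (Suc k) * ?d y x \<le> hk k z + real (Suc k) * ?d x z"
      by (simp only: distrib_left)
  qed
  have hk_lip: "\<bar>hk k x - hk k z\<bar> \<le> real (Suc k) * ?d x z" if "x \<in> ?X" "z \<in> ?X" for k x z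
    using hk_lip'[OF that, of k] hk_lip'[OF that(2,1), of k] m.commute[of x z] by simp
  have hk_lim: "(\<lambda>k. hk k z) \<longlonglongrightarrow> h z" if z: "z \<in> ?X" for z
  proof (rule LIMSEQ_I)
    fix e :: real assume e: "0 < e"
    obtain r where r: "0 < r" "\<And>y. y \<in> ?X \<Longrightarrow> ?d z y < r \<Longrightarrow> \<bar>h y - h z\<bar> < e / 2"
      using continuous_map_linfD[OF h z half_gt_zero[OF e]] by metis
    \<comment> \<open>Beyond distance \<open>r\<close> the penalty is at least \<open>2 * B\<close>,
      so a distant point contributes at most \<open>h z\<close>, and only points near
      \<open>z\<close>, where \<open>h\<close> is close to \<open>h z\<close>, can raise the
      supremum.\<close>
    obtain k0 :: nat where k0: "2 * B / r < real k0" using reals_Archimedean2 by blast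
    have "norm (hk k z - h z) < e" if k: "k0 \<le> k" for k
    proof -
      have "hk k z \<le> h z + e / 2"
        unfolding hk_def
      proof (rule cSUP_least[OF ne])
        fix y assume y: "y \<in> ?X"
        show "h y - real (Suc k) * ?d y z \<le> h z + e / 2"
        proof (cases "?d z y < r")
          case True
          moreover have "0 \<le> real (Suc k) * ?d y z" by simp
          ultimately show ?thesis using r(2)[OF y] by linarith
        next
          case False
          have "2 * B / r \<le> real (Suc k)" using k0 k by simp
          then have "2 * B \<le> real (Suc k) * r" using r by (simp add: field_simps)
          also have "\<dots> \<le> real (Suc k) * ?d y z"
            using False m.commute[of z y] by (intro mult_left_mono) auto
          finally show ?thesis using bd[OF y] bd[OF z] e by linarith
        qed
      qed
      then show ?thesis using hk_ge[OF z, of k] e by simp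
    qed
    then show "\<exists>no. \<forall>n\<ge>no. norm (hk n z - h z) < e" by blast
  qed
  have hkm: "(\<lambda>v. hk k (Y v)) \<in> borel_measurable M'" for k
    by (rule borel_measurable_continuous_map[OF Y Lipschitz_linf_continuous[OF hk_lip]])
  have "(\<lambda>k. \<integral>v. hk k (Y v) \<partial>M') \<longlonglongrightarrow> (\<integral>v. h (Y v) \<partial>M')"
  proof (rule integral_dominated_convergence[where w = "\<lambda>_. B"])
    show "(\<lambda>v. h (Y v)) \<in> borel_measurable M'" by (rule borel_measurable_continuous_map[OF Y h])
    show "AE v in M'. (\<lambda>k. hk k (Y v)) \<longlonglongrightarrow> h (Y v)" by (intro AE_I2 hk_lim Y_in)
    show "AE v in M'. norm (hk k (Y v)) \<le> B" for k using hk_bd Y_in by (intro AE_I2) simp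
  qed (use hkm in auto)
  then have "\<forall>\<^sub>F k in sequentially. (\<integral>v. hk k (Y v) \<partial>M') < (\<integral>v. h (Y v) \<partial>M') + \<epsilon> / 2"
    using \<epsilon> by (intro order_tendstoD) auto
  then obtain k where k: "(\<integral>v. hk k (Y v) \<partial>M') < (\<integral>v. h (Y v) \<partial>M') + \<epsilon> / 2"
    by (auto simp: eventually_sequentially)
  have "\<forall>\<^sub>F n in sequentially. outer_exp M (\<lambda>\<omega>. hk k (restrict (\<lambda>t. Z n t \<omega>) T)) \<le> (\<integral>v. hk k (Y v) \<partial>M') + \<epsilon> / 2"
    using \<epsilon> by (intro limsup_outer_exp_Lipschitz[OF hk_lip _ hk_bd]) auto
  then show ?thesis
  proof eventually_elim
    case (elim n)
    have "outer_exp M (\<lambda>\<omega>. h (restrict (\<lambda>t. Z n t \<omega>) T)) \<le> outer_exp M (\<lambda>\<omega>. hk k (restrict (\<lambda>t. Z n t \<omega>) T))"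
      using Z_in bd hk_bd hk_ge by (intro outer_exp_mono[where B = B]) auto
    then show ?case using elim k by linarith
  qed
qed

lemma weak_convergence:
  assumes h: "continuous_map (linf_top T) euclideanreal h"
    and bd: "bounded (h ` topspace (linf_top T))"
  shows "(\<lambda>n. outer_exp M (\<lambda>\<omega>. h (restrict (\<lambda>t. Z n t \<omega>) T))) \<longlonglongrightarrow> (\<integral>v. h (Y v) \<partial>M')"
proof -
  obtain B where B: "\<And>x. x \<in> mspace (linf_metric T) \<Longrightarrow> \<bar>h x\<bar> \<le> B"
    using bd by (auto simp: bounded_iff linf_top_def)
  have h': "continuous_map (linf_top T) euclideanreal (\<lambda>z. - h z)"
    using h by (intro continuous_map_minus)
  have B': "\<bar>- h x\<bar> \<le> B" if "x \<in> mspace (linf_metric T)" for x using B[OF that] by simp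
  show ?thesis
  proof (rule LIMSEQ_I)
    fix e :: real assume e: "0 < e"
    have up: "\<forall>\<^sub>F n in sequentially. outer_exp M (\<lambda>\<omega>. h (restrict (\<lambda>t. Z n t \<omega>) T)) \<le> (\<integral>v. h (Y v) \<partial>M') + e / 2"
      by (rule limsup_outer_exp[OF h _ half_gt_zero[OF e]]) (rule B)
    have up': "\<forall>\<^sub>F n in sequentially. outer_exp M (\<lambda>\<omega>. - h (restrict (\<lambda>t. Z n t \<omega>) T)) \<le> (\<integral>v. - h (Y v) \<partial>M') + e / 2"
      by (rule limsup_outer_exp[OF h' _ half_gt_zero[OF e]]) (rule B')
    have "\<forall>\<^sub>F n in sequentially. norm (outer_exp M (\<lambda>\<omega>. h (restrict (\<lambda>t. Z n t \<omega>) T)) - (\<integral>v. h (Y v) \<partial>M')) < e"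
      using up up'
    proof eventually_elim
      case (elim n)
      have "- outer_exp M (\<lambda>\<omega>. - h (restrict (\<lambda>t. Z n t \<omega>) T)) \<le> outer_exp M (\<lambda>\<omega>. h (restrict (\<lambda>t. Z n t \<omega>) T))"
        using Z_in B by (intro outer_exp_uminus[where B = B]) auto
      then show ?case using elim e by auto
    qed
    then show "\<exists>no. \<forall>n\<ge>no. norm (outer_exp M (\<lambda>\<omega>. h (restrict (\<lambda>t. Z n t \<omega>) T)) - (\<integral>v. h (Y v) \<partial>M')) < e"
      by (simp add: eventually_sequentially)
  qed
qed

end

subsection \<open>The smoothed sequential process\<close>

locale smoothed_process = prob_space M
  for M :: "'w measure" +
  fixes MX :: "'x measure" and X :: "nat \<Rightarrow> nat \<Rightarrow> 'w \<Rightarrow> 'x"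
    and F :: "('x \<Rightarrow> real) set" and Fenv :: "'x \<Rightarrow> real"
    and \<rho> :: "('x \<Rightarrow> real) \<Rightarrow> ('x \<Rightarrow> real) \<Rightarrow> real"
    and \<A> :: "real set set"
  assumes X_meas: "\<And>n i. 1 \<le> i \<Longrightarrow> i \<le> n \<Longrightarrow> X i n \<in> measurable M MX"
    and F_meas: "F \<subseteq> borel_measurable MX"
    and env: "\<And>f x. f \<in> F \<Longrightarrow> x \<in> space MX \<Longrightarrow> \<bar>f x\<bar> \<le> Fenv x"
    and env_int: "\<And>n i. 1 \<le> i \<Longrightarrow> i \<le> n \<Longrightarrow> integrable M (\<lambda>\<omega>. Fenv (X i n \<omega>))"
    and rho: "semimetric_on F \<rho>"
    and reg: "\<And>A. A \<in> \<A> \<Longrightarrow> regular_set A"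
    and sep: "\<And>n. separable_process M (\<A> \<times> F) (tau_s \<rho>) (Zs M X n)"
begin

text \<open>Finiteness matters because \<open>measure\<close> is 0 on sets of infinite measure and
  hence is monotone only below a set of finite measure.\<close>

lemma symdiff_fmeasurable:
  assumes "A \<in> \<A>" "B \<in> \<A>"
  shows "symdiff A B \<in> fmeasurable lborel"
proof (rule fmeasurableI2)
  show "{0..1::real} \<in> fmeasurable lborel" by (intro fmeasurableI) auto
  show "symdiff A B \<subseteq> {0..1}" "symdiff A B \<in> sets lborel"
    using reg[OF assms(1)] reg[OF assms(2)] by (auto simp: symdiff_def regular_set_def)
qed

text \<open>The first summand inherits the triangle inequality from the inclusion of a symmetric
  difference in the union of two others, the square root being monotone and subadditive.\<close>

lemma semimetric_tau_s: "semimetric_on (\<A> \<times> F) (tau_s \<rho>)"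
  unfolding semimetric_on_def
proof (intro conjI ballI)
  fix s assume "s \<in> \<A> \<times> F"
  then show "tau_s \<rho> s s = 0" using rho by (auto simp: tau_s_def symdiff_def semimetric_on_def)
next
  fix s t assume "s \<in> \<A> \<times> F" "t \<in> \<A> \<times> F"
  then show "0 \<le> tau_s \<rho> s t" "tau_s \<rho> s t = tau_s \<rho> t s"
    using rho by (auto simp: tau_s_def symdiff_def semimetric_on_def Un_commute)
next
  fix s t u assume stu: "s \<in> \<A> \<times> F" "t \<in> \<A> \<times> F" "u \<in> \<A> \<times> F"
  let ?m = "\<lambda>s t. measure lborel (symdiff (fst s) (fst t))"
  have fm: "symdiff (fst s) (fst t) \<in> fmeasurable lborel" if "s \<in> \<A> \<times> F" "t \<in> \<A> \<times> F" for s t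
    using that by (intro symdiff_fmeasurable) auto
  have "?m s u \<le> measure lborel (symdiff (fst s) (fst t) \<union> symdiff (fst t) (fst u))"
    using fm[OF stu(1,2)] fm[OF stu(2,3)] fm[OF stu(1,3)]
    by (intro measure_mono_fmeasurable fmeasurable.Un) (auto simp: symdiff_def dest: fmeasurableD)
  also have "\<dots> \<le> ?m s t + ?m t u"
    using fm[OF stu(1,2)] fm[OF stu(2,3)] by (intro measure_Un_le fmeasurableD)
  finally have "sqrt (?m s u) \<le> sqrt (?m s t + ?m t u)" by simp
  also have "\<dots> \<le> sqrt (?m s t) + sqrt (?m t u)" by (rule sqrt_add_le_add_sqrt) auto
  finally show "tau_s \<rho> s u \<le> tau_s \<rho> s t + tau_s \<rho> t u"
    using rho stu unfolding tau_s_def semimetric_on_def by fastforce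
qed

lemma integrable_F:
  assumes "f \<in> F" "1 \<le> i" "i \<le> n"
  shows "integrable M (\<lambda>\<omega>. f (X i n \<omega>))"
proof (rule Bochner_Integration.integrable_bound[OF env_int[OF assms(2,3)]])
  show "(\<lambda>\<omega>. f (X i n \<omega>)) \<in> borel_measurable M"
    using F_meas assms X_meas by (intro measurable_compose[OF X_meas]) auto
  show "AE \<omega> in M. norm (f (X i n \<omega>)) \<le> norm (Fenv (X i n \<omega>))"
    using env[OF assms(1)] measurable_space[OF X_meas[OF assms(2,3)]] by (intro AE_I2) force
qed

lemma integrable_Zs:
  assumes "t \<in> \<A> \<times> F"
  shows "integrable M (Zs M X n t)"
proof -
  obtain A f where t: "t = (A, f)" "f \<in> F" using assms by auto
  show ?thesis
    unfolding t(1) Zs_def prod.case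
    using integrable_F[OF t(2)] by (intro integrable_mult_right Bochner_Integration.integrable_sum
        Bochner_Integration.integrable_diff integrable_const) auto
qed

text \<open>The weights are at most the length 1 of the cells, and the envelope controls all
  \<open>f\<close> at once, so every path, not just almost every one, lies in the space of bounded
  functions.\<close>

lemma bounded_Zs:
  assumes \<omega>: "\<omega> \<in> space M"
  shows "bounded ((\<lambda>t. Zs M X n t \<omega>) ` (\<A> \<times> F))"
proof -
  define b where "b = (1 / sqrt (real n)) * (\<Sum>i = 1..n. Fenv (X i n \<omega>) + expectation (\<lambda>\<eta>. Fenv (X i n \<eta>)))"
  have "\<bar>Zs M X n (A, f) \<omega>\<bar> \<le> b" if "f \<in> F" for A f
  proof -
    let ?m = "\<lambda>i. measure lborel ({real i - 1<..real i} \<inter> (\<lambda>x. real n * x) ` A)"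
    have m: "?m i \<le> 1" for i
    proof -
      have "emeasure lborel ({real i - 1<..real i} \<inter> (\<lambda>x. real n * x) ` A) \<le> emeasure lborel {real i - 1<..real i}"
        by (intro emeasure_mono) auto
      also have "\<dots> = 1" by simp
      finally have "enn2real (emeasure lborel ({real i - 1<..real i} \<inter> (\<lambda>x. real n * x) ` A)) \<le> enn2real 1"
        by (intro enn2real_mono) auto
      then show ?thesis by (simp add: measure_def)
    qed
    have "\<bar>Zs M X n (A, f) \<omega>\<bar> = (1 / sqrt (real n)) * \<bar>\<Sum>i = 1..n. ?m i * (f (X i n \<omega>) - expectation (\<lambda>\<eta>. f (X i n \<eta>)))\<bar>"
      by (simp add: Zs_def abs_mult)
    also have "\<dots> \<le> b"
      unfolding b_def
    proof (intro mult_left_mono order_trans[OF sum_abs] sum_mono)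
      fix i assume "i \<in> {1..n}"
      then have i: "1 \<le> i" "i \<le> n" by auto
      have 1: "\<bar>f (X i n \<eta>)\<bar> \<le> Fenv (X i n \<eta>)" if "\<eta> \<in> space M" for \<eta>
        using env[OF \<open>f \<in> F\<close>] measurable_space[OF X_meas[OF i]] that by blast
      have "\<bar>expectation (\<lambda>\<eta>. f (X i n \<eta>))\<bar> \<le> expectation (\<lambda>\<eta>. \<bar>f (X i n \<eta>)\<bar>)" by (rule integral_abs_bound)
      also have "\<dots> \<le> expectation (\<lambda>\<eta>. Fenv (X i n \<eta>))"
        using integrable_F[OF \<open>f \<in> F\<close> i] env_int[OF i] 1 by (intro integral_mono) auto
      finally have 2: "\<bar>f (X i n \<omega>) - expectation (\<lambda>\<eta>. f (X i n \<eta>))\<bar> \<le> Fenv (X i n \<omega>) + expectation (\<lambda>\<eta>. Fenv (X i n \<eta>))"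
        using 1[OF \<omega>] by linarith
      have "\<bar>?m i * (f (X i n \<omega>) - expectation (\<lambda>\<eta>. f (X i n \<eta>)))\<bar>
          \<le> 1 * \<bar>f (X i n \<omega>) - expectation (\<lambda>\<eta>. f (X i n \<eta>))\<bar>"
        unfolding abs_mult using m by (intro mult_right_mono) auto
      then show "\<bar>?m i * (f (X i n \<omega>) - expectation (\<lambda>\<eta>. f (X i n \<eta>)))\<bar>
          \<le> Fenv (X i n \<omega>) + expectation (\<lambda>\<eta>. Fenv (X i n \<eta>))" using 2 by (auto intro: order_trans)
    qed simp
    finally show ?thesis .
  qed
  then show ?thesis unfolding bounded_iff by (auto intro!: exI[of _ b])
qed

text \<open>The increment is split at \<open>(B, f)\<close>: conditions (i) and (ii) each control
  one leg, and the two scales add up because \<open>tau_s\<close> is a sum.\<close>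

lemma increment_orlicz_ball:
  assumes \<psi>: "young_function \<psi>" "mono_on {0..} \<psi>"
    and i: "\<forall>A\<in>\<A>. \<forall>B\<in>\<A>. \<forall>n.
        (SUP f\<in>F. orlicz_norm M \<psi> (\<lambda>\<omega>. Zs M X n (A, f) \<omega> - Zs M X n (B, f) \<omega>))
          \<le> ennreal (C1 * sqrt (measure lborel (symdiff A B)))"
    and ii: "\<forall>f\<in>F. \<forall>g\<in>F. \<forall>n.
        (SUP A\<in>\<A>. orlicz_norm M \<psi> (\<lambda>\<omega>. Zs M X n (A, f) \<omega> - Zs M X n (A, g) \<omega>))
          \<le> ennreal (C2 * \<rho> f g)"
    and C: "0 < C" "C1 \<le> C" "C2 \<le> C"
    and st: "s \<in> \<A> \<times> F" "t \<in> \<A> \<times> F" and r: "tau_s \<rho> s t < r"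
  shows "(\<integral>\<^sup>+\<omega>. ennreal (\<psi> (\<bar>Zs M X n s \<omega> - Zs M X n t \<omega>\<bar> / (C * r))) \<partial>M) \<le> 1"
proof -
  obtain A f B g where s: "s = (A, f)" and t: "t = (B, g)" by (metis surj_pair)
  then have mem: "A \<in> \<A>" "f \<in> F" "B \<in> \<A>" "g \<in> F" using st by auto
  define l where "l = sqrt (measure lborel (symdiff A B))"
  have l: "0 \<le> l" by (simp add: l_def)
  have \<rho>0: "0 \<le> \<rho> f g" using rho mem by (auto simp: semimetric_on_def)
  have r': "l + \<rho> f g < r" using r unfolding s t tau_s_def l_def by simp
  \<comment> \<open>Half of the slack in \<open>r\<close> goes to each leg, which makes both norm
    bounds strict, as \<open>orlicz_norm_lessD\<close> requires.\<close>
  define h where "h = (r - l - \<rho> f g) / 2"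
  have h: "0 < h" "(l + h) + (\<rho> f g + h) = r" using r' by (auto simp: h_def)
  have c1: "C1 * l < C * (l + h)"
    using C l h by (intro le_less_trans[OF mult_right_mono[OF C(2) l]] mult_strict_left_mono) auto
  have c2: "C2 * \<rho> f g < C * (\<rho> f g + h)"
    using C \<rho>0 h by (intro le_less_trans[OF mult_right_mono[OF C(3) \<rho>0]] mult_strict_left_mono) auto
  have pos: "0 < C * (l + h)" "0 < C * (\<rho> f g + h)" using C l \<rho>0 h by auto
  have "orlicz_norm M \<psi> (\<lambda>\<omega>. Zs M X n (A, f) \<omega> - Zs M X n (B, f) \<omega>)
      \<le> (SUP f\<in>F. orlicz_norm M \<psi> (\<lambda>\<omega>. Zs M X n (A, f) \<omega> - Zs M X n (B, f) \<omega>))"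
    by (rule SUP_upper[OF mem(2)])
  also have "\<dots> \<le> ennreal (C1 * l)" unfolding l_def using i mem by blast
  also have "\<dots> < ennreal (C * (l + h))" using c1 pos by (intro ennreal_lessI)
  finally have o1: "(\<integral>\<^sup>+\<omega>. ennreal (\<psi> (\<bar>Zs M X n (A, f) \<omega> - Zs M X n (B, f) \<omega>\<bar> / (C * (l + h)))) \<partial>M) \<le> 1"
    by (rule orlicz_norm_lessD[OF \<psi>(2)])
  have "orlicz_norm M \<psi> (\<lambda>\<omega>. Zs M X n (B, f) \<omega> - Zs M X n (B, g) \<omega>)
      \<le> (SUP B\<in>\<A>. orlicz_norm M \<psi> (\<lambda>\<omega>. Zs M X n (B, f) \<omega> - Zs M X n (B, g) \<omega>))"
    by (rule SUP_upper[OF mem(3)])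
  also have "\<dots> \<le> ennreal (C2 * \<rho> f g)" using ii mem by blast
  also have "\<dots> < ennreal (C * (\<rho> f g + h))" using c2 pos by (intro ennreal_lessI)
  finally have o2: "(\<integral>\<^sup>+\<omega>. ennreal (\<psi> (\<bar>Zs M X n (B, f) \<omega> - Zs M X n (B, g) \<omega>\<bar> / (C * (\<rho> f g + h)))) \<partial>M) \<le> 1"
    by (rule orlicz_norm_lessD[OF \<psi>(2)])
  have int: "integrable M (Zs M X n (A, f))" "integrable M (Zs M X n (B, f))" "integrable M (Zs M X n (B, g))"
    using mem by (auto intro: integrable_Zs)
  have "C * (l + h) + C * (\<rho> f g + h) = C * r" using h(2) by (simp flip: distrib_left)
  then show ?thesis
    using orlicz_ball_add[OF \<psi> pos _ _ o1 o2] int unfolding s t by (simp add: borel_measurable_integrable)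
qed

lemma equicontinuous_in_mean:
  assumes \<psi>: "young_function \<psi>" "mono_on {0..} \<psi>"
    and i: "\<exists>C1. \<forall>A\<in>\<A>. \<forall>B\<in>\<A>. \<forall>n.
        (SUP f\<in>F. orlicz_norm M \<psi> (\<lambda>\<omega>. Zs M X n (A, f) \<omega> - Zs M X n (B, f) \<omega>))
          \<le> ennreal (C1 * sqrt (measure lborel (symdiff A B)))"
    and ii: "\<exists>C2. \<forall>f\<in>F. \<forall>g\<in>F. \<forall>n.
        (SUP A\<in>\<A>. orlicz_norm M \<psi> (\<lambda>\<omega>. Zs M X n (A, f) \<omega> - Zs M X n (A, g) \<omega>))
          \<le> ennreal (C2 * \<rho> f g)"
    and iii: "(\<integral>\<^sup>+ \<epsilon> \<in> {\<epsilon>. 0 < \<epsilon> \<and> ereal \<epsilon> < diameter_d (\<A> \<times> F) (tau_s \<rho>)}.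
        psi_inv \<psi> (ennreal_of_enat (covering_number (\<A> \<times> F) (tau_s \<rho>) (\<epsilon> / 2))) \<partial>lborel)
       < \<infinity>"
    and \<epsilon>: "0 < \<epsilon>"
  shows "\<exists>\<eta>>0. \<forall>n. (\<integral>\<^sup>+\<omega>. osc (\<A> \<times> F) (tau_s \<rho>) (Zs M X n) \<eta> \<omega> \<partial>M) < ennreal \<epsilon>"
proof -
  obtain C1 C2 where C1: "\<forall>A\<in>\<A>. \<forall>B\<in>\<A>. \<forall>n.
        (SUP f\<in>F. orlicz_norm M \<psi> (\<lambda>\<omega>. Zs M X n (A, f) \<omega> - Zs M X n (B, f) \<omega>))
          \<le> ennreal (C1 * sqrt (measure lborel (symdiff A B)))"
    and C2: "\<forall>f\<in>F. \<forall>g\<in>F. \<forall>n.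
        (SUP A\<in>\<A>. orlicz_norm M \<psi> (\<lambda>\<omega>. Zs M X n (A, f) \<omega> - Zs M X n (A, g) \<omega>))
          \<le> ennreal (C2 * \<rho> f g)" using i ii by blast
  \<comment> \<open>The given constants may be zero or negative; chaining needs a positive
    scale.\<close>
  define C where "C = max 1 (max C1 C2)"
  have C: "0 < C" "C1 \<le> C" "C2 \<le> C" by (auto simp: C_def)
  \<comment> \<open>The bound that passes from finite subsets to the whole index set is not strict,
    so it is taken at \<open>\<epsilon> / 2\<close>.\<close>
  have "0 < \<epsilon> / 2" using \<epsilon> by simp
  from chaining_uniform[OF semimetric_tau_s \<psi> C(1) iii this] obtain \<eta> where \<eta>: "0 < \<eta>" and
    ch: "\<And>Z :: real set \<times> ('x \<Rightarrow> real) \<Rightarrow> 'w \<Rightarrow> real. (\<forall>t\<in>\<A> \<times> F. integrable M (Z t)) \<Longrightarrow>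
     (\<forall>s\<in>\<A> \<times> F. \<forall>t\<in>\<A> \<times> F. \<forall>r. tau_s \<rho> s t < r \<longrightarrow>
       (\<integral>\<^sup>+\<omega>. ennreal (\<psi> (\<bar>Z s \<omega> - Z t \<omega>\<bar> / (C * r))) \<partial>M) \<le> 1) \<Longrightarrow>
     (\<forall>T1. finite T1 \<longrightarrow> T1 \<subseteq> \<A> \<times> F \<longrightarrow> (\<integral>\<^sup>+\<omega>. osc T1 (tau_s \<rho>) Z \<eta> \<omega> \<partial>M) \<le> ennreal (\<epsilon> / 2))"
    unfolding osc_def by blast
  have "(\<integral>\<^sup>+\<omega>. osc (\<A> \<times> F) (tau_s \<rho>) (Zs M X n) \<eta> \<omega> \<partial>M) < ennreal \<epsilon>" for n
  proof -
    have "\<forall>T1. finite T1 \<longrightarrow> T1 \<subseteq> \<A> \<times> F \<longrightarrow> (\<integral>\<^sup>+\<omega>. osc T1 (tau_s \<rho>) (Zs M X n) \<eta> \<omega> \<partial>M) \<le> ennreal (\<epsilon> / 2)"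
      using increment_orlicz_ball[OF \<psi> C1 C2 C] by (intro ch ballI allI impI integrable_Zs)
    then have "(\<integral>\<^sup>+\<omega>. osc (\<A> \<times> F) (tau_s \<rho>) (Zs M X n) \<eta> \<omega> \<partial>M) \<le> ennreal (\<epsilon> / 2)"
      using integrable_Zs by (intro nn_integral_osc_le[OF sep \<eta>]) auto
    also have "\<dots> < ennreal \<epsilon>" using \<epsilon> by (intro ennreal_lessI) auto
    finally show ?thesis .
  qed
  then show ?thesis using \<eta> by blast
qed

lemma asymptotic_equicontinuity:
  assumes eq: "\<And>\<epsilon>. 0 < \<epsilon> \<Longrightarrow> \<exists>\<eta>>0. \<forall>n. (\<integral>\<^sup>+\<omega>. osc (\<A> \<times> F) (tau_s \<rho>) (Zs M X n) \<eta> \<omega> \<partial>M) < ennreal \<epsilon>"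
    and \<epsilon>: "0 < \<epsilon>"
  shows "((\<lambda>\<delta>. limsup (\<lambda>n. ereal (outer_prob M
          {\<omega>. \<exists>s\<in>\<A> \<times> F. \<exists>t\<in>\<A> \<times> F. tau_s \<rho> s t \<le> \<delta> \<and> \<bar>Zs M X n s \<omega> - Zs M X n t \<omega>\<bar> > \<epsilon>}))) \<longlongrightarrow> 0) (at_right 0)"
    (is "((\<lambda>\<delta>. limsup (\<lambda>n. ereal (?P \<delta> n))) \<longlongrightarrow> 0) _")
proof (rule order_tendstoI)
  fix a :: ereal assume a: "a < 0"
  have "0 \<le> limsup (\<lambda>n. ereal (?P \<delta> n))" for \<delta>
    by (rule le_Limsup) (auto simp: outer_prob_nonneg)
  then have "a < limsup (\<lambda>n. ereal (?P \<delta> n))" for \<delta> using a by (rule less_le_trans[rotated])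
  then show "\<forall>\<^sub>F \<delta> in at_right 0. a < limsup (\<lambda>n. ereal (?P \<delta> n))" by simp
next
  fix a :: ereal assume "0 < a"
  then obtain e where e: "0 < e" "ereal e < a" using ereal_dense2[of 0 a] by auto
  \<comment> \<open>Markov's inequality at level \<open>\<epsilon>\<close> turns the mean bound
    \<open>\<epsilon> * e\<close> into the probability bound \<open>e\<close>, for every
    \<open>n\<close> at once.\<close>
  obtain \<eta> where \<eta>: "0 < \<eta>" and osc: "\<And>n. (\<integral>\<^sup>+\<omega>. osc (\<A> \<times> F) (tau_s \<rho>) (Zs M X n) \<eta> \<omega> \<partial>M) < ennreal (\<epsilon> * e)"
    using eq[of "\<epsilon> * e"] e \<epsilon> by auto
  have "limsup (\<lambda>n. ereal (?P \<delta> n)) < a" if "\<delta> < \<eta>" for \<delta>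
  proof -
    have "?P \<delta> n \<le> e" for n
      using osc[of n] \<epsilon> e \<eta> that integrable_Zs by (intro outer_prob_osc_le[OF sep \<eta>]) (auto intro: less_imp_le)
    then have "limsup (\<lambda>n. ereal (?P \<delta> n)) \<le> ereal e" by (intro Limsup_bounded) auto
    then show ?thesis using e(2) by (rule le_less_trans)
  qed
  then show "\<forall>\<^sub>F \<delta> in at_right 0. limsup (\<lambda>n. ereal (?P \<delta> n)) < a"
    unfolding eventually_at_right_field using \<eta> by blast
qed

lemma weak_convergence_Zs:
  fixes M' :: "'v measure"
  assumes eq: "\<And>\<epsilon>. 0 < \<epsilon> \<Longrightarrow> \<exists>\<eta>>0. \<forall>n. (\<integral>\<^sup>+\<omega>. osc (\<A> \<times> F) (tau_s \<rho>) (Zs M X n) \<eta> \<omega> \<partial>M) < ennreal \<epsilon>"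
    and cov: "\<And>\<epsilon>. 0 < \<epsilon> \<Longrightarrow> covering_number (\<A> \<times> F) (tau_s \<rho>) \<epsilon> < \<infinity>"
    and M': "prob_space M'"
    and Z: "Z \<in> measurable M' (borel_of_top (linf_top (\<A> \<times> F)))"
    and tight: "\<forall>e>0. \<exists>K. compactin (linf_top (\<A> \<times> F)) K \<and> measure M' (Z -` K \<inter> space M') \<ge> 1 - e"
    and fidi: "\<forall>ts. set ts \<subseteq> \<A> \<times> F \<longrightarrow>
       (\<forall>g :: (nat \<Rightarrow> real) \<Rightarrow> real. continuous_on UNIV g \<and> bounded (range g) \<longrightarrow>
          (\<lambda>n. \<integral>\<omega>. g (\<lambda>j. if j < length ts then Zs M X n (ts ! j) \<omega> else 0) \<partial>M)
          \<longlonglongrightarrow> (\<integral>v. g (\<lambda>j. if j < length ts then Z v (ts ! j) else 0) \<partial>M'))"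
    and h: "continuous_map (linf_top (\<A> \<times> F)) euclideanreal h" "bounded (h ` topspace (linf_top (\<A> \<times> F)))"
  shows "(\<lambda>n. outer_exp M (\<lambda>\<omega>. h (restrict (\<lambda>t. Zs M X n t \<omega>) (\<A> \<times> F)))) \<longlonglongrightarrow> (\<integral>v. h (Z v) \<partial>M')"
proof -
  interpret W: asymp_equicontinuous M M' "\<A> \<times> F" "tau_s \<rho>" "Zs M X" Z
  proof (intro asymp_equicontinuous.intro asymp_equicontinuous_axioms.intro)
    show "prob_space M" by (rule prob_space_axioms)
    show "Zs M X n t \<in> borel_measurable M" if "t \<in> \<A> \<times> F" for n t
      using integrable_Zs[OF that] by (rule borel_measurable_integrable)
    show "\<exists>S. finite S \<and> S \<subseteq> \<A> \<times> F \<and> (\<forall>t\<in>\<A> \<times> F. \<exists>s\<in>S. tau_s \<rho> s t < \<epsilon>)" if "0 < \<epsilon>" for \<epsilon>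
    proof (rule covering_number_net[OF cov[OF that]])
      fix S assume S: "finite S" "S \<subseteq> \<A> \<times> F" "\<And>t. t \<in> \<A> \<times> F \<Longrightarrow> \<exists>s\<in>S. tau_s \<rho> s t < \<epsilon>"
      show ?thesis by (intro exI[of _ S] conjI ballI) (fact S)+
    qed
    show "bounded ((\<lambda>t. Zs M X n t \<omega>) ` (\<A> \<times> F))" if "\<omega> \<in> space M" for n \<omega>
      by (rule bounded_Zs[OF that])
    show "\<exists>K. compactin (linf_top (\<A> \<times> F)) K \<and> measure M' (Z -` K \<inter> space M') \<ge> 1 - e" if "0 < e" for e
      using tight that by (elim allE impE)
    show "(\<lambda>n. \<integral>\<omega>. g (\<lambda>j. if j < length ts then Zs M X n (ts ! j) \<omega> else 0) \<partial>M)
        \<longlonglongrightarrow> (\<integral>v. g (\<lambda>j. if j < length ts then Z v (ts ! j) else 0) \<partial>M')"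
      if "set ts \<subseteq> \<A> \<times> F" "continuous_on UNIV g" "bounded (range g)" for ts and g :: "(nat \<Rightarrow> real) \<Rightarrow> real"
      by (rule fidi[rule_format, OF that(1) conjI[OF that(2,3)]])
  qed (fact M' sep eq Z)+
  show ?thesis by (rule W.weak_convergence[OF h])
qed

lemma AE_bounded_uniformly_continuous_Zs:
  assumes eq: "\<And>\<epsilon>. 0 < \<epsilon> \<Longrightarrow> \<exists>\<eta>>0. \<forall>n. (\<integral>\<^sup>+\<omega>. osc (\<A> \<times> F) (tau_s \<rho>) (Zs M X n) \<eta> \<omega> \<partial>M) < ennreal \<epsilon>"
  shows "AE \<omega> in M. bounded ((\<lambda>t. Zs M X n t \<omega>) ` (\<A> \<times> F)) \<and>
     (\<forall>e>0. \<exists>\<delta>>0. \<forall>s\<in>\<A> \<times> F. \<forall>t\<in>\<A> \<times> F. tau_s \<rho> s t < \<delta> \<longrightarrow> \<bar>Zs M X n s \<omega> - Zs M X n t \<omega>\<bar> < e)"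
proof -
  have "AE \<omega> in M. \<forall>e>0. \<exists>\<delta>>0. \<forall>s\<in>\<A> \<times> F. \<forall>t\<in>\<A> \<times> F. tau_s \<rho> s t < \<delta> \<longrightarrow> \<bar>Zs M X n s \<omega> - Zs M X n t \<omega>\<bar> < e"
  proof (rule AE_uniformly_continuous_paths[OF sep])
    show "Zs M X n t \<in> borel_measurable M" if "t \<in> \<A> \<times> F" for t
      using integrable_Zs[OF that] by (rule borel_measurable_integrable)
    show "\<exists>\<eta>>0. (\<integral>\<^sup>+\<omega>. osc (\<A> \<times> F) (tau_s \<rho>) (Zs M X n) \<eta> \<omega> \<partial>M) < ennreal \<epsilon>" if "0 < \<epsilon>" for \<epsilon>
      using eq[OF that] by blast
  qed
  with AE_space show ?thesis by eventually_elim (intro conjI bounded_Zs)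
qed

end

section \<open>Power functions and polynomial covering numbers\<close>

text \<open>Inside the half-line this is convexity of powers. With an end point at 0 it reduces to
  \<open>(w * z) powr p \<le> w * z powr p\<close>, which holds because
  \<open>w powr p \<le> w\<close> for weights between 0 and 1.\<close>

lemma young_function_powr:
  assumes p: "1 \<le> p"
  shows "young_function (\<lambda>x. x powr p)" "mono_on {0..} (\<lambda>x. x powr p)"
proof -
  have sub: "(w * z) powr p \<le> w * z powr p" if "0 \<le> w" "w \<le> 1" "0 \<le> z" for w z :: real
  proof -
    have "w powr p \<le> w powr 1" using that p by (intro powr_mono')
    then have "w powr p * z powr p \<le> w * z powr p" using that by (intro mult_right_mono) auto
    then show ?thesis using that by (simp add: powr_mult)
  qed
  have "convex_on {0..} (\<lambda>x. x powr p)"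
    unfolding convex_on_def
  proof (intro conjI ballI allI impI)
    fix x y u v :: real assume *: "x \<in> {0..}" "y \<in> {0..}" "0 \<le> u" "0 \<le> v" "u + v = 1"
    show "(u *\<^sub>R x + v *\<^sub>R y) powr p \<le> u * x powr p + v * y powr p"
    proof (cases "x = 0 \<or> y = 0")
      case True
      then show ?thesis using * sub[of v y] sub[of u x] p by auto
    next
      case False
      then have "x \<in> {0<..}" "y \<in> {0<..}" using * by auto
      then show ?thesis using * powr_convex[OF p] unfolding convex_on_def by blast
    qed
  qed auto
  then show "young_function (\<lambda>x. x powr p)"
    using p by (auto simp: young_function_def intro!: exI[of _ 1])
  show "mono_on {0..} (\<lambda>x. x powr p)" using p by (auto intro!: mono_onI powr_mono2)
qed

lemma psi_inv_powr_le:
  assumes "0 < p" "0 \<le> c" "y \<le> ennreal (c powr p)"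
  shows "psi_inv (\<lambda>x. x powr p) y \<le> ennreal c"
  unfolding psi_inv_def
proof (intro Sup_least, elim CollectE exE conjE)
  fix z x assume x: "z = ennreal x" "0 \<le> x" "ennreal (x powr p) \<le> y"
  have "x powr p \<le> c powr p" using order_trans[OF x(3) assms(3)] by (simp add: ennreal_le_iff)
  then have "x \<le> c" using assms x by (metis not_le powr_less_mono2)
  then show "z \<le> ennreal c" using x by (simp add: ennreal_leI)
qed

text \<open>The inverse of the power is \<open>y powr (1 / p)\<close>, so near 0 the integrand is of
  order \<open>\<epsilon> powr (- a / p)\<close>, which is integrable since \<open>a < p\<close>.
  Away from 0 it is bounded by monotonicity, and the diameter is finite.\<close>

lemma polynomial_entropy_integral_finite:
  assumes d: "semimetric_on T d" and a: "0 < a" and p: "max a 1 < p"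
    and N: "\<forall>\<^sub>F \<epsilon> in at_right 0. ennreal_of_enat (covering_number T d \<epsilon>) \<le> ennreal (K * \<epsilon> powr (- a))"
  shows "(\<integral>\<^sup>+ \<epsilon> \<in> {\<epsilon>. 0 < \<epsilon> \<and> ereal \<epsilon> < diameter_d T d}.
      psi_inv (\<lambda>x. x powr p) (ennreal_of_enat (covering_number T d (\<epsilon> / 2))) \<partial>lborel) < \<infinity>"
proof -
  \<comment> \<open>The given \<open>K\<close> may fail to be positive; positivity is needed to take
    the root \<open>1 / p\<close> and undo it.\<close>
  define K' where "K' = max K 1"
  have K': "0 < K'" "K \<le> K'" by (auto simp: K'_def)
  have p0: "0 < p" using p by simp
  obtain b where b: "0 < b" and Nb: "\<And>\<epsilon>. 0 < \<epsilon> \<Longrightarrow> \<epsilon> < b \<Longrightarrow>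
      ennreal_of_enat (covering_number T d \<epsilon>) \<le> ennreal (K * \<epsilon> powr (- a))"
    using N unfolding eventually_at_right_field by auto
  have Nb': "ennreal_of_enat (covering_number T d \<epsilon>) \<le> ennreal (K' * \<epsilon> powr (- a))" if "0 < \<epsilon>" "\<epsilon> < b" for \<epsilon>
    using order_trans[OF Nb[OF that] ennreal_leI[OF mult_right_mono[OF K'(2)]]] by simp
  have psi_bd: "psi_inv (\<lambda>x. x powr p) (ennreal_of_enat (covering_number T d (\<epsilon> / 2)))
      \<le> ennreal ((K' * (e / 2) powr (- a)) powr (1 / p))" if "0 < e" "e < 2 * b" "e \<le> \<epsilon>" for e \<epsilon>
  proof (rule psi_inv_powr_le[OF p0])
    have "ennreal_of_enat (covering_number T d (\<epsilon> / 2)) \<le> ennreal_of_enat (covering_number T d (e / 2))"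
      using that by (intro ennreal_of_enat_mono covering_number_antimono) auto
    also have "\<dots> \<le> ennreal (K' * (e / 2) powr (- a))" using that by (intro Nb') auto
    also have "K' * (e / 2) powr (- a) = ((K' * (e / 2) powr (- a)) powr (1 / p)) powr p"
      using K' p0 that by (simp add: powr_powr)
    finally show "ennreal_of_enat (covering_number T d (\<epsilon> / 2))
      \<le> ennreal (((K' * (e / 2) powr (- a)) powr (1 / p)) powr p)" .
  qed simp
  have "covering_number T d (b / 2) < \<infinity>"
  proof (rule ccontr)
    assume "\<not> ?thesis"
    then have "ennreal_of_enat (covering_number T d (b / 2)) = \<top>" by simp
    then show False using Nb'[of "b / 2"] b by (simp add: top_unique)
  qed
  then obtain S where S: "finite S" "S \<subseteq> T" "\<And>t. t \<in> T \<Longrightarrow> \<exists>s\<in>S. d s t < b / 2"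
    using covering_number_net by metis
  \<comment> \<open>Any two points lie within \<open>b / 2\<close> of net points, so their distance
    is at most \<open>b\<close> plus one distance between net points, which the sum over all pairs
    dominates.\<close>
  define D where "D = b + (\<Sum>x\<in>S \<times> S. d (fst x) (snd x))"
  have dS: "0 \<le> d (fst x) (snd x)" if "x \<in> S \<times> S" for x
  proof -
    have "fst x \<in> T" "snd x \<in> T" using that S(2) by auto
    then show ?thesis using d by (auto simp: semimetric_on_def)
  qed
  have D0: "0 \<le> D" unfolding D_def using b dS by (intro add_nonneg_nonneg sum_nonneg) auto
  have diam: "diameter_d T d \<le> ereal D"
    unfolding diameter_d_def
  proof (intro Sup_least, elim CollectE exE conjE)
    fix x s t assume x: "x = ereal (d s t)" and st: "s \<in> T" "t \<in> T"
    obtain s' t' where st': "s' \<in> S" "d s' s < b / 2" "t' \<in> S" "d t' t < b / 2" using S(3) st by meson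
    have mem: "s' \<in> T" "t' \<in> T" using st' S by auto
    have "d s t \<le> d s s' + d s' t" "d s' t \<le> d s' t' + d t' t" "d s s' = d s' s"
      using d st mem unfolding semimetric_on_def by blast+
    moreover have "d (fst (s', t')) (snd (s', t')) \<le> (\<Sum>x\<in>S \<times> S. d (fst x) (snd x))"
      using st' S(1) dS by (intro member_le_sum) auto
    ultimately have "d s t \<le> D" using st' unfolding D_def by simp
    then show "x \<le> ereal D" by (simp add: x)
  qed
  define q where "q = - a / p"
  have q: "- 1 < q" using p a p0 by (simp add: q_def field_simps)
  define c1 where "c1 = K' powr (1 / p) * 2 powr (a / p)"
  define c2 where "c2 = (K' * (b / 2) powr (- a)) powr (1 / p)"
  have c1: "(K' * (\<epsilon> / 2) powr (- a)) powr (1 / p) = c1 * \<epsilon> powr q" if "0 < \<epsilon>" for \<epsilon>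
    using that K' by (simp add: c1_def q_def powr_mult powr_divide powr_powr powr_minus field_simps)
  let ?f = "\<lambda>\<epsilon>. if \<epsilon> \<in> {0..D} then \<epsilon> powr q else 0"
  have "(?f has_integral (D powr (q + 1) / (q + 1))) UNIV"
    using has_integral_powr_from_0[OF q D0] by (simp only: has_integral_restrict_UNIV)
  then have I: "integral\<^sup>N lborel (\<lambda>\<epsilon>. ennreal (?f \<epsilon>)) = ennreal (D powr (q + 1) / (q + 1))"
    by (intro nn_integral_has_integral_lborel) auto
  let ?D = "{\<epsilon>. 0 < \<epsilon> \<and> ereal \<epsilon> < diameter_d T d}"
  have "(\<integral>\<^sup>+ \<epsilon> \<in> ?D. psi_inv (\<lambda>x. x powr p) (ennreal_of_enat (covering_number T d (\<epsilon> / 2))) \<partial>lborel)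
      \<le> (\<integral>\<^sup>+ \<epsilon>. ennreal c1 * ennreal (?f \<epsilon>) + ennreal c2 * indicator {0..D} \<epsilon> \<partial>lborel)"
  proof (rule nn_integral_mono)
    fix \<epsilon> :: real
    show "psi_inv (\<lambda>x. x powr p) (ennreal_of_enat (covering_number T d (\<epsilon> / 2))) * indicator ?D \<epsilon>
       \<le> ennreal c1 * ennreal (?f \<epsilon>) + ennreal c2 * indicator {0..D} \<epsilon>"
    proof (cases "\<epsilon> \<in> ?D")
      case True
      then have \<epsilon>: "0 < \<epsilon>" "ereal \<epsilon> < ereal D" using less_le_trans[OF _ diam] by blast+
      then have \<epsilon>': "\<epsilon> \<in> {0..D}" by simp
      show ?thesis
      proof (cases "\<epsilon> < 2 * b")
        case True
        have "psi_inv (\<lambda>x. x powr p) (ennreal_of_enat (covering_number T d (\<epsilon> / 2))) \<le> ennreal (c1 * \<epsilon> powr q)"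
          using psi_bd[OF \<epsilon>(1) True order_refl] unfolding c1[OF \<epsilon>(1)] .
        also have "\<dots> = ennreal c1 * ennreal (?f \<epsilon>)" using \<epsilon>' by (simp add: ennreal_mult c1_def)
        finally show ?thesis using \<open>\<epsilon> \<in> ?D\<close> by (simp add: add_increasing2)
      next
        case False
        have "psi_inv (\<lambda>x. x powr p) (ennreal_of_enat (covering_number T d (\<epsilon> / 2))) \<le> ennreal c2"
          unfolding c2_def using False b by (intro psi_bd) auto
        then show ?thesis using \<open>\<epsilon> \<in> ?D\<close> \<epsilon>' by (simp add: add_increasing)
      qed
    qed simp
  qed
  also have "\<dots> = ennreal c1 * (\<integral>\<^sup>+ \<epsilon>. ennreal (?f \<epsilon>) \<partial>lborel) + ennreal c2 * emeasure lborel {0..D}"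
    by (subst nn_integral_add) (auto simp: nn_integral_cmult nn_integral_cmult_indicator)
  also have "\<dots> < \<infinity>" unfolding I using D0 by (simp add: ennreal_mult_less_top)
  finally show ?thesis .
qed

theorem theorem3p1:
  fixes M :: "'w measure" and MX :: "'x measure"
    and X :: "nat \<Rightarrow> nat \<Rightarrow> 'w \<Rightarrow> 'x"
    and F :: "('x \<Rightarrow> real) set" and Fenv :: "'x \<Rightarrow> real"
    and \<rho> :: "('x \<Rightarrow> real) \<Rightarrow> ('x \<Rightarrow> real) \<Rightarrow> real"
    and \<A> :: "real set set"
    and \<psi> :: "real \<Rightarrow> real"
  assumes P: "prob_space M"
    and X_meas: "\<And>n i. 1 \<le> i \<Longrightarrow> i \<le> n \<Longrightarrow> X i n \<in> measurable M MX"
    and F_meas: "F \<subseteq> borel_measurable MX"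
    and env_meas: "Fenv \<in> borel_measurable MX"
    and env: "\<And>f x. f \<in> F \<Longrightarrow> x \<in> space MX \<Longrightarrow> \<bar>f x\<bar> \<le> Fenv x"
    and env_int: "\<And>n i. 1 \<le> i \<Longrightarrow> i \<le> n \<Longrightarrow> integrable M (\<lambda>\<omega>. Fenv (X i n \<omega>))"
    and rho: "semimetric_on F \<rho>"
    and reg: "\<And>A. A \<in> \<A> \<Longrightarrow> regular_set A"
    and sep: "\<And>n. separable_process M (\<A> \<times> F) (tau_s \<rho>) (Zs M X n)"
  shows
   "(young_function \<psi> \<and> mono_on {0..} \<psi> \<and>
     (\<exists>c>0. Limsup (at_top \<times>\<^sub>F at_top)
              (\<lambda>(x, y). ereal (\<psi> x * \<psi> y / \<psi> (c * x * y))) < \<infinity>) \<and>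
     (\<forall>Y \<in> borel_measurable M. (\<integral>\<^sup>+ \<omega>. ennreal \<bar>Y \<omega>\<bar> \<partial>M) \<le> orlicz_norm M \<psi> Y) \<and>
     (\<exists>C1. \<forall>A\<in>\<A>. \<forall>B\<in>\<A>. \<forall>n.
        (SUP f\<in>F. orlicz_norm M \<psi> (\<lambda>\<omega>. Zs M X n (A, f) \<omega> - Zs M X n (B, f) \<omega>))
          \<le> ennreal (C1 * sqrt (measure lborel (symdiff A B)))) \<and>
     (\<exists>C2. \<forall>f\<in>F. \<forall>g\<in>F. \<forall>n.
        (SUP A\<in>\<A>. orlicz_norm M \<psi> (\<lambda>\<omega>. Zs M X n (A, f) \<omega> - Zs M X n (A, g) \<omega>))
          \<le> ennreal (C2 * \<rho> f g)) \<and>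
     (\<integral>\<^sup>+ \<epsilon> \<in> {\<epsilon>. 0 < \<epsilon> \<and> ereal \<epsilon> < diameter_d (\<A> \<times> F) (tau_s \<rho>)}.
        psi_inv \<psi> (ennreal_of_enat (covering_number (\<A> \<times> F) (tau_s \<rho>) (\<epsilon> / 2))) \<partial>lborel)
       < \<infinity>
   \<longrightarrow>
     (\<forall>\<epsilon>>0. \<exists>\<eta>>0. \<forall>n.
        (\<integral>\<^sup>+ \<omega>. (SUP st\<in>{(s, t). s \<in> \<A> \<times> F \<and> t \<in> \<A> \<times> F \<and> tau_s \<rho> s t < \<eta>}.
                     ennreal \<bar>Zs M X n (fst st) \<omega> - Zs M X n (snd st) \<omega>\<bar>) \<partial>M)
          < ennreal \<epsilon>) \<and>
     (\<forall>\<epsilon>>0. ((\<lambda>\<delta>. limsup (\<lambda>n. ereal (outer_prob M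
          {\<omega>. \<exists>s\<in>\<A> \<times> F. \<exists>t\<in>\<A> \<times> F. tau_s \<rho> s t \<le> \<delta> \<and>
                \<bar>Zs M X n s \<omega> - Zs M X n t \<omega>\<bar> > \<epsilon>}))) \<longlongrightarrow> 0) (at_right 0)) \<and>
     (\<forall>(M' :: 'v measure) Z.
        prob_space M' \<and>
        Z \<in> measurable M' (borel_of_top (linf_top (\<A> \<times> F))) \<and>
        (\<forall>e>0. \<exists>K. compactin (linf_top (\<A> \<times> F)) K \<and>
                    measure M' (Z -` K \<inter> space M') \<ge> 1 - e) \<and>
        (\<forall>ts. set ts \<subseteq> \<A> \<times> F \<longrightarrow>
           (\<forall>g :: (nat \<Rightarrow> real) \<Rightarrow> real. continuous_on UNIV g \<and> bounded (range g) \<longrightarrow>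
              (\<lambda>n. \<integral>\<omega>. g (\<lambda>j. if j < length ts then Zs M X n (ts ! j) \<omega> else 0) \<partial>M)
              \<longlonglongrightarrow> (\<integral>v. g (\<lambda>j. if j < length ts then Z v (ts ! j) else 0) \<partial>M')))
        \<longrightarrow>
        (\<forall>h. continuous_map (linf_top (\<A> \<times> F)) euclideanreal h \<and>
             bounded (h ` topspace (linf_top (\<A> \<times> F))) \<longrightarrow>
           (\<lambda>n. outer_exp M (\<lambda>\<omega>. h (restrict (\<lambda>t. Zs M X n t \<omega>) (\<A> \<times> F))))
           \<longlonglongrightarrow> (\<integral>v. h (Z v) \<partial>M'))))
   \<and>
   (\<forall>a p. 0 < a \<and> max a 1 < p \<and>
      (\<exists>K. \<forall>\<^sub>F \<epsilon> in at_right 0.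
          ennreal_of_enat (covering_number (\<A> \<times> F) (tau_s \<rho>) \<epsilon>) \<le> ennreal (K * \<epsilon> powr (- a)))
    \<longrightarrow>
      (\<integral>\<^sup>+ \<epsilon> \<in> {\<epsilon>. 0 < \<epsilon> \<and> ereal \<epsilon> < diameter_d (\<A> \<times> F) (tau_s \<rho>)}.
         psi_inv (\<lambda>x. x powr p)
           (ennreal_of_enat (covering_number (\<A> \<times> F) (tau_s \<rho>) (\<epsilon> / 2))) \<partial>lborel) < \<infinity>
      \<and>
      ((\<exists>C1. \<forall>A\<in>\<A>. \<forall>B\<in>\<A>. \<forall>n.
          (SUP f\<in>F. orlicz_norm M (\<lambda>x. x powr p) (\<lambda>\<omega>. Zs M X n (A, f) \<omega> - Zs M X n (B, f) \<omega>))
            \<le> ennreal (C1 * sqrt (measure lborel (symdiff A B)))) \<and>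
       (\<exists>C2. \<forall>f\<in>F. \<forall>g\<in>F. \<forall>n.
          (SUP A\<in>\<A>. orlicz_norm M (\<lambda>x. x powr p) (\<lambda>\<omega>. Zs M X n (A, f) \<omega> - Zs M X n (A, g) \<omega>))
            \<le> ennreal (C2 * \<rho> f g))
       \<longrightarrow>
       (\<forall>n. \<exists>Zt :: real set \<times> ('x \<Rightarrow> real) \<Rightarrow> 'w \<Rightarrow> real.
          (\<forall>t\<in>\<A> \<times> F. Zt t \<in> borel_measurable M \<and> (AE \<omega> in M. Zt t \<omega> = Zs M X n t \<omega>)) \<and>
          (AE \<omega> in M. bounded ((\<lambda>t. Zt t \<omega>) ` (\<A> \<times> F)) \<and>
             (\<forall>e>0. \<exists>\<delta>>0. \<forall>s\<in>\<A> \<times> F. \<forall>t\<in>\<A> \<times> F.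
                tau_s \<rho> s t < \<delta> \<longrightarrow> \<bar>Zt s \<omega> - Zt t \<omega>\<bar> < e)))))"
proof -
  interpret smoothed_process M MX X F Fenv \<rho> \<A>
  proof (rule smoothed_process.intro)
    show "prob_space M" by (rule P)
    show "smoothed_process_axioms M MX X F Fenv \<rho> \<A>"
      by (rule smoothed_process_axioms.intro) fact+
  qed
  show ?thesis
  proof (rule conjI[OF impI], goal_cases)
    case 1
    note \<psi> = 1[THEN conjunct1] 1[THEN conjunct2, THEN conjunct1]
    note bounds = 1[THEN conjunct2, THEN conjunct2, THEN conjunct2, THEN conjunct2]
    note eq = equicontinuous_in_mean[OF \<psi> bounds[THEN conjunct1] bounds[THEN conjunct2, THEN conjunct1]
        bounds[THEN conjunct2, THEN conjunct2]]
    note cov = entropy_covering_finite[OF semimetric_tau_s \<psi> bounds[THEN conjunct2, THEN conjunct2]]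
    show ?case
    proof (intro conjI, goal_cases)
      case 1
      show ?case using eq unfolding osc_def by (intro allI impI)
    next
      case 2
      show ?case by (intro allI impI asymptotic_equicontinuity[OF eq])
    next
      case 3
      show ?case
        by (intro allI impI, elim conjE) (rule weak_convergence_Zs[OF eq cov])
    qed
  next
    case 2
    show ?case
    proof (intro allI impI, elim conjE exE, goal_cases)
      case (1 a p K)
      note iii = polynomial_entropy_integral_finite[OF semimetric_tau_s 1]
      have p: "1 \<le> p" using 1 by simp
      show ?case
      proof (intro conjI impI allI, rule iii, elim conjE, goal_cases)
        case (1 n)
        \<comment> \<open>The integral condition for the power function is derived here, not
          assumed, and then feeds the same equicontinuity bound as in the first half.\<close>
        note eq = equicontinuous_in_mean[OF young_function_powr[OF p] 1 iii]
        show ?case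
          using AE_bounded_uniformly_continuous_Zs[OF eq] integrable_Zs
          by (intro exI[of _ "Zs M X n"]) (simp add: borel_measurable_integrable)
      qed
    qed
  qed
qed

end
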